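(* Let $\widehat R=\mathrm k[[x_1,\dots,x_n]]$ or $\mathrm k\{x_1,\dots,x_n\}$, $\widehat P=(x_1,\dots,x_c)$, and let $I\subset\widehat R$ be an ideal with Schreyer resolution $$0\to\widehat R^{m_k}\xrightarrow{F_k}\cdots\xrightarrow{F_2}\widehat R^{m_1}\xrightarrow{F_1}\widehat R^{m_0}\xrightarrow{F_0}\widehat R\to\widehat R/I\to0$$ and associated orders $\mathrm a^{(i)}_l$ (with $\mathrm a_l:=\mathrm a^{(0)}_l$), constructed with respect to $\operatorname{ord}_{\widehat P}$ as in the context. Then for every integer $r$ the sequence $$0\to\bigoplus_{l=1}^{m_k}\widehat P^{\,r-\mathrm a^{(k)}_l}\xrightarrow{F_k}\cdots\xrightarrow{F_2}\bigoplus_{l=1}^{m_1}\widehat P^{\,r-\mathrm a^{(1)}_l}\xrightarrow{F_1}\bigoplus_{l=1}^{m_0}\widehat P^{\,r-\mathrm a_l}\xrightarrow{F_0}\widehat P^{\,r}\to\widehat P^{\,r}/(\widehat P^{\,r}\cap I)\to0$$ is exact, where $\widehat P^{\,i}=\widehat R$ for $i\le0$.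
   Context: $\operatorname{ord}_{\widehat P}(f)=\max\{j: f\in\widehat P^{\,j}\}$. Monomials are compared first by $\widehat P$-degree (degree in $x_1,\dots,x_c$), then by a fixed lexicographic order in $x_1,\dots,x_c$, then by $\mathfrak m$-degree (total degree), then by a fixed lexicographic order; the initial monomial $\mathrm{in}(f)$ is the smallest monomial occurring in $f$. A finite system in an ideal (or submodule of a free module with a module order) is a standard basis if the initial terms of its members generate the module of all initial terms; an ideal has a unique reduced standard basis (monic initial terms, no initial monomial dividing another initial monomial or any tail monomial). Schreyer resolution: $F_0=(f_1,\dots,f_{m_0})$, where $f_1,\dots,f_{m_0}$ is the reduced standard basis of $I$, and $\mathrm a^{(0)}_l=\operatorname{ord}_{\widehat P}(f_l)$. Inductively, given the matrix $F_i$ with columns $f^{(i)}_1,\dots,f^{(i)}_{m_i}$ forming a standard basis of the submodule they generate, order $\widehat R^{m_i}=\bigoplus\widehat Re_l$ by: $x^\alpha e_l<x^\beta e_{l'}$ iff $\mathrm{in}(x^\alpha f^{(i)}_l)<\mathrm{in}(x^\beta f^{(i)}_{l'})$, or the initial terms are equal and $l<l'$; and set $\operatorname{ord}_{\widehat P}(e_l):=\mathrm a^{(i)}_l:=\operatorname{ord}_{\widehat P}(f^{(i)}_l)$, with $\operatorname{ord}_{\widehat P}(\sum_l g_le_l)=\min_l(\operatorname{ord}_{\widehat P}(g_l)+\mathrm a^{(i)}_l)$. For each pair $l\neq l'$ write the S-polynomial as $S(f^{(i)}_l,f^{(i)}_{l'})=p\,f^{(i)}_l+p'f^{(i)}_{l'}$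 with $p,p'$ terms cancelling the initial terms (zero if the initial terms lie in different components), divide it by $f^{(i)}_1,\dots,f^{(i)}_{m_i}$ by Grauert's division theorem, $S=\sum_tq_tf^{(i)}_t$ (remainder $0$), and form the syzygy $pe_l+p'e_{l'}-\sum_tq_te_t$. The columns of $F_{i+1}$ are the subset of these syzygies that forms a (reduced) standard basis of the syzygy module for the module order on $\widehat R^{m_i}$ in which $x^\alpha e_l<x^\beta e_{l'}$ iff $\mathrm{in}(x^\alpha f^{(i)}_l)<\mathrm{in}(x^\beta f^{(i)}_{l'})$, or these initial terms are equal and $l<l'$. The process stops after finitely many steps. *)

theory Defs
  imports
    "HOL-Analysis.Infinite_Sum"
    "HOL-Library.Poly_Mapping"
    "HOL-Library.Extended_Nat"
    "HOL-Algebra.Ideal_Product"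
    "HOL-Algebra.Exact_Sequence"
    "Jordan_Normal_Form.Matrix"
begin

section \<open>Power series\<close>

text \<open>A monomial $x^\alpha$ is its exponent vector. The variable $x_i$ has index $i - 1$. All series live in one type with a variable for every natural number; a monomial
  has only finitely many divisors, so the Cauchy product makes sense there. The rings in $n$
  variables are subrings of this type.\<close>

type_synonym mon = "nat \<Rightarrow>\<^sub>0 nat"

typedef 'k mps = "UNIV :: (mon \<Rightarrow> 'k) set"
  morphisms mps_coeff Abs_mps
  by simp

setup_lifting type_definition_mps

lemma mps_eq_iff: "f = g \<longleftrightarrow> (\<forall>\<alpha>. mps_coeff f \<alpha> = mps_coeff g \<alpha>)"
  by transfer auto

lemma finite_mon_splits: "finite {(\<beta>, \<gamma>). \<beta> + \<gamma> = (\<alpha> :: mon)}"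
proof -
  let ?S = "{(\<beta>, \<gamma>). \<beta> + \<gamma> = \<alpha>}" and ?K = "Poly_Mapping.keys \<alpha>"
  let ?M = "Max (Poly_Mapping.lookup \<alpha> ` ?K)"
  let ?T = "{f. \<forall>i. (i \<in> ?K \<longrightarrow> f i \<in> {..?M}) \<and> (i \<notin> ?K \<longrightarrow> f i = 0)}"
  have "Poly_Mapping.lookup \<beta> \<in> ?T" if "\<beta> + \<gamma> = \<alpha>" for \<beta> \<gamma>
  proof -
    have le: "Poly_Mapping.lookup \<beta> i \<le> Poly_Mapping.lookup \<alpha> i" for i
      by (simp add: that[symmetric] lookup_add)
    have "Poly_Mapping.lookup \<beta> i \<le> ?M" if "i \<in> ?K" for i
      using that by (intro order.trans[OF le] Max_ge) auto
    moreover have "Poly_Mapping.lookup \<beta> i = 0" if "i \<notin> ?K" for i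
      using le[of i] that by (simp add: in_keys_iff)
    ultimately show ?thesis
      by auto
  qed
  then have "Poly_Mapping.lookup ` fst ` ?S \<subseteq> ?T" by auto
  moreover have "finite ?T" by (intro finite_set_of_finite_funs) auto
  ultimately have "finite (Poly_Mapping.lookup ` fst ` ?S)"
    by (rule finite_subset)
  then have "finite (fst ` ?S)"
    by (rule finite_imageD) (simp add: inj_on_def poly_mapping_eqI)
  moreover have "inj_on fst ?S" by (auto simp: inj_on_def)
  ultimately show ?thesis by (rule finite_imageD)
qed

instantiation mps :: (comm_ring_1) comm_ring_1
begin

lift_definition zero_mps :: "'a mps" is "\<lambda>_. 0" .
lift_definition one_mps :: "'a mps" is "\<lambda>\<alpha>. if \<alpha> = 0 then 1 else 0" .
lift_definition plus_mps :: "'a mps \<Rightarrow> 'a mps \<Rightarrow> 'a mps" is "\<lambda>f g \<alpha>. f \<alpha> + g \<alpha>" .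
lift_definition minus_mps :: "'a mps \<Rightarrow> 'a mps \<Rightarrow> 'a mps" is "\<lambda>f g \<alpha>. f \<alpha> - g \<alpha>" .
lift_definition uminus_mps :: "'a mps \<Rightarrow> 'a mps" is "\<lambda>f \<alpha>. - f \<alpha>" .
lift_definition times_mps :: "'a mps \<Rightarrow> 'a mps \<Rightarrow> 'a mps"
  is "\<lambda>f g \<alpha>. \<Sum>(\<beta>, \<gamma>) | \<beta> + \<gamma> = \<alpha>. f \<beta> * g \<gamma>" .

instance
proof
  fix a b c :: "'a mps"
  show "a * b * c = a * (b * c)"
  proof (transfer, rule ext)
    fix f g h :: "mon \<Rightarrow> 'a" and \<alpha> :: mon
    have "(\<Sum>(\<beta>, \<gamma>) | \<beta> + \<gamma> = \<alpha>. (\<Sum>(\<beta>', \<gamma>') | \<beta>' + \<gamma>' = \<beta>. f \<beta>' * g \<gamma>') * h \<gamma>) =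
      (\<Sum>p\<in>{(\<beta>, \<gamma>). \<beta> + \<gamma> = \<alpha>}. \<Sum>q\<in>{(\<beta>', \<gamma>'). \<beta>' + \<gamma>' = fst p}. f (fst q) * g (snd q) * h (snd p))"
      by (simp add: sum_distrib_right case_prod_beta)
    also have "\<dots> = (\<Sum>(p, q)\<in>Sigma {(\<beta>, \<gamma>). \<beta> + \<gamma> = \<alpha>} (\<lambda>p. {(\<beta>', \<gamma>'). \<beta>' + \<gamma>' = fst p}).
        f (fst q) * g (snd q) * h (snd p))"
      by (rule sum.Sigma) (auto simp: finite_mon_splits)
    also have "\<dots> = (\<Sum>(p, q)\<in>Sigma {(\<beta>, \<gamma>). \<beta> + \<gamma> = \<alpha>} (\<lambda>p. {(\<beta>', \<gamma>'). \<beta>' + \<gamma>' = snd p}).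
        f (fst p) * (g (fst q) * h (snd q)))"
      by (rule sum.reindex_bij_witness
            [where i = "\<lambda>(p, q). ((fst p + fst q, snd q), (fst p, fst q))"
               and j = "\<lambda>(p, q). ((fst q, snd q + snd p), (snd q, snd p))"])
         (auto simp: algebra_simps)
    also have "\<dots> = (\<Sum>p\<in>{(\<beta>, \<gamma>). \<beta> + \<gamma> = \<alpha>}. \<Sum>q\<in>{(\<beta>', \<gamma>'). \<beta>' + \<gamma>' = snd p}.
        f (fst p) * (g (fst q) * h (snd q)))"
      by (rule sum.Sigma[symmetric]) (auto simp: finite_mon_splits)
    also have "\<dots> = (\<Sum>(\<beta>, \<gamma>) | \<beta> + \<gamma> = \<alpha>. f \<beta> * (\<Sum>(\<beta>', \<gamma>') | \<beta>' + \<gamma>' = \<gamma>. g \<beta>' * h \<gamma>'))"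
      by (simp add: sum_distrib_left case_prod_beta)
    finally show "(\<Sum>(\<beta>, \<gamma>) | \<beta> + \<gamma> = \<alpha>. (\<Sum>(\<beta>', \<gamma>') | \<beta>' + \<gamma>' = \<beta>. f \<beta>' * g \<gamma>') * h \<gamma>) =
      (\<Sum>(\<beta>, \<gamma>) | \<beta> + \<gamma> = \<alpha>. f \<beta> * (\<Sum>(\<beta>', \<gamma>') | \<beta>' + \<gamma>' = \<gamma>. g \<beta>' * h \<gamma>'))" .
  qed
  show "a * b = b * a"
  proof (transfer, rule ext)
    fix f g :: "mon \<Rightarrow> 'a" and \<alpha> :: mon
    show "(\<Sum>(\<beta>, \<gamma>) | \<beta> + \<gamma> = \<alpha>. f \<beta> * g \<gamma>) = (\<Sum>(\<beta>, \<gamma>) | \<beta> + \<gamma> = \<alpha>. g \<beta> * f \<gamma>)"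
      by (rule sum.reindex_bij_witness[where i = prod.swap and j = prod.swap])
         (auto simp: ac_simps)
  qed
  show "1 * a = a"
  proof (transfer, rule ext)
    fix f :: "mon \<Rightarrow> 'a" and \<alpha> :: mon
    have "(\<Sum>(\<beta>, \<gamma>) | \<beta> + \<gamma> = \<alpha>. (if \<beta> = 0 then 1 else 0) * f \<gamma>) =
        (\<Sum>(\<beta>, \<gamma>)\<in>{(0 :: mon, \<alpha>)}. (if \<beta> = 0 then 1 else 0) * f \<gamma>)"
      by (intro sum.mono_neutral_right finite_mon_splits) (auto split: if_splits)
    then show "(\<Sum>(\<beta>, \<gamma>) | \<beta> + \<gamma> = \<alpha>. (if \<beta> = 0 then 1 else 0) * f \<gamma>) = f \<alpha>"
      by simp
  qed
  show "(a + b) * c = a * c + b * c"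
    by (transfer, rule ext) (simp add: algebra_simps sum.distrib case_prod_beta)
  show "(0 :: 'a mps) \<noteq> 1" by (transfer, auto simp: fun_eq_iff)
qed (transfer; simp add: fun_eq_iff algebra_simps)+

end

definition mps_monom :: "mon \<Rightarrow> 'k \<Rightarrow> 'k::zero mps" where
  "mps_monom \<alpha> a = Abs_mps (\<lambda>\<beta>. if \<beta> = \<alpha> then a else 0)"

definition mps_var :: "nat \<Rightarrow> 'k::zero_neq_one mps" where
  "mps_var i = mps_monom (Poly_Mapping.single i 1) 1"

definition mon_degree :: "mon \<Rightarrow> nat" where
  "mon_degree \<alpha> = (\<Sum>i\<in>Poly_Mapping.keys \<alpha>. Poly_Mapping.lookup \<alpha> i)"

definition formal_series :: "nat \<Rightarrow> 'k::zero mps set" where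
  "formal_series n = {f. \<forall>\<alpha>. mps_coeff f \<alpha> \<noteq> 0 \<longrightarrow> Poly_Mapping.keys \<alpha> \<subseteq> {..<n}}"

text \<open>For $k\{x_1,\dots,x_n\}$ the field carries a complete absolute value, archimedean or not.
  The trivial absolute value is allowed; it gives the ring of all formal series.\<close>

definition complete_absolute_value :: "('k::field \<Rightarrow> real) \<Rightarrow> bool" where
  "complete_absolute_value v \<longleftrightarrow>
     (\<forall>a. 0 \<le> v a) \<and> (\<forall>a. v a = 0 \<longleftrightarrow> a = 0) \<and>
     (\<forall>a b. v (a * b) = v a * v b) \<and> (\<forall>a b. v (a + b) \<le> v a + v b) \<and>
     (\<forall>s :: nat \<Rightarrow> 'k.
        (\<forall>\<epsilon>>0. \<exists>N. \<forall>i\<ge>N. \<forall>j\<ge>N. v (s i - s j) < \<epsilon>) \<longrightarrow>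
        (\<exists>a. (\<lambda>i. v (s i - a)) \<longlonglongrightarrow> 0))"

definition convergent_series :: "('k::field \<Rightarrow> real) \<Rightarrow> nat \<Rightarrow> 'k mps set" where
  "convergent_series v n = {f \<in> formal_series n.
     \<exists>\<rho>>0. (\<lambda>\<alpha>. v (mps_coeff f \<alpha>) * \<rho> ^ mon_degree \<alpha>) summable_on UNIV}"

section \<open>The ring, its free modules and the $\widehat P$-adic order\<close>

text \<open>From here on \<open>R\<close> is the carrier of one of the two rings.\<close>

definition series_ring :: "'k::field mps set \<Rightarrow> 'k mps ring" where
  "series_ring R = \<lparr>carrier = R, monoid.mult = (*), one = 1, zero = 0, add = (+)\<rparr>"

definition free_module :: "'k::field mps set \<Rightarrow> nat \<Rightarrow> ('k mps, 'k mps vec) module" where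
  "free_module R m =
     (module_vec TYPE('k mps) m)\<lparr>carrier := {u \<in> carrier_vec m. \<forall>l<m. u $ l \<in> R}\<rparr>"

definition P_ideal :: "'k::field mps set \<Rightarrow> nat \<Rightarrow> 'k mps set" where
  "P_ideal R c = Idl\<^bsub>series_ring R\<^esub> {mps_var i | i. i < c}"

text \<open>The powers are taken in the multiplicative monoid of ideals, whose unit is the ring itself.
  Since \<open>nat\<close> truncates at 0, the power with exponent $i \<le> 0$ is the ring.\<close>

definition P_power :: "'k::field mps set \<Rightarrow> nat \<Rightarrow> int \<Rightarrow> 'k mps set" where
  "P_power R c i = P_ideal R c [^]\<^bsub>ideals_set (series_ring R)\<^esub> nat i"

text \<open>The supremum is a maximum unless $f$ lies in all powers, as $f = 0$ does; then it is
  \<open>\<infinity>\<close>.\<close>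

definition ord_P :: "'k::field mps set \<Rightarrow> nat \<Rightarrow> 'k mps \<Rightarrow> enat" where
  "ord_P R c f = Sup {enat j | j. f \<in> P_power R c (int j)}"

definition ord_P_vec :: "'k::field mps set \<Rightarrow> nat \<Rightarrow> (nat \<Rightarrow> nat) \<Rightarrow> 'k mps vec \<Rightarrow> enat" where
  "ord_P_vec R c w g = (INF l\<in>{..<dim_vec g}. ord_P R c (g $ l) + enat (w l))"

section \<open>Monomial orders and standard bases\<close>

text \<open>The lists \<open>xs\<close> and \<open>ys\<close> enumerate $x_1,\dots,x_c$ and $x_1,\dots,x_n$ in the precedence
  used by the two lexicographic comparisons.\<close>

definition mon_less :: "nat \<Rightarrow> nat list \<Rightarrow> nat list \<Rightarrow> mon \<Rightarrow> mon \<Rightarrow> bool" where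
  "mon_less c xs ys \<alpha> \<beta> \<longleftrightarrow>
     ((\<Sum>i<c. Poly_Mapping.lookup \<alpha> i, map (Poly_Mapping.lookup \<alpha>) xs, mon_degree \<alpha>, map (Poly_Mapping.lookup \<alpha>) ys),
      (\<Sum>i<c. Poly_Mapping.lookup \<beta> i, map (Poly_Mapping.lookup \<beta>) xs, mon_degree \<beta>, map (Poly_Mapping.lookup \<beta>) ys))
     \<in> less_than <*lex*> lex less_than <*lex*> less_than <*lex*> lex less_than"

text \<open>\<open>(\<alpha>, l)\<close> stands for the module monomial $x^\alpha e_l$.\<close>

type_synonym mmon = "mon \<times> nat"

definition vec_supp :: "'k::zero mps vec \<Rightarrow> mmon set" where
  "vec_supp g = {(\<alpha>, l). l < dim_vec g \<and> mps_coeff (g $ l) \<alpha> \<noteq> 0}"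

definition init_mon :: "(mmon \<Rightarrow> mmon \<Rightarrow> bool) \<Rightarrow> 'k::zero mps vec \<Rightarrow> mmon" where
  "init_mon lt g = (THE \<mu>. \<mu> \<in> vec_supp g \<and> (\<forall>\<nu>\<in>vec_supp g. \<nu> \<noteq> \<mu> \<longrightarrow> lt \<mu> \<nu>))"

definition init_coeff :: "(mmon \<Rightarrow> mmon \<Rightarrow> bool) \<Rightarrow> 'k::zero mps vec \<Rightarrow> 'k" where
  "init_coeff lt g = (case init_mon lt g of (\<alpha>, l) \<Rightarrow> mps_coeff (g $ l) \<alpha>)"

definition init_term :: "(mmon \<Rightarrow> mmon \<Rightarrow> bool) \<Rightarrow> 'k::field mps vec \<Rightarrow> 'k mps vec" where
  "init_term lt g = (case init_mon lt g of
     (\<alpha>, l) \<Rightarrow> mps_monom \<alpha> (init_coeff lt g) \<cdot>\<^sub>v unit_vec (dim_vec g) l)"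

definition mmon_dvd :: "mmon \<Rightarrow> mmon \<Rightarrow> bool" where
  "mmon_dvd \<mu> \<nu> \<longleftrightarrow> snd \<mu> = snd \<nu> \<and> (\<exists>\<gamma>. fst \<nu> = fst \<mu> + \<gamma>)"

definition submodule_gen ::
    "'k::field mps set \<Rightarrow> nat \<Rightarrow> 'k mps vec set \<Rightarrow> 'k mps vec set" where
  "submodule_gen R m S = \<Inter>{N. submodule N (series_ring R) (free_module R m) \<and> S \<subseteq> N}"

text \<open>A finite system of vectors is given by the matrix with these columns.\<close>

definition standard_basis ::
    "'k::field mps set \<Rightarrow> (mmon \<Rightarrow> mmon \<Rightarrow> bool) \<Rightarrow> 'k mps vec set \<Rightarrow> 'k mps mat \<Rightarrow> bool" where
  "standard_basis R lt M F \<longleftrightarrow>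
     set (cols F) \<subseteq> M \<and>
     submodule_gen R (dim_row F) {init_term lt f | f. f \<in> set (cols F) \<and> f \<noteq> 0\<^sub>v (dim_row F)} =
     submodule_gen R (dim_row F) {init_term lt g | g. g \<in> M \<and> g \<noteq> 0\<^sub>v (dim_row F)}"

definition monic_minimal :: "(mmon \<Rightarrow> mmon \<Rightarrow> bool) \<Rightarrow> 'k::field mps mat \<Rightarrow> bool" where
  "monic_minimal lt F \<longleftrightarrow>
     (\<forall>l<dim_col F. col F l \<noteq> 0\<^sub>v (dim_row F) \<and> init_coeff lt (col F l) = 1) \<and>
     (\<forall>l<dim_col F. \<forall>l'<dim_col F. l \<noteq> l' \<longrightarrow>
        \<not> mmon_dvd (init_mon lt (col F l)) (init_mon lt (col F l')))"

definition tail_reduced :: "(mmon \<Rightarrow> mmon \<Rightarrow> bool) \<Rightarrow> 'k::field mps mat \<Rightarrow> bool" where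
  "tail_reduced lt F \<longleftrightarrow>
     (\<forall>l<dim_col F. \<forall>l'<dim_col F. \<forall>\<nu>\<in>vec_supp (col F l') - {init_mon lt (col F l')}.
        \<not> mmon_dvd (init_mon lt (col F l)) \<nu>)"

definition reduced_standard_basis ::
    "'k::field mps set \<Rightarrow> (mmon \<Rightarrow> mmon \<Rightarrow> bool) \<Rightarrow> 'k mps vec set \<Rightarrow> 'k mps mat \<Rightarrow> bool" where
  "reduced_standard_basis R lt M F \<longleftrightarrow>
     standard_basis R lt M F \<and> monic_minimal lt F \<and> tail_reduced lt F"

section \<open>The Schreyer resolution\<close>

definition schreyer_less ::
    "(mmon \<Rightarrow> mmon \<Rightarrow> bool) \<Rightarrow> 'k::field mps mat \<Rightarrow> mmon \<Rightarrow> mmon \<Rightarrow> bool" where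
  "schreyer_less lt F \<mu> \<nu> \<longleftrightarrow>
     (let a = init_mon lt (mps_monom (fst \<mu>) 1 \<cdot>\<^sub>v col F (snd \<mu>));
          b = init_mon lt (mps_monom (fst \<nu>) 1 \<cdot>\<^sub>v col F (snd \<nu>))
      in lt a b \<or> a = b \<and> snd \<mu> < snd \<nu>)"

definition syzygies :: "'k::field mps set \<Rightarrow> 'k mps mat \<Rightarrow> 'k mps vec set" where
  "syzygies R F = {g \<in> carrier (free_module R (dim_col F)). F *\<^sub>v g = 0\<^sub>v (dim_row F)}"

text \<open>Division of \<open>s\<close> by the columns of \<open>F\<close> with quotients \<open>q\<close> and remainder \<open>rem\<close>: no product
  $q_t f_t$ has a smaller initial monomial than \<open>s\<close>, and no monomial of \<open>rem\<close> is divisible by an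
  initial monomial. The supports of the quotients are not restricted further, so they need not be
  unique; every normalisation of the quotients is an instance.\<close>

definition grauert_division ::
    "'k::field mps set \<Rightarrow> (mmon \<Rightarrow> mmon \<Rightarrow> bool) \<Rightarrow> 'k mps mat \<Rightarrow>
     'k mps vec \<Rightarrow> 'k mps vec \<Rightarrow> 'k mps vec \<Rightarrow> bool" where
  "grauert_division R lt F s q rem \<longleftrightarrow>
     q \<in> carrier (free_module R (dim_col F)) \<and> rem \<in> carrier (free_module R (dim_row F)) \<and>
     s = F *\<^sub>v q + rem \<and>
     (\<forall>t<dim_col F. q $ t \<cdot>\<^sub>v col F t \<noteq> 0\<^sub>v (dim_row F) \<longrightarrow>
        s \<noteq> 0\<^sub>v (dim_row F) \<and> \<not> lt (init_mon lt (q $ t \<cdot>\<^sub>v col F t)) (init_mon lt s)) \<and>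
     (\<forall>t<dim_col F. \<forall>\<nu>\<in>vec_supp rem. \<not> mmon_dvd (init_mon lt (col F t)) \<nu>)"

text \<open>The pair of terms $(p, p')$ cancelling the initial terms of $f$ and $f'$. Subtraction of
  exponents is truncated, so $\alpha + (\beta - \alpha) = \beta + (\alpha - \beta)$ is the exponent
  of the least common multiple of $x^\alpha$ and $x^\beta$.\<close>

definition spoly_terms ::
    "(mmon \<Rightarrow> mmon \<Rightarrow> bool) \<Rightarrow> 'k::field mps vec \<Rightarrow> 'k mps vec \<Rightarrow> 'k mps \<times> 'k mps" where
  "spoly_terms lt f f' =
     (let (\<alpha>, j) = init_mon lt f; (\<beta>, j') = init_mon lt f' in
      if j = j'
      then (mps_monom (\<beta> - \<alpha>) (1 / init_coeff lt f), mps_monom (\<alpha> - \<beta>) (- 1 / init_coeff lt f'))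
      else (0, 0))"

definition schreyer_syzygy ::
    "'k::field mps set \<Rightarrow> (mmon \<Rightarrow> mmon \<Rightarrow> bool) \<Rightarrow> 'k mps mat \<Rightarrow> nat \<Rightarrow> nat \<Rightarrow>
     'k mps vec \<Rightarrow> bool" where
  "schreyer_syzygy R lt F l l' g \<longleftrightarrow>
     (let m = dim_col F; (p, p') = spoly_terms lt (col F l) (col F l') in
      \<exists>q. grauert_division R lt F (p \<cdot>\<^sub>v col F l + p' \<cdot>\<^sub>v col F l') q (0\<^sub>v (dim_row F)) \<and>
          g = p \<cdot>\<^sub>v unit_vec m l + p' \<cdot>\<^sub>v unit_vec m l' - q)"

text \<open>One step of the construction: from \<open>F\<close>, whose columns are ordered by \<open>lt\<close>, to \<open>F'\<close>. The chosen
  Schreyer syzygies have monic initial terms none of which divides another. Whether their tails are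
  reduced as well depends on the quotients chosen in the divisions; this is not demanded, so fully
  reduced choices are included.\<close>

definition schreyer_step ::
    "'k::field mps set \<Rightarrow> (mmon \<Rightarrow> mmon \<Rightarrow> bool) \<Rightarrow> 'k mps mat \<Rightarrow> 'k mps mat \<Rightarrow> bool" where
  "schreyer_step R lt F F' \<longleftrightarrow>
     dim_row F' = dim_col F \<and>
     set (cols F') \<subseteq>
       {g. \<exists>l<dim_col F. \<exists>l'<dim_col F. l \<noteq> l' \<and> schreyer_syzygy R lt F l l' g} \<and>
     standard_basis R (schreyer_less lt F) (syzygies R F) F' \<and>
     monic_minimal (schreyer_less lt F) F'"

text \<open>\<open>level_less \<dots> F i\<close> orders the module that contains the columns of \<open>F i\<close>. At level 0 this is
  the ring, regarded as the free module of rank 1.\<close>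

primrec level_less ::
    "nat \<Rightarrow> nat list \<Rightarrow> nat list \<Rightarrow> (nat \<Rightarrow> 'k::field mps mat) \<Rightarrow> nat \<Rightarrow> mmon \<Rightarrow> mmon \<Rightarrow> bool"
where
  "level_less c xs ys F 0 = (\<lambda>\<mu> \<nu>. mon_less c xs ys (fst \<mu>) (fst \<nu>))"
| "level_less c xs ys F (Suc i) = schreyer_less (level_less c xs ys F i) (F i)"

text \<open>\<open>level_ord R c F i l\<close> is $\mathrm{ord}_{\widehat P}(e_l)$ in the module that contains the
  columns of \<open>F i\<close>. Hence $\mathrm a^{(i)}_l$ sits at level $i + 1$ (\<open>schreyer_ord\<close> below), and
  level 0 is the ring with weight 0.\<close>

primrec level_ord ::
    "'k::field mps set \<Rightarrow> nat \<Rightarrow> (nat \<Rightarrow> 'k mps mat) \<Rightarrow> nat \<Rightarrow> nat \<Rightarrow> nat"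
where
  "level_ord R c F 0 = (\<lambda>l. 0)"
| "level_ord R c F (Suc i) = (\<lambda>l. the_enat (ord_P_vec R c (level_ord R c F i) (col (F i) l)))"

definition vecs1 :: "'k mps set \<Rightarrow> 'k mps vec set" where
  "vecs1 A = {u \<in> carrier_vec 1. u $ 0 \<in> A}"

text \<open>The process stops at \<open>F k\<close> because the next matrix has no columns.\<close>

definition schreyer_resolution ::
    "'k::field mps set \<Rightarrow> nat \<Rightarrow> nat list \<Rightarrow> nat list \<Rightarrow> 'k mps set \<Rightarrow> nat \<Rightarrow>
     (nat \<Rightarrow> 'k mps mat) \<Rightarrow> bool" where
  "schreyer_resolution R c xs ys I k F \<longleftrightarrow>
     dim_row (F 0) = 1 \<and>
     reduced_standard_basis R (level_less c xs ys F 0) (vecs1 I) (F 0) \<and>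
     (\<forall>i<k. schreyer_step R (level_less c xs ys F i) (F i) (F (Suc i))) \<and>
     schreyer_step R (level_less c xs ys F k) (F k) (0\<^sub>m (dim_col (F k)) 0)"

section \<open>The filtered sequence\<close>

definition schreyer_ord ::
    "'k::field mps set \<Rightarrow> nat \<Rightarrow> (nat \<Rightarrow> 'k mps mat) \<Rightarrow> nat \<Rightarrow> nat \<Rightarrow> nat" where
  "schreyer_ord R c F i = level_ord R c F (Suc i)"

text \<open>The additive group of $\bigoplus_{l<m} \widehat P^{\,r - w_l}$. For $m = 1$ and $w_0 = 0$ it is
  $\widehat P^{\,r}$.\<close>

definition P_sum ::
    "'k::field mps set \<Rightarrow> nat \<Rightarrow> nat \<Rightarrow> (nat \<Rightarrow> nat) \<Rightarrow> int \<Rightarrow> 'k mps vec monoid" where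
  "P_sum R c m w r =
     \<lparr>carrier = {u \<in> carrier_vec m. \<forall>l<m. u $ l \<in> P_power R c (r - int (w l))},
      monoid.mult = (+), one = 0\<^sub>v m\<rparr>"

definition zero_group :: "'k::field mps vec monoid" where
  "zero_group = \<lparr>carrier = {0\<^sub>v 0}, monoid.mult = (+), one = 0\<^sub>v 0\<rparr>"

end

(*
  The Schreyer orders refine the order by weighted P-degree, in which e_l has weight a_l. Hence if
  division by a standard basis writes g as a combination of the basis elements whose terms do not
  start below in(g), then the quotients have the P-degrees that the filtered sequence requires, and
  the remainder vanishes because its initial monomial would be divisible by one of those of the
  basis.

  Division with remainder is an infinite unitriangular linear system indexed by the monomials. It
  is solved by recursion along the well-founded monomial order. The solution converges because for
  suitable weights the initial monomial of each divisor has strictly smallest weight, so that in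
  the weighted norm of a small radius the tails contribute at most half of the initial terms.
  Formal power series are the convergent ones for the trivial absolute value.
*)
theory Submission
  imports Defs
begin

section \<open>Monomials and weighted norms\<close>

text \<open>When 0 < c < n, infinitely many monomials lie below x_1. Subtracting initial terms one
  after another need not get past them, and no weight with natural values represents the whole
  order. The existence and the convergence of a division are therefore separated. For existence,
  every coefficient equation is finite, because a monomial has finitely many divisors, so
  transfinite recursion determines all coefficients without any notion of limit. For convergence,
  only the finitely many initial monomials of the divisors have to be separated from their
  successors. One weight function can do that: the order of the ring compares finitely many linear
  forms lexicographically, a Schreyer order pulls an earlier order back along a translation with
  ties broken by the basis index, and both constructions admit such weights. The factor 1/2 stands
  for any constant below 1: it allows the error term to be absorbed into the quantity being
  estimated.\<close>

definition mons :: "nat \<Rightarrow> mon set" where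
  "mons n = {\<alpha>. Poly_Mapping.keys \<alpha> \<subseteq> {..<n}}"

lemma mons_iff: "\<alpha> \<in> mons n \<longleftrightarrow> (\<forall>i\<ge>n. Poly_Mapping.lookup \<alpha> i = 0)"
  unfolding mons_def subset_iff in_keys_iff mem_Collect_eq lessThan_iff by (metis not_le)

lemma zero_in_mons [simp]: "0 \<in> mons n"
  by (simp add: mons_def)

lemma add_in_mons [simp]: "\<alpha> + \<beta> \<in> mons n \<longleftrightarrow> \<alpha> \<in> mons n \<and> \<beta> \<in> mons n"
  by (auto simp: mons_iff lookup_add)

lemma single_in_mons: "i < n \<Longrightarrow> Poly_Mapping.single i k \<in> mons n"
  by (auto simp: mons_iff lookup_single when_def)

text \<open>A linear form on exponent vectors, used in two ways: with weights at least 1 it is the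
  exponent of the radius in weighted norms, and with weights 0 and 1 such forms encode the
  comparisons that define the monomial order of the ring.\<close>

definition wdeg :: "nat \<Rightarrow> (nat \<Rightarrow> nat) \<Rightarrow> mon \<Rightarrow> nat" where
  "wdeg n w \<alpha> = (\<Sum>i<n. w i * Poly_Mapping.lookup \<alpha> i)"

lemma wdeg_add: "wdeg n w (\<alpha> + \<beta>) = wdeg n w \<alpha> + wdeg n w \<beta>"
  by (simp add: wdeg_def lookup_add algebra_simps sum.distrib)

lemma mon_degree_wdeg: "\<alpha> \<in> mons n \<Longrightarrow> mon_degree \<alpha> = wdeg n (\<lambda>_. 1) \<alpha>"
  unfolding mon_degree_def wdeg_def mons_def
  by (auto intro!: sum.mono_neutral_left simp: in_keys_iff)

lemma mon_eq_iff_mons: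
  assumes "\<alpha> \<in> mons n" "\<beta> \<in> mons n"
    and "\<And>i. i < n \<Longrightarrow> Poly_Mapping.lookup \<alpha> i = Poly_Mapping.lookup \<beta> i"
  shows "\<alpha> = \<beta>"
proof (rule poly_mapping_eqI)
  fix i show "Poly_Mapping.lookup \<alpha> i = Poly_Mapping.lookup \<beta> i"
    using assms by (cases "i < n") (auto simp: mons_iff)
qed

lemma lookup_le_wdeg:
  assumes "\<forall>i<n. 1 \<le> w i" "i < n"
  shows "Poly_Mapping.lookup \<alpha> i \<le> wdeg n w \<alpha>"
proof -
  have "Poly_Mapping.lookup \<alpha> i \<le> w i * Poly_Mapping.lookup \<alpha> i" using assms by simp
  also have "\<dots> \<le> wdeg n w \<alpha>" unfolding wdeg_def
    using assms by (intro member_le_sum) auto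
  finally show ?thesis .
qed

text \<open>Positive weights bound each exponent by the weighted degree, which confines the
  monomials to a box. The estimate for infinite systems depends on this: it truncates at a weight
  and needs the truncated sum to be finite.\<close>

lemma finite_wdeg_le:
  assumes "\<forall>i<n. 1 \<le> w i"
  shows "finite {\<alpha> \<in> mons n. wdeg n w \<alpha> \<le> N}"
proof -
  let ?T = "{f. \<forall>i. (i \<in> {..<n} \<longrightarrow> f i \<in> {..N}) \<and> (i \<notin> {..<n} \<longrightarrow> f i = 0)}"
  have "Poly_Mapping.lookup ` {\<alpha> \<in> mons n. wdeg n w \<alpha> \<le> N} \<subseteq> ?T"
    by (auto simp: mons_iff intro: order.trans[OF lookup_le_wdeg[OF assms]])
  moreover have "finite ?T" by (intro finite_set_of_finite_funs) auto
  ultimately have "finite (Poly_Mapping.lookup ` {\<alpha> \<in> mons n. wdeg n w \<alpha> \<le> N})"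
    by (rule finite_subset)
  then show ?thesis
    by (rule finite_imageD) (simp add: inj_on_def poly_mapping_eqI)
qed

section \<open>Coefficients of sums, products and monomial multiples\<close>

lemma mps_coeff_simps [simp]:
  "mps_coeff 0 \<alpha> = 0"
  "mps_coeff 1 \<alpha> = (if \<alpha> = 0 then 1 else 0)"
  "mps_coeff (f + g) \<alpha> = mps_coeff f \<alpha> + mps_coeff g \<alpha>"
  "mps_coeff (f - g) \<alpha> = mps_coeff f \<alpha> - mps_coeff g \<alpha>"
  "mps_coeff (- f) \<alpha> = - mps_coeff f \<alpha>"
  by (simp_all add: zero_mps.rep_eq one_mps.rep_eq plus_mps.rep_eq minus_mps.rep_eq uminus_mps.rep_eq)

lemma mps_coeff_times:
  "mps_coeff (f * g) \<alpha> = (\<Sum>(\<beta>, \<gamma>) | \<beta> + \<gamma> = \<alpha>. mps_coeff f \<beta> * mps_coeff g \<gamma>)"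
  by (rule fun_cong[OF times_mps.rep_eq])

lemma mps_coeff_sum [simp]:
  "mps_coeff (\<Sum>i\<in>A. f i) \<alpha> = (\<Sum>i\<in>A. mps_coeff (f i) \<alpha>)"
  by (induction A rule: infinite_finite_induct) auto

lemma mps_coeff_Abs [simp]: "mps_coeff (Abs_mps f) = f"
  by (simp add: Abs_mps_inverse)

lemma mps_coeff_monom: "mps_coeff (mps_monom \<alpha> a) \<beta> = (if \<beta> = \<alpha> then a else 0)"
  by (simp add: mps_monom_def)

lemma mps_coeff_monom_times:
  "mps_coeff (mps_monom \<gamma> a * f) (\<gamma> + \<beta>) = a * mps_coeff f \<beta>"
proof -
  have "mps_coeff (mps_monom \<gamma> a * f) (\<gamma> + \<beta>) =
     (\<Sum>(\<beta>', \<gamma>')\<in>{(\<gamma>, \<beta>)}. mps_coeff (mps_monom \<gamma> a) \<beta>' * mps_coeff f \<gamma>')"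
    unfolding mps_coeff_times
    by (rule sum.mono_neutral_right[OF finite_mon_splits])
      (auto simp: mps_coeff_monom split: if_splits)
  then show ?thesis by (simp add: mps_coeff_monom)
qed

lemma mps_coeff_monom_times_eq_0:
  "\<nexists>\<beta>. \<alpha> = \<gamma> + \<beta> \<Longrightarrow> mps_coeff (mps_monom \<gamma> a * f) \<alpha> = 0"
  unfolding mps_coeff_times by (rule sum.neutral) (auto simp: mps_coeff_monom)

lemma mps_times_nonzero_coeffE:
  assumes "mps_coeff (f * g) \<alpha> \<noteq> 0"
  obtains \<beta> \<gamma> where "\<alpha> = \<beta> + \<gamma>" "mps_coeff f \<beta> \<noteq> 0" "mps_coeff g \<gamma> \<noteq> 0"
proof -
  have "\<exists>x\<in>{(\<beta>, \<gamma>). \<beta> + \<gamma> = \<alpha>}. (case x of (\<beta>, \<gamma>) \<Rightarrow> mps_coeff f \<beta> * mps_coeff g \<gamma>) \<noteq> 0"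
    using assms unfolding mps_coeff_times by (meson sum.neutral)
  then show ?thesis using that by fastforce
qed

text \<open>The weighted l1-norm at radius \<rho> is at most C, said through finite partial sums so
  that no summability has to be carried along. The index type is arbitrary because the same bound is
  applied to series, to vectors of series and to rows of an infinite matrix.\<close>

definition wbounded :: "('k \<Rightarrow> real) \<Rightarrow> ('x \<Rightarrow> nat) \<Rightarrow> real \<Rightarrow> real \<Rightarrow> ('x \<Rightarrow> 'k) \<Rightarrow> bool" where
  "wbounded v w \<rho> C f \<longleftrightarrow> (\<forall>A. finite A \<longrightarrow> (\<Sum>x\<in>A. v (f x) * \<rho> ^ w x) \<le> C)"

locale abs_value =
  fixes v :: "'k::field \<Rightarrow> real"
  assumes v_nonneg [simp]: "0 \<le> v a"
    and v_eq_0_iff [simp]: "v a = 0 \<longleftrightarrow> a = 0"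
    and v_mult: "v (a * b) = v a * v b"
    and v_add: "v (a + b) \<le> v a + v b"
begin

lemma v_0 [simp]: "v 0 = 0"
  by simp

lemma v_1 [simp]: "v 1 = 1"
proof -
  have "v 1 * v 1 = v 1" by (metis mult_1 v_mult)
  moreover have "v 1 \<noteq> 0" by (simp only: v_eq_0_iff one_neq_zero not_False_eq_True)
  ultimately show ?thesis by simp
qed

lemma v_minus [simp]: "v (- a) = v a"
proof -
  have "v (-1) * v (-1) = 1" by (metis v_mult v_1 minus_mult_minus mult_1)
  then have "v (-1) ^ 2 = 1" by (simp add: power2_eq_square)
  then have "v (-1) = 1" using v_nonneg[of "-1"] by (simp add: power2_eq_1_iff)
  then show ?thesis by (metis mult_minus1 mult_1 v_mult)
qed

lemma v_diff: "v (a - b) \<le> v a + v b"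
  using v_add[of a "- b"] by simp

lemma v_sum: "v (\<Sum>i\<in>A. f i) \<le> (\<Sum>i\<in>A. v (f i))"
proof (induction A rule: infinite_finite_induct)
  case (insert x F)
  then show ?case using v_add[of "f x" "sum f F"] by simp
qed auto

lemma wbounded_mono:
  assumes "wbounded v w \<rho> C f" "0 \<le> \<rho>'" "\<And>x. f x \<noteq> 0 \<Longrightarrow> \<rho>' ^ w' x \<le> \<rho> ^ w x"
  shows "wbounded v w' \<rho>' C f"
  unfolding wbounded_def
proof (intro allI impI)
  fix A :: "'a set" assume "finite A"
  have "v (f x) * \<rho>' ^ w' x \<le> v (f x) * \<rho> ^ w x" for x
    using assms(3)[of x] by (cases "f x = 0") (auto intro: mult_left_mono)
  then have "(\<Sum>x\<in>A. v (f x) * \<rho>' ^ w' x) \<le> (\<Sum>x\<in>A. v (f x) * \<rho> ^ w x)"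
    by (rule sum_mono)
  also have "\<dots> \<le> C" using assms(1) \<open>finite A\<close> by (simp add: wbounded_def)
  finally show "(\<Sum>x\<in>A. v (f x) * \<rho>' ^ w' x) \<le> C" .
qed

lemma wbounded_add:
  assumes "wbounded v w \<rho> C f" "wbounded v w \<rho> D g" "0 \<le> \<rho>"
  shows "wbounded v w \<rho> (C + D) (\<lambda>x. f x + g x)"
  unfolding wbounded_def
proof (intro allI impI)
  fix A :: "'a set" assume "finite A"
  have "(\<Sum>x\<in>A. v (f x + g x) * \<rho> ^ w x) \<le> (\<Sum>x\<in>A. v (f x) * \<rho> ^ w x + v (g x) * \<rho> ^ w x)"
    using assms(3) v_add by (intro sum_mono) (simp add: mult_right_mono flip: distrib_right)
  also have "\<dots> \<le> C + D"
    using assms(1,2) \<open>finite A\<close> by (simp add: wbounded_def sum.distrib add_mono)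
  finally show "(\<Sum>x\<in>A. v (f x + g x) * \<rho> ^ w x) \<le> C + D" .
qed

text \<open>Passing to part of a family along an injection cannot increase the norm, and a constant
  weight shift by d costs the factor \<open>\<rho> ^ d\<close>. Shifts arise from dividing by a
  monomial or extracting a component; d = 0 merely discards or relabels coefficients. Only the
  nonzero values of g are constrained.\<close>

lemma wbounded_reindex:
  assumes "wbounded v w \<rho> C f" "0 < \<rho>"
    and "inj_on h B" "\<And>x. g x \<noteq> 0 \<Longrightarrow> x \<in> B \<and> g x = f (h x) \<and> w (h x) = w' x + d"
  shows "wbounded v w' \<rho> (C / \<rho> ^ d) g"
  unfolding wbounded_def
proof (intro allI impI)
  fix A :: "'b set" assume A: "finite A"
  let ?A = "{x \<in> A. g x \<noteq> 0}"
  have "(\<Sum>x\<in>A. v (g x) * \<rho> ^ w' x) = (\<Sum>x\<in>?A. v (g x) * \<rho> ^ w' x)"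
    using A by (intro sum.mono_neutral_right) auto
  also have "\<dots> = (\<Sum>x\<in>?A. v (f (h x)) * \<rho> ^ w (h x) / \<rho> ^ d)"
    using assms(2,4) by (intro sum.cong) (auto simp: power_add)
  also have "\<dots> = (\<Sum>y\<in>h ` ?A. v (f y) * \<rho> ^ w y) / \<rho> ^ d"
    unfolding sum_divide_distrib
    using assms(4) by (intro sum.reindex_cong[symmetric, where l = h] inj_on_subset[OF assms(3)]) auto
  also have "\<dots> \<le> C / \<rho> ^ d"
    using assms(1,2) A by (intro divide_right_mono) (auto simp: wbounded_def)
  finally show "(\<Sum>x\<in>A. v (g x) * \<rho> ^ w' x) \<le> C / \<rho> ^ d" .
qed

lemma wbounded_times:
  assumes f: "wbounded v w \<rho> C (mps_coeff f)" and g: "wbounded v w \<rho> D (mps_coeff g)"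
    and \<rho>: "0 \<le> \<rho>"
    and w: "\<And>\<alpha> \<beta>. mps_coeff f \<alpha> \<noteq> 0 \<Longrightarrow> mps_coeff g \<beta> \<noteq> 0 \<Longrightarrow> w (\<alpha> + \<beta>) = w \<alpha> + w \<beta>"
  shows "wbounded v w \<rho> (C * D) (mps_coeff (f * g))"
  unfolding wbounded_def
proof (intro allI impI)
  fix A :: "mon set" assume A: "finite A"
  let ?S = "\<lambda>\<alpha>. {(\<beta>, \<gamma>). \<beta> + \<gamma> = (\<alpha> :: mon)}"
  let ?F = "\<lambda>\<alpha>. v (mps_coeff f \<alpha>) * \<rho> ^ w \<alpha>" and ?G = "\<lambda>\<alpha>. v (mps_coeff g \<alpha>) * \<rho> ^ w \<alpha>"
  let ?T = "\<Union>\<alpha>\<in>A. ?S \<alpha>"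
  have finT: "finite ?T" using A by (auto intro: finite_mon_splits)
  have pos: "0 \<le> ?F \<alpha>" "0 \<le> ?G \<alpha>" for \<alpha> using \<rho> by auto
  have C: "0 \<le> C" using f unfolding wbounded_def by (metis finite.emptyI sum.empty)
  have "(\<Sum>\<alpha>\<in>A. v (mps_coeff (f * g) \<alpha>) * \<rho> ^ w \<alpha>) \<le> (\<Sum>\<alpha>\<in>A. \<Sum>(\<beta>, \<gamma>)\<in>?S \<alpha>. ?F \<beta> * ?G \<gamma>)"
  proof (rule sum_mono)
    fix \<alpha>
    have "v (mps_coeff (f * g) \<alpha>) * \<rho> ^ w \<alpha> \<le>
        (\<Sum>(\<beta>, \<gamma>)\<in>?S \<alpha>. v (mps_coeff f \<beta>) * v (mps_coeff g \<gamma>)) * \<rho> ^ w \<alpha>"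
      unfolding mps_coeff_times using \<rho>
      by (intro mult_right_mono order.trans[OF v_sum] sum_mono) (auto simp: v_mult)
    also have "\<dots> = (\<Sum>(\<beta>, \<gamma>)\<in>?S \<alpha>. v (mps_coeff f \<beta>) * v (mps_coeff g \<gamma>) * \<rho> ^ w \<alpha>)"
      by (simp add: sum_distrib_right case_prod_beta)
    also have "\<dots> = (\<Sum>(\<beta>, \<gamma>)\<in>?S \<alpha>. ?F \<beta> * ?G \<gamma>)"
    proof (rule sum.cong[OF refl], clarify)
      fix \<beta> \<gamma> assume "\<alpha> = \<beta> + \<gamma>"
      then show "v (mps_coeff f \<beta>) * v (mps_coeff g \<gamma>) * \<rho> ^ w (\<beta> + \<gamma>) = ?F \<beta> * ?G \<gamma>"
        using w[of \<beta> \<gamma>]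
        by (cases "mps_coeff f \<beta> = 0 \<or> mps_coeff g \<gamma> = 0") (auto simp: power_add)
    qed
    finally show "v (mps_coeff (f * g) \<alpha>) * \<rho> ^ w \<alpha> \<le> (\<Sum>(\<beta>, \<gamma>)\<in>?S \<alpha>. ?F \<beta> * ?G \<gamma>)" .
  qed
  also have "\<dots> = (\<Sum>(\<beta>, \<gamma>)\<in>?T. ?F \<beta> * ?G \<gamma>)"
    by (rule sum.UNION_disjoint[symmetric]) (auto simp: A finite_mon_splits)
  \<comment> \<open>The pairs that sum to a monomial of A lie in a finite rectangle. The added terms
    are nonnegative, and over the rectangle the sum factors.\<close>
  also have "\<dots> \<le> (\<Sum>(\<beta>, \<gamma>)\<in>fst ` ?T \<times> snd ` ?T. ?F \<beta> * ?G \<gamma>)"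
  proof (rule sum_mono2)
    show "finite (fst ` ?T \<times> snd ` ?T)" using finT by blast
    show "?T \<subseteq> fst ` ?T \<times> snd ` ?T" by force
  qed (use \<rho> in auto)
  also have "\<dots> = (\<Sum>\<beta>\<in>fst ` ?T. ?F \<beta>) * (\<Sum>\<gamma>\<in>snd ` ?T. ?G \<gamma>)"
    by (simp only: sum_product sum.cartesian_product)
  also have "\<dots> \<le> C * D"
    using f g finT pos C by (intro mult_mono sum_nonneg) (auto simp: wbounded_def)
  finally show "(\<Sum>\<alpha>\<in>A. v (mps_coeff (f * g) \<alpha>) * \<rho> ^ w \<alpha>) \<le> C * D" .
qed

end

section \<open>The powers of $\widehat P$\<close>

definition pdeg :: "nat \<Rightarrow> mon \<Rightarrow> nat" where
  "pdeg c \<alpha> = (\<Sum>i<c. Poly_Mapping.lookup \<alpha> i)"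

lemma pdeg_add: "pdeg c (\<alpha> + \<beta>) = pdeg c \<alpha> + pdeg c \<beta>"
  by (simp add: pdeg_def lookup_add sum.distrib)

lemma pdeg_single: "i < c \<Longrightarrow> pdeg c (Poly_Mapping.single i 1) = 1"
  unfolding pdeg_def lookup_single when_def by simp

locale conv_ring = abs_value v for v :: "'k::field \<Rightarrow> real" +
  fixes n c :: nat and R :: "'k mps set"
  assumes c_le_n: "c \<le> n" and R_def: "R = convergent_series v n"
begin

section \<open>The ring as the series that are bounded at all small radii\<close>

lemma R_mons: "f \<in> R \<Longrightarrow> mps_coeff f \<alpha> \<noteq> 0 \<Longrightarrow> \<alpha> \<in> mons n"
  by (simp add: R_def convergent_series_def formal_series_def mons_def)

text \<open>The choice of positive weights is immaterial: on monomials in n variables the weighted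
  degree lies between the total degree and a constant multiple of it. The condition is put as
  holding for all sufficiently small radii, so that finitely many such conditions can be met by a
  common radius.\<close>

lemma R_iff:
  assumes w: "\<forall>i<n. 1 \<le> w i"
  shows "f \<in> R \<longleftrightarrow> (\<forall>\<alpha>. mps_coeff f \<alpha> \<noteq> 0 \<longrightarrow> \<alpha> \<in> mons n) \<and>
    (\<forall>\<^sub>F \<rho> in at_right 0. \<exists>C. wbounded v (wdeg n w) \<rho> C (mps_coeff f))"
proof safe
  fix \<alpha> assume "f \<in> R" "mps_coeff f \<alpha> \<noteq> 0" then show "\<alpha> \<in> mons n" by (rule R_mons)
next
  assume f: "f \<in> R"
  then obtain \<rho>\<^sub>0 where \<rho>\<^sub>0: "\<rho>\<^sub>0 > 0" "(\<lambda>\<alpha>. v (mps_coeff f \<alpha>) * \<rho>\<^sub>0 ^ mon_degree \<alpha>) summable_on UNIV"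
    by (auto simp: R_def convergent_series_def)
  define C where "C = infsum (\<lambda>\<alpha>. v (mps_coeff f \<alpha>) * \<rho>\<^sub>0 ^ mon_degree \<alpha>) UNIV"
  have C: "wbounded v mon_degree \<rho>\<^sub>0 C (mps_coeff f)"
    unfolding wbounded_def C_def using \<rho>\<^sub>0 by (auto intro!: finite_sum_le_infsum)
  have "wbounded v (wdeg n w) \<rho> C (mps_coeff f)" if \<rho>: "0 < \<rho>" "\<rho> < min 1 \<rho>\<^sub>0" for \<rho>
  proof (rule wbounded_mono[OF C])
    fix \<alpha> assume "mps_coeff f \<alpha> \<noteq> 0"
    then have \<alpha>: "\<alpha> \<in> mons n" using f R_mons by blast
    have "mon_degree \<alpha> \<le> wdeg n w \<alpha>"
      unfolding mon_degree_wdeg[OF \<alpha>] wdeg_def using w by (intro sum_mono) auto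
    then have "\<rho> ^ wdeg n w \<alpha> \<le> \<rho> ^ mon_degree \<alpha>" using \<rho> by (intro power_decreasing) auto
    also have "\<dots> \<le> \<rho>\<^sub>0 ^ mon_degree \<alpha>" using \<rho> by (intro power_mono) auto
    finally show "\<rho> ^ wdeg n w \<alpha> \<le> \<rho>\<^sub>0 ^ mon_degree \<alpha>" .
  qed (use \<rho> in auto)
  then show "\<forall>\<^sub>F \<rho> in at_right 0. \<exists>C. wbounded v (wdeg n w) \<rho> C (mps_coeff f)"
    using \<rho>\<^sub>0(1) by (intro eventually_at_rightI[of 0 "min 1 \<rho>\<^sub>0"]) auto
next
  assume supp: "\<forall>\<alpha>. mps_coeff f \<alpha> \<noteq> 0 \<longrightarrow> \<alpha> \<in> mons n"
    and "\<forall>\<^sub>F \<rho> in at_right 0. \<exists>C. wbounded v (wdeg n w) \<rho> C (mps_coeff f)"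
  moreover have "\<forall>\<^sub>F \<rho> in at_right 0. 0 < \<rho> \<and> \<rho> < (1::real)"
    by (intro eventually_at_rightI[of 0 1]) auto
  ultimately have "\<forall>\<^sub>F \<rho> in at_right 0. (0 < \<rho> \<and> \<rho> < (1::real)) \<and> (\<exists>C. wbounded v (wdeg n w) \<rho> C (mps_coeff f))"
    by (simp add: eventually_conj_iff)
  then obtain \<rho> C where \<rho>: "0 < \<rho>" "\<rho> < 1" and C: "wbounded v (wdeg n w) \<rho> C (mps_coeff f)"
    using eventually_happens'[OF trivial_limit_at_right_real] by blast
  \<comment> \<open>No single weight exceeds L, and \<rho> < 1, so the smaller radius
    \<open>\<rho> ^ L\<close> compensates for replacing the weighted degree by the total
    degree.\<close>
  define L where "L = (\<Sum>i<n. w i)"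
  have "wbounded v mon_degree (\<rho> ^ L) C (mps_coeff f)"
  proof (rule wbounded_mono[OF C])
    fix \<alpha> assume "mps_coeff f \<alpha> \<noteq> 0"
    then have \<alpha>: "\<alpha> \<in> mons n" using supp by blast
    have "w i \<le> L" if "i < n" for i unfolding L_def using that by (intro member_le_sum) auto
    then have "wdeg n w \<alpha> \<le> L * mon_degree \<alpha>"
      unfolding mon_degree_wdeg[OF \<alpha>] wdeg_def sum_distrib_left by (intro sum_mono) auto
    then show "(\<rho> ^ L) ^ mon_degree \<alpha> \<le> \<rho> ^ wdeg n w \<alpha>"
      unfolding power_mult[symmetric] using \<rho> by (intro power_decreasing) auto
  qed (use \<rho> in auto)
  then have "(\<lambda>\<alpha>. v (mps_coeff f \<alpha>) * (\<rho> ^ L) ^ mon_degree \<alpha>) summable_on UNIV"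
    using \<rho> by (intro nonneg_bdd_above_summable_on) (auto simp: wbounded_def bdd_above_def)
  moreover have "\<rho> ^ L > 0" using \<rho> by simp
  ultimately show "f \<in> R"
    using supp unfolding R_def convergent_series_def formal_series_def mons_def by blast
qed

lemma eventually_pos: "\<forall>\<^sub>F \<rho> in at_right 0. 0 < (\<rho>::real)"
  by (simp add: eventually_at_right_less)

lemma R_add: assumes "f \<in> R" "g \<in> R" shows "f + g \<in> R"
proof -
  have "\<forall>\<^sub>F \<rho> in at_right 0. \<exists>C. wbounded v (wdeg n (\<lambda>_. 1)) \<rho> C (mps_coeff f)"
    "\<forall>\<^sub>F \<rho> in at_right 0. \<exists>C. wbounded v (wdeg n (\<lambda>_. 1)) \<rho> C (mps_coeff g)"
    using assms R_iff[of "\<lambda>_. 1"] by auto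
  then have "\<forall>\<^sub>F \<rho> in at_right 0. \<exists>C. wbounded v (wdeg n (\<lambda>_. 1)) \<rho> C (mps_coeff (f + g))"
    using eventually_pos
  proof eventually_elim
    case (elim \<rho>)
    then obtain C D where "wbounded v (wdeg n (\<lambda>_. 1)) \<rho> C (mps_coeff f)"
      "wbounded v (wdeg n (\<lambda>_. 1)) \<rho> D (mps_coeff g)" by blast
    from wbounded_add[OF this] elim have "wbounded v (wdeg n (\<lambda>_. 1)) \<rho> (C + D) (mps_coeff (f + g))"
      unfolding plus_mps.rep_eq by simp
    then show ?case by blast
  qed
  moreover have "\<alpha> \<in> mons n" if "mps_coeff (f + g) \<alpha> \<noteq> 0" for \<alpha>
  proof -
    have "mps_coeff f \<alpha> \<noteq> 0 \<or> mps_coeff g \<alpha> \<noteq> 0" using that by auto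
    then show ?thesis using assms R_mons by blast
  qed
  ultimately show ?thesis using R_iff[of "\<lambda>_. 1"] by blast
qed

lemma R_times: assumes "f \<in> R" "g \<in> R" shows "f * g \<in> R"
proof -
  have "\<forall>\<^sub>F \<rho> in at_right 0. \<exists>C. wbounded v (wdeg n (\<lambda>_. 1)) \<rho> C (mps_coeff f)"
    "\<forall>\<^sub>F \<rho> in at_right 0. \<exists>C. wbounded v (wdeg n (\<lambda>_. 1)) \<rho> C (mps_coeff g)"
    using assms R_iff[of "\<lambda>_. 1"] by auto
  then have "\<forall>\<^sub>F \<rho> in at_right 0. \<exists>C. wbounded v (wdeg n (\<lambda>_. 1)) \<rho> C (mps_coeff (f * g))"
    using eventually_pos
  proof eventually_elim
    case (elim \<rho>)
    then obtain C D where "wbounded v (wdeg n (\<lambda>_. 1)) \<rho> C (mps_coeff f)"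
      "wbounded v (wdeg n (\<lambda>_. 1)) \<rho> D (mps_coeff g)" by blast
    from wbounded_times[OF this] elim show ?case
      by (intro exI[of _ "C * D"]) (simp add: wdeg_add)
  qed
  moreover have "\<alpha> \<in> mons n" if "mps_coeff (f * g) \<alpha> \<noteq> 0" for \<alpha>
    using that by (rule mps_times_nonzero_coeffE) (use assms R_mons in auto)
  ultimately show ?thesis using R_iff[of "\<lambda>_. 1"] by blast
qed

lemma R_monom: assumes "\<alpha> \<in> mons n" shows "mps_monom \<alpha> a \<in> R"
proof -
  have "wbounded v (wdeg n (\<lambda>_. 1)) \<rho> (v a * \<rho> ^ wdeg n (\<lambda>_. 1) \<alpha>) (mps_coeff (mps_monom \<alpha> a))"
    if "\<rho> > 0" for \<rho>
    unfolding wbounded_def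
  proof (intro allI impI)
    fix A :: "mon set" assume "finite A"
    have "(\<Sum>x\<in>A. v (mps_coeff (mps_monom \<alpha> a) x) * \<rho> ^ wdeg n (\<lambda>_. 1) x) =
        (\<Sum>x\<in>A. if x = \<alpha> then v a * \<rho> ^ wdeg n (\<lambda>_. 1) \<alpha> else 0)"
      by (intro sum.cong) (auto simp: mps_coeff_monom)
    also have "\<dots> \<le> v a * \<rho> ^ wdeg n (\<lambda>_. 1) \<alpha>"
      using \<open>finite A\<close> that by (simp add: sum.delta')
    finally show "(\<Sum>x\<in>A. v (mps_coeff (mps_monom \<alpha> a) x) * \<rho> ^ wdeg n (\<lambda>_. 1) x) \<le>
      v a * \<rho> ^ wdeg n (\<lambda>_. 1) \<alpha>" .
  qed
  then have "\<forall>\<^sub>F \<rho> in at_right 0. \<exists>C. wbounded v (wdeg n (\<lambda>_. 1)) \<rho> C (mps_coeff (mps_monom \<alpha> a))"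
    by (intro eventually_mono[OF eventually_pos] exI)
  moreover have "\<beta> \<in> mons n" if "mps_coeff (mps_monom \<alpha> a) \<beta> \<noteq> 0" for \<beta>
    using that assms by (simp add: mps_coeff_monom split: if_splits)
  ultimately show ?thesis using R_iff[of "\<lambda>_. 1"] by blast
qed

lemma monom_0: "mps_monom \<alpha> 0 = 0" "mps_monom 0 1 = 1"
  by (auto simp: mps_eq_iff mps_coeff_monom)

lemma R_0 [simp]: "0 \<in> R" and R_1 [simp]: "1 \<in> R"
  using R_monom[of 0 0] R_monom[of 0 1] by (auto simp: monom_0)

lemma R_uminus: assumes "f \<in> R" shows "- f \<in> R"
proof -
  have "- f = mps_monom 0 (-1) * f"
    unfolding mps_eq_iff using mps_coeff_monom_times[of 0 "-1" f] by auto
  then show ?thesis using assms R_monom[of 0 "-1"] R_times by simp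
qed

lemma R_diff: "f \<in> R \<Longrightarrow> g \<in> R \<Longrightarrow> f - g \<in> R"
  using R_add[of f "- g"] R_uminus by simp

lemma R_sum: "(\<And>i. i \<in> A \<Longrightarrow> f i \<in> R) \<Longrightarrow> (\<Sum>i\<in>A. f i) \<in> R"
  by (induction A rule: infinite_finite_induct) (auto intro: R_add)

text \<open>Covers division by the monomial with exponent \<sigma> followed by discarding any set of
  coefficients, the two operations by which the cofactors of the variables are formed below.\<close>

lemma R_shift:
  assumes f: "f \<in> R" and g: "\<And>\<beta>. mps_coeff g \<beta> \<noteq> 0 \<Longrightarrow> mps_coeff g \<beta> = mps_coeff f (\<beta> + \<sigma>)"
  shows "g \<in> R"
proof -
  have "\<forall>\<^sub>F \<rho> in at_right 0. \<exists>C. wbounded v (wdeg n (\<lambda>_. 1)) \<rho> C (mps_coeff f)"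
    using f R_iff[of "\<lambda>_. 1"] by auto
  then have "\<forall>\<^sub>F \<rho> in at_right 0. \<exists>C. wbounded v (wdeg n (\<lambda>_. 1)) \<rho> C (mps_coeff g)"
    using eventually_pos
  proof eventually_elim
    case (elim \<rho>)
    then obtain C where C: "wbounded v (wdeg n (\<lambda>_. 1)) \<rho> C (mps_coeff f)" by blast
    have "wbounded v (wdeg n (\<lambda>_. 1)) \<rho> (C / \<rho> ^ wdeg n (\<lambda>_. 1) \<sigma>) (mps_coeff g)"
      by (rule wbounded_reindex[OF C elim(2), where h = "\<lambda>\<beta>. \<beta> + \<sigma>" and B = UNIV])
        (use g in \<open>simp_all add: wdeg_add inj_on_def\<close>)
    then show ?case by blast
  qed
  moreover have "\<beta> \<in> mons n" if "mps_coeff g \<beta> \<noteq> 0" for \<beta>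
    using R_mons[OF f, of "\<beta> + \<sigma>"] g[OF that] that by simp
  ultimately show ?thesis using R_iff[of "\<lambda>_. 1"] by blast
qed

lemma cring_R: "cring (series_ring R)"
proof (rule cringI)
  show "abelian_group (series_ring R)"
  proof (rule abelian_groupI)
    fix x assume "x \<in> carrier (series_ring R)"
    then show "\<exists>y\<in>carrier (series_ring R). y \<oplus>\<^bsub>series_ring R\<^esub> x = \<zero>\<^bsub>series_ring R\<^esub>"
      by (auto simp: series_ring_def intro!: bexI[of _ "- x"] R_uminus)
  qed (auto simp: series_ring_def R_add algebra_simps)
  show "comm_monoid (series_ring R)"
    by (rule comm_monoidI) (auto simp: series_ring_def R_times algebra_simps)
qed (auto simp: series_ring_def algebra_simps)

lemma ring_R: "ring (series_ring R)"
  using cring_R by (simp add: cring_def)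

lemma series_ring_inv: "f \<in> R \<Longrightarrow> inv\<^bsub>add_monoid (series_ring R)\<^esub> f = - f"
  using abelian_group.minus_equality[OF ring.is_abelian_group[OF ring_R], of "- f" f] R_uminus
  unfolding a_inv_def series_ring_def by auto

section \<open>The powers of the ideal in terms of the P-degrees of monomials\<close>

definition Pset :: "nat \<Rightarrow> 'k mps set" where
  "Pset j = {f \<in> R. \<forall>\<alpha>. mps_coeff f \<alpha> \<noteq> 0 \<longrightarrow> j \<le> pdeg c \<alpha>}"

lemma Pset_R: "f \<in> Pset j \<Longrightarrow> f \<in> R"
  by (simp add: Pset_def)

lemma Pset_add: "f \<in> Pset j \<Longrightarrow> g \<in> Pset j \<Longrightarrow> f + g \<in> Pset j"
  by (auto simp: Pset_def R_add) (metis add_0)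

lemma Pset_times: 
  assumes "f \<in> Pset i" "g \<in> Pset j" 
  shows "f * g \<in> Pset (i + j)"
proof -
  have "i + j \<le> pdeg c \<alpha>" if "mps_coeff (f * g) \<alpha> \<noteq> 0" for \<alpha>
    using that by (rule mps_times_nonzero_coeffE) (use assms in \<open>auto simp: Pset_def pdeg_add add_mono\<close>)
  then show ?thesis using assms by (simp add: Pset_def R_times)
qed

lemma Pset_0: "Pset 0 = R"
  by (auto simp: Pset_def)

lemma ideal_Pset: "ideal (Pset j) (series_ring R)"
proof (rule idealI[OF ring_R])
  show "subgroup (Pset j) (add_monoid (series_ring R))"
  proof
    fix x assume "x \<in> Pset j"
    then show "inv\<^bsub>add_monoid (series_ring R)\<^esub> x \<in> Pset j"
      using series_ring_inv[of x] by (simp add: Pset_def R_uminus)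
  next
    show "\<one>\<^bsub>add_monoid (series_ring R)\<^esub> \<in> Pset j" by (simp add: series_ring_def Pset_def)
  qed (auto simp: series_ring_def Pset_add intro: Pset_R)
next
  fix a x assume *: "a \<in> Pset j" "x \<in> carrier (series_ring R)"
  then have "x * a \<in> Pset j" using Pset_times[of x 0 a j] by (auto simp: Pset_0 series_ring_def)
  then show "x \<otimes>\<^bsub>series_ring R\<^esub> a \<in> Pset j" "a \<otimes>\<^bsub>series_ring R\<^esub> x \<in> Pset j"
    by (auto simp: series_ring_def mult.commute)
qed

lemma mps_var_Pset: "i < c \<Longrightarrow> mps_var i \<in> Pset 1"
  unfolding mps_var_def Pset_def using c_le_n pdeg_single[of i c]
  by (auto intro!: R_monom single_in_mons simp: mps_coeff_monom split: if_splits)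

text \<open>Each monomial of f is charged to the first variable it contains, and \<open>g i\<close>
  collects the monomials charged to variable i, divided by that variable. No monomial is used twice,
  and the P-degree drops by exactly one.\<close>

lemma Pset_Suc_decompose:
  assumes f: "f \<in> Pset (Suc j)"
  shows "\<exists>g. (\<forall>i<c. g i \<in> Pset j) \<and> f = (\<Sum>i<c. g i * mps_var i)"
proof -
  let ?e = "\<lambda>i. Poly_Mapping.single i (1::nat)"
  define g where "g i = Abs_mps (\<lambda>\<beta>. if \<forall>i'<i. Poly_Mapping.lookup (\<beta> + ?e i) i' = 0
    then mps_coeff f (\<beta> + ?e i) else 0)" for i
  have gc: "mps_coeff (g i) \<beta> = (if \<forall>i'<i. Poly_Mapping.lookup (\<beta> + ?e i) i' = 0
    then mps_coeff f (\<beta> + ?e i) else 0)" for i \<beta>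
    by (simp only: g_def mps_coeff_Abs)
  have g: "g i \<in> Pset j" if "i < c" for i
  proof -
    have "g i \<in> R" using f by (intro R_shift[OF Pset_R[OF f], of _ "?e i"]) (metis gc)
    moreover have "j \<le> pdeg c \<beta>" if "mps_coeff (g i) \<beta> \<noteq> 0" for \<beta>
    proof -
      have "mps_coeff f (\<beta> + ?e i) \<noteq> 0" using that by (metis gc)
      then have "Suc j \<le> pdeg c (\<beta> + ?e i)" using f by (simp add: Pset_def)
      then show ?thesis using pdeg_single[OF \<open>i < c\<close>] by (simp add: pdeg_add)
    qed
    ultimately show ?thesis by (simp add: Pset_def)
  qed
  have "f = (\<Sum>i<c. g i * mps_var i)"
    unfolding mps_eq_iff
  proof
    fix \<alpha>
    have least: "mps_coeff (g i * mps_var i) \<alpha> =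
      (if Poly_Mapping.lookup \<alpha> i \<noteq> 0 \<and> (\<forall>i'<i. Poly_Mapping.lookup \<alpha> i' = 0) then mps_coeff f \<alpha> else 0)" for i
    proof (cases "Poly_Mapping.lookup \<alpha> i = 0")
      case True
      have "\<nexists>\<beta>. \<alpha> = ?e i + \<beta>"
      proof
        assume "\<exists>\<beta>. \<alpha> = ?e i + \<beta>"
        then show False using True by (auto simp: lookup_add)
      qed
      then show ?thesis using True mps_coeff_monom_times_eq_0[of \<alpha> "?e i" 1 "g i"]
        by (simp add: mps_var_def mult.commute)
    next
      case False
      define \<beta> where "\<beta> = \<alpha> - ?e i"
      have \<alpha>: "\<alpha> = ?e i + \<beta>"
        using False by (intro poly_mapping_eqI) (auto simp: \<beta>_def lookup_add lookup_minus lookup_single when_def)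
      have "mps_coeff (g i * mps_var i) \<alpha> = mps_coeff (g i) \<beta>"
        unfolding mps_var_def mult.commute[of "g i"] \<alpha> mps_coeff_monom_times by simp
      also have "\<dots> = (if \<forall>i'<i. Poly_Mapping.lookup \<alpha> i' = 0 then mps_coeff f \<alpha> else 0)"
        by (simp only: gc \<alpha> add.commute)
      finally show ?thesis using False by simp
    qed
    show "mps_coeff f \<alpha> = mps_coeff (\<Sum>i<c. g i * mps_var i) \<alpha>"
    proof (cases "mps_coeff f \<alpha> = 0")
      case True
      then show ?thesis by (simp add: least cong: if_cong)
    next
      case False
      then have "pdeg c \<alpha> \<noteq> 0" using f by (auto simp: Pset_def)
      then obtain i\<^sub>1 where i\<^sub>1: "i\<^sub>1 < c" "Poly_Mapping.lookup \<alpha> i\<^sub>1 \<noteq> 0" by (auto simp: pdeg_def)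
      \<comment> \<open>The minimum is taken over all variables. It falls below c because the
        P-degree is positive and the variables of P have the smallest indices.\<close>
      define i\<^sub>0 where "i\<^sub>0 = (LEAST i. Poly_Mapping.lookup \<alpha> i \<noteq> 0)"
      have i\<^sub>0: "Poly_Mapping.lookup \<alpha> i\<^sub>0 \<noteq> 0"
        unfolding i\<^sub>0_def by (rule LeastI[of _ i\<^sub>1]) (rule i\<^sub>1(2))
      have i\<^sub>0_least: "Poly_Mapping.lookup \<alpha> i = 0" if "i < i\<^sub>0" for i
        using not_less_Least[OF that[unfolded i\<^sub>0_def]] by blast
      have "i\<^sub>0 \<le> i\<^sub>1" unfolding i\<^sub>0_def by (rule Least_le) (rule i\<^sub>1(2))
      then have i\<^sub>0_c: "i\<^sub>0 < c" using i\<^sub>1(1) by simp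
      have "(Poly_Mapping.lookup \<alpha> i \<noteq> 0 \<and> (\<forall>i'<i. Poly_Mapping.lookup \<alpha> i' = 0)) \<longleftrightarrow> i = i\<^sub>0" for i
        using i\<^sub>0 i\<^sub>0_least by (metis linorder_neqE_nat)
      then show ?thesis using i\<^sub>0_c by (simp add: least)
    qed
  qed
  then show ?thesis using g by blast
qed

lemma P_ideal_eq: "P_ideal R c = Pset 1"
proof
  show "P_ideal R c \<subseteq> Pset 1"
    unfolding P_ideal_def genideal_def using ideal_Pset[of 1] mps_var_Pset by blast
  show "Pset 1 \<subseteq> P_ideal R c"
  proof
    fix f assume "f \<in> Pset 1"
    then obtain g where g: "\<forall>i<c. g i \<in> Pset 0" "f = (\<Sum>i<c. g i * mps_var i)"
      using Pset_Suc_decompose[of f 0] by auto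
    have "f \<in> J" if J: "ideal J (series_ring R)" "{mps_var i |i. i < c} \<subseteq> J" for J
    proof -
      have "(\<Sum>i<k. g i * mps_var i) \<in> J" if "k \<le> c" for k
        using that
      proof (induction k)
        case 0
        then show ?case using additive_subgroup.zero_closed[OF ideal.axioms(1)[OF J(1)]]
          by (simp add: series_ring_def)
      next
        case (Suc k)
        have "g k * mps_var k \<in> J"
        proof -
          have "mps_var k \<in> J" using J(2) Suc_le_lessD[OF Suc.prems] by blast
          then show ?thesis using ideal.I_l_closed[OF J(1), of "mps_var k" "g k"] g(1) Suc.prems
            by (auto simp: series_ring_def Pset_0)
        qed
        then show ?case
          using additive_subgroup.a_closed[OF ideal.axioms(1)[OF J(1)]] Suc
          by (auto simp: series_ring_def)
      qed
      then show ?thesis using g(2) by simp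
    qed
    then show "f \<in> P_ideal R c" unfolding P_ideal_def genideal_def by blast
  qed
qed

text \<open>One inclusion is additivity of the P-degree; the other is the decomposition along the
  variables, whose summands are products of the required shape.\<close>

lemma ideal_prod_Pset: "ideal_prod (series_ring R) (Pset j) (Pset 1) = Pset (Suc j)"
proof safe
  fix f assume "f \<in> ideal_prod (series_ring R) (Pset j) (Pset 1)"
  then show "f \<in> Pset (Suc j)"
  proof induction
    case (prod a b)
    then show ?case using Pset_times[of a j b 1] by (simp add: series_ring_def)
  next
    case (sum a b)
    then show ?case by (simp add: series_ring_def Pset_add)
  qed
next
  fix f assume "f \<in> Pset (Suc j)"
  then obtain g where g: "\<forall>i<c. g i \<in> Pset j" "f = (\<Sum>i<c. g i * mps_var i)"
    using Pset_Suc_decompose by blast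
  have 1: "a * b \<in> ideal_prod (series_ring R) (Pset j) (Pset 1)" if "a \<in> Pset j" "b \<in> Pset 1" for a b
    using ideal_prod.prod[OF that, of "series_ring R"] by (simp add: series_ring_def)
  have 2: "a + b \<in> ideal_prod (series_ring R) (Pset j) (Pset 1)"
    if "a \<in> ideal_prod (series_ring R) (Pset j) (Pset 1)"
       "b \<in> ideal_prod (series_ring R) (Pset j) (Pset 1)" for a b
    using ideal_prod.sum[OF that] by (simp add: series_ring_def)
  have "(\<Sum>i<k. g i * mps_var i) \<in> ideal_prod (series_ring R) (Pset j) (Pset 1)" if "k \<le> c" for k
    using that
  proof (induction k)
    case 0
    then show ?case using 1[of 0 0] by (simp add: Pset_def)
  next
    case (Suc k)
    then show ?case using 2[OF Suc.IH 1[of "g k" "mps_var k"]] g(1) mps_var_Pset[of k] by simp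
  qed
  then show "f \<in> ideal_prod (series_ring R) (Pset j) (Pset 1)" using g(2) by simp
qed

text \<open>The form in which powers are used from here on: membership is a lower bound on the
  P-degree of each monomial. For i \<le> 0 the bound is vacuous, in agreement with the truncation in
  \<open>P_power\<close>.\<close>

lemma P_power_eq: "P_power R c i = {f \<in> R. \<forall>\<alpha>. mps_coeff f \<alpha> \<noteq> 0 \<longrightarrow> i \<le> int (pdeg c \<alpha>)}"
proof -
  have "P_ideal R c [^]\<^bsub>ideals_set (series_ring R)\<^esub> j = Pset j" for j :: nat
  proof (induction j)
    case 0
    then show ?case by (simp add: nat_pow_def ideals_set_def Pset_0 series_ring_def)
  next
    case (Suc j)
    then show ?case using ideal_prod_Pset[of j] by (simp add: nat_pow_def ideals_set_def P_ideal_eq)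
  qed
  then show ?thesis unfolding P_power_def Pset_def by (auto simp: nat_le_iff)
qed

end

section \<open>Monomial orders\<close>

definition mmons :: "nat \<Rightarrow> nat \<Rightarrow> mmon set" where
  "mmons n m = mons n \<times> {..<m}"

definition mwdeg :: "nat \<Rightarrow> (nat \<Rightarrow> nat) \<Rightarrow> (nat \<Rightarrow> nat) \<Rightarrow> mmon \<Rightarrow> nat" where
  "mwdeg n w s \<mu> = wdeg n w (fst \<mu>) + s (snd \<mu>)"

text \<open>The last assumption is what makes Grauert's division converge: one positive weight
  function separates finitely many prescribed monomials from all larger ones simultaneously, so
  that the tails of the divisors become small against their initial terms.\<close>

locale good_order =
  fixes n c m :: nat and a :: "nat \<Rightarrow> nat" and lt :: "mmon \<Rightarrow> mmon \<Rightarrow> bool"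
  assumes total: "\<mu> \<in> mmons n m \<Longrightarrow> \<nu> \<in> mmons n m \<Longrightarrow> \<mu> \<noteq> \<nu> \<Longrightarrow> lt \<mu> \<nu> \<or> lt \<nu> \<mu>"
    and wf_lt: "wf {(\<mu>, \<nu>). \<mu> \<in> mmons n m \<and> \<nu> \<in> mmons n m \<and> lt \<mu> \<nu>}"
    and compat: "(\<alpha>, i) \<in> mmons n m \<Longrightarrow> (\<beta>, j) \<in> mmons n m \<Longrightarrow> \<gamma> \<in> mons n \<Longrightarrow> lt (\<alpha>, i) (\<beta>, j) \<Longrightarrow>
        lt (\<gamma> + \<alpha>, i) (\<gamma> + \<beta>, j)"
    and graded: "(\<alpha>, i) \<in> mmons n m \<Longrightarrow> (\<beta>, j) \<in> mmons n m \<Longrightarrow> lt (\<alpha>, i) (\<beta>, j) \<Longrightarrow>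
        pdeg c \<alpha> + a i \<le> pdeg c \<beta> + a j"
    and weights: "finite S \<Longrightarrow> S \<subseteq> mmons n m \<Longrightarrow> \<exists>w s. (\<forall>i<n. 1 \<le> w i) \<and>
        (\<forall>\<mu>\<in>S. \<forall>\<nu>\<in>mmons n m. lt \<mu> \<nu> \<longrightarrow> mwdeg n w s \<mu> < mwdeg n w s \<nu>)"
begin

lemma lt_asym: "\<mu> \<in> mmons n m \<Longrightarrow> \<nu> \<in> mmons n m \<Longrightarrow> lt \<mu> \<nu> \<Longrightarrow> \<not> lt \<nu> \<mu>"
  using wf_not_sym[OF wf_lt, of \<mu> \<nu>] by auto

text \<open>Asymmetry, which well-foundedness implies, makes the definite description in
  \<open>init_mon\<close> unambiguous on supports inside \<open>mmons n m\<close>.\<close>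

lemma init_mon_unique:
  assumes "vec_supp g \<subseteq> mmons n m" "\<mu> \<in> vec_supp g" "\<And>\<nu>. \<nu> \<in> vec_supp g \<Longrightarrow> \<nu> \<noteq> \<mu> \<Longrightarrow> lt \<mu> \<nu>"
  shows "init_mon lt g = \<mu>"
  unfolding init_mon_def
proof (rule the_equality)
  fix \<mu>' assume \<mu>': "\<mu>' \<in> vec_supp g \<and> (\<forall>\<nu>\<in>vec_supp g. \<nu> \<noteq> \<mu>' \<longrightarrow> lt \<mu>' \<nu>)"
  show "\<mu>' = \<mu>"
  proof (rule ccontr)
    assume "\<mu>' \<noteq> \<mu>"
    then have "lt \<mu>' \<mu>" "lt \<mu> \<mu>'" using \<mu>' assms by auto
    then show False using lt_asym \<mu>' assms by blast
  qed
qed (use assms in auto)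

lemma init_mon_least:
  assumes "vec_supp g \<subseteq> mmons n m" "vec_supp g \<noteq> {}"
  shows "init_mon lt g \<in> vec_supp g" "\<And>\<nu>. \<nu> \<in> vec_supp g \<Longrightarrow> \<nu> \<noteq> init_mon lt g \<Longrightarrow> lt (init_mon lt g) \<nu>"
proof -
  obtain \<mu> where \<mu>: "\<mu> \<in> vec_supp g"
    and min: "\<And>\<nu>. (\<nu>, \<mu>) \<in> {(\<mu>, \<nu>). \<mu> \<in> mmons n m \<and> \<nu> \<in> mmons n m \<and> lt \<mu> \<nu>} \<Longrightarrow> \<nu> \<notin> vec_supp g"
  proof -
    obtain \<mu>\<^sub>0 where "\<mu>\<^sub>0 \<in> vec_supp g" using assms(2) by blast
    from wfE_min[OF wf_lt this] show ?thesis using that by blast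
  qed
  have least: "lt \<mu> \<nu>" if "\<nu> \<in> vec_supp g" "\<nu> \<noteq> \<mu>" for \<nu>
  proof -
    have mem: "\<mu> \<in> mmons n m" "\<nu> \<in> mmons n m" using that(1) \<mu> assms(1) by blast+
    have "\<not> lt \<nu> \<mu>" using min[of \<nu>] that(1) mem by blast
    then show ?thesis using total[OF mem] that(2) by blast
  qed
  have eq: "init_mon lt g = \<mu>" by (rule init_mon_unique[OF assms(1) \<mu> least])
  show "init_mon lt g \<in> vec_supp g" unfolding eq by (rule \<mu>)
  show "lt (init_mon lt g) \<nu>" if "\<nu> \<in> vec_supp g" "\<nu> \<noteq> init_mon lt g" for \<nu>
    using that unfolding eq by (rule least)
qed

end

section \<open>Lexicographic comparison of finitely many linear forms\<close>

lemma lex_append: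
  "length us = length us' \<Longrightarrow>
    (us @ vs, us' @ vs') \<in> lex r \<longleftrightarrow> (us, us') \<in> lex r \<and> length vs = length vs' \<or> us = us' \<and> (vs, vs') \<in> lex r"
  by (induction us us' rule: list_induct2) auto

abbreviation wdegs :: "nat \<Rightarrow> (nat \<Rightarrow> nat) list \<Rightarrow> mon \<Rightarrow> nat list" where
  "wdegs n hs \<alpha> \<equiv> map (\<lambda>h. wdeg n h \<alpha>) hs"

lemma wdegs_total: "(wdegs n hs \<alpha>, wdegs n hs \<beta>) \<in> lex less_than \<or> (wdegs n hs \<beta>, wdegs n hs \<alpha>) \<in> lex less_than
   \<or> wdegs n hs \<alpha> = wdegs n hs \<beta>"
  by (induction hs) auto

lemma wdegs_compat: "(wdegs n hs (\<gamma> + \<alpha>), wdegs n hs (\<gamma> + \<beta>)) \<in> lex less_than \<longleftrightarrow>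
   (wdegs n hs \<alpha>, wdegs n hs \<beta>) \<in> lex less_than"
  by (induction hs) (auto simp: wdeg_add)

text \<open>A lexicographic comparison is imitated by one linear form in which earlier coordinates
  get much larger factors. How large depends only on the smaller of the two monomials, which ranges
  over the finite set S, so \<beta> can stay arbitrary.\<close>

lemma wdegs_weights:
  assumes "finite S"
  shows "\<exists>w. (\<forall>i<n. 1 \<le> w i) \<and>
    (\<forall>\<alpha>\<in>S. \<forall>\<beta>. (wdegs n hs \<alpha>, wdegs n hs \<beta>) \<in> lex less_than \<longrightarrow> wdeg n w \<alpha> < wdeg n w \<beta>)"
proof (induction hs)
  case Nil
  then show ?case by (intro exI[of _ "\<lambda>_. 1"]) auto
next
  case (Cons h hs)
  then obtain w where w: "\<forall>i<n. 1 \<le> w i"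
    "\<And>\<alpha> \<beta>. \<alpha> \<in> S \<Longrightarrow> (wdegs n hs \<alpha>, wdegs n hs \<beta>) \<in> lex less_than \<Longrightarrow> wdeg n w \<alpha> < wdeg n w \<beta>"
    by blast
  \<comment> \<open>N exceeds all values of w on S, so one unit of the leading form h outweighs
    everything that w contributes there.\<close>
  define N where "N = Suc (Max (insert 0 (wdeg n w ` S)))"
  have N: "wdeg n w \<alpha> < N" if "\<alpha> \<in> S" for \<alpha>
    unfolding N_def using that assms by (intro le_imp_less_Suc Max_ge) auto
  define w' where "w' i = N * h i + w i" for i
  have w': "wdeg n w' \<alpha> = N * wdeg n h \<alpha> + wdeg n w \<alpha>" for \<alpha>
    unfolding w'_def wdeg_def by (simp add: algebra_simps sum.distrib sum_distrib_left)
  have "wdeg n w' \<alpha> < wdeg n w' \<beta>"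
    if \<alpha>: "\<alpha> \<in> S" and less: "(wdegs n (h # hs) \<alpha>, wdegs n (h # hs) \<beta>) \<in> lex less_than" for \<alpha> \<beta>
  proof -
    consider "wdeg n h \<alpha> < wdeg n h \<beta>" | "wdeg n h \<alpha> = wdeg n h \<beta>" "(wdegs n hs \<alpha>, wdegs n hs \<beta>) \<in> lex less_than"
      using less by auto
    then show ?thesis
    proof cases
      case 1
      have "wdeg n w' \<alpha> < N * Suc (wdeg n h \<alpha>)" unfolding w' using N[OF \<alpha>] by simp
      also have "\<dots> \<le> N * wdeg n h \<beta>" using 1 by (intro mult_le_mono2) simp
      also have "\<dots> \<le> wdeg n w' \<beta>" unfolding w' by simp
      finally show ?thesis .
    next
      case 2
      then show ?thesis using w(2)[OF \<alpha>] by (simp add: w')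
    qed
  qed
  moreover have "\<forall>i<n. 1 \<le> w' i" using w(1) unfolding w'_def by (simp add: trans_le_add2)
  ultimately show ?case by blast
qed

lemma wdeg_lookup: "i < n \<Longrightarrow> wdeg n (\<lambda>j. of_bool (j = i)) \<alpha> = Poly_Mapping.lookup \<alpha> i"
  unfolding wdeg_def by (simp add: of_bool_def if_distrib[of "\<lambda>x. x * _"] cong: if_cong)

lemma wdeg_pdeg: 
  assumes "c \<le> n" 
  shows "wdeg n (\<lambda>j. of_bool (j < c)) \<alpha> = pdeg c \<alpha>"
proof -
  have "wdeg n (\<lambda>j. of_bool (j < c)) \<alpha> = (\<Sum>j\<in>{..<n}. if j < c then Poly_Mapping.lookup \<alpha> j else 0)"
    unfolding wdeg_def by (intro sum.cong) auto
  also have "\<dots> = (\<Sum>j\<in>{j\<in>{..<n}. j < c}. Poly_Mapping.lookup \<alpha> j)"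
    by (rule sum.inter_filter[symmetric]) simp
  also have "{j\<in>{..<n}. j < c} = {..<c}" using assms by auto
  finally show ?thesis by (simp add: pdeg_def)
qed

text \<open>The four stages of \<open>mon_less\<close> as linear forms: P-degree, exponents in the
  order \<open>xs\<close>, total degree, exponents in the order \<open>ys\<close>. One flat list
  replaces the nested comparison.\<close>

definition ring_weights :: "nat \<Rightarrow> nat list \<Rightarrow> nat list \<Rightarrow> (nat \<Rightarrow> nat) list" where
  "ring_weights c xs ys = [\<lambda>j. of_bool (j < c)] @ map (\<lambda>i j. of_bool (j = i)) xs @ [\<lambda>_. 1] @
     map (\<lambda>i j. of_bool (j = i)) ys"

lemma mon_less_wdegs:
  assumes "c \<le> n" "set xs = {..<c}" "set ys = {..<n}" "\<alpha> \<in> mons n" "\<beta> \<in> mons n"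
  shows "mon_less c xs ys \<alpha> \<beta> \<longleftrightarrow>
    (wdegs n (ring_weights c xs ys) \<alpha>, wdegs n (ring_weights c xs ys) \<beta>) \<in> lex less_than"
proof -
  have xs: "map (\<lambda>i. wdeg n (\<lambda>j. of_bool (j = i)) \<gamma>) xs = map (Poly_Mapping.lookup \<gamma>) xs" for \<gamma>
    using assms by (intro map_cong) (auto simp: wdeg_lookup)
  have ys: "map (\<lambda>i. wdeg n (\<lambda>j. of_bool (j = i)) \<gamma>) ys = map (Poly_Mapping.lookup \<gamma>) ys" for \<gamma>
    using assms by (intro map_cong) (auto simp: wdeg_lookup)
  show ?thesis
    unfolding mon_less_def ring_weights_def using assms(1,4,5)
    by (simp add: o_def xs ys wdeg_pdeg lex_append mon_degree_wdeg pdeg_def[symmetric])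
qed

lemma good_order_ring:
  assumes "c \<le> n" "set xs = {..<c}" "set ys = {..<n}"
  shows "good_order n c 1 (\<lambda>_. 0) (\<lambda>\<mu> \<nu>. mon_less c xs ys (fst \<mu>) (fst \<nu>))"
proof
  note less = mon_less_wdegs[OF assms]
  fix \<mu> \<nu> :: mmon assume *: "\<mu> \<in> mmons n 1" "\<nu> \<in> mmons n 1" "\<mu> \<noteq> \<nu>"
  have "wdegs n (ring_weights c xs ys) (fst \<mu>) \<noteq> wdegs n (ring_weights c xs ys) (fst \<nu>)"
  proof
    assume "wdegs n (ring_weights c xs ys) (fst \<mu>) = wdegs n (ring_weights c xs ys) (fst \<nu>)"
    \<comment> \<open>The forms coming from \<open>ys\<close> alone determine every exponent, hence
      the monomial; totality rests on this.\<close>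
    then have "\<forall>i<n. Poly_Mapping.lookup (fst \<mu>) i = Poly_Mapping.lookup (fst \<nu>) i"
      using assms(3) by (auto simp: ring_weights_def wdeg_lookup)
    then have "fst \<mu> = fst \<nu>" using * by (intro mon_eq_iff_mons[of _ n]) (auto simp: mmons_def)
    then show False using * by (auto simp: mmons_def prod_eq_iff)
  qed
  then show "mon_less c xs ys (fst \<mu>) (fst \<nu>) \<or> mon_less c xs ys (fst \<nu>) (fst \<mu>)"
    using wdegs_total[where n = n and hs = "ring_weights c xs ys" and \<alpha> = "fst \<mu>" and \<beta> = "fst \<nu>"] * less by (auto simp: mmons_def)
next
  have "wf (inv_image (less_than <*lex*> lex less_than <*lex*> less_than <*lex*> lex less_than)
    (\<lambda>\<mu>. ((\<Sum>i<c. Poly_Mapping.lookup (fst \<mu>) i), map (Poly_Mapping.lookup (fst \<mu>)) xs, mon_degree (fst \<mu>),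
       map (Poly_Mapping.lookup (fst \<mu>)) ys)))" (is "wf ?r")
    by (intro wf_inv_image wf_lex_prod wf_less_than wf_lex)
  moreover have "{(\<mu>, \<nu>). \<mu> \<in> mmons n 1 \<and> \<nu> \<in> mmons n 1 \<and> mon_less c xs ys (fst \<mu>) (fst \<nu>)} \<subseteq> ?r"
    by (auto simp: mon_less_def)
  ultimately show "wf {(\<mu>, \<nu>). \<mu> \<in> mmons n 1 \<and> \<nu> \<in> mmons n 1 \<and> mon_less c xs ys (fst \<mu>) (fst \<nu>)}"
    by (rule wf_subset)
next
  fix \<alpha> \<beta> \<gamma> i j
  assume "(\<alpha>, i) \<in> mmons n 1" "(\<beta>, j) \<in> mmons n 1" "\<gamma> \<in> mons n"
    "mon_less c xs ys (fst (\<alpha>, i)) (fst (\<beta>, j))"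
  then show "mon_less c xs ys (fst (\<gamma> + \<alpha>, i)) (fst (\<gamma> + \<beta>, j))"
    by (simp add: mon_less_wdegs[OF assms] wdegs_compat mmons_def)
next
  fix \<alpha> \<beta> i j
  assume *: "(\<alpha>, i) \<in> mmons n 1" "(\<beta>, j) \<in> mmons n 1"
    "mon_less c xs ys (fst (\<alpha>, i)) (fst (\<beta>, j))"
  then show "pdeg c \<alpha> + 0 \<le> pdeg c \<beta> + 0"
    by (auto simp: mon_less_def pdeg_def)
next
  fix S assume S: "finite S" "S \<subseteq> mmons n 1"
  obtain w where w: "\<forall>i<n. 1 \<le> w i" "\<forall>\<alpha>\<in>fst ` S. \<forall>\<beta>. (wdegs n (ring_weights c xs ys) \<alpha>,
      wdegs n (ring_weights c xs ys) \<beta>) \<in> lex less_than \<longrightarrow> wdeg n w \<alpha> < wdeg n w \<beta>"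
    using wdegs_weights[where S = "fst ` S" and n = n and hs = "ring_weights c xs ys"] S(1) by auto
  have "\<forall>\<mu>\<in>S. \<forall>\<nu>\<in>mmons n 1. mon_less c xs ys (fst \<mu>) (fst \<nu>) \<longrightarrow> mwdeg n w (\<lambda>_. 0) \<mu> < mwdeg n w (\<lambda>_. 0) \<nu>"
    using w(2) S(2) by (force simp: mwdeg_def mmons_def mon_less_wdegs[OF assms])
  then show "\<exists>w s. (\<forall>i<n. 1 \<le> w i) \<and> (\<forall>\<mu>\<in>S. \<forall>\<nu>\<in>mmons n 1.
      mon_less c xs ys (fst \<mu>) (fst \<nu>) \<longrightarrow> mwdeg n w s \<mu> < mwdeg n w s \<nu>)"
    using w(1) by blast
qed

text \<open>Pulls an order back along the map sending (\<alpha>, l) to (\<alpha> + \<sigma> l,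
  \<iota> l), where \<sigma> l and \<iota> l stand for the exponent and the component of the initial
  monomial of a column. The map need not be injective, so the basis index breaks ties; a' is the
  weight for which the map preserves the weighted P-degree. Schreyer orders are the intended
  instance.\<close>

lemma good_order_induced:
  assumes "good_order n c p a lt"
    and \<sigma>: "\<And>l. l < m \<Longrightarrow> (\<sigma> l, \<iota> l) \<in> mmons n p"
    and lt': "\<And>\<alpha> \<beta> l l'. \<alpha> \<in> mons n \<Longrightarrow> \<beta> \<in> mons n \<Longrightarrow> l < m \<Longrightarrow> l' < m \<Longrightarrow>
      lt' (\<alpha>, l) (\<beta>, l') \<longleftrightarrow> lt (\<alpha> + \<sigma> l, \<iota> l) (\<beta> + \<sigma> l', \<iota> l') \<or>
        (\<alpha> + \<sigma> l, \<iota> l) = (\<beta> + \<sigma> l', \<iota> l') \<and> l < l'"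
    and a': "\<And>l. l < m \<Longrightarrow> a' l = pdeg c (\<sigma> l) + a (\<iota> l)"
  shows "good_order n c m a' lt'"
proof -
  interpret good_order n c p a lt by fact
  have mem: "\<alpha> \<in> mons n \<and> l < m" "(\<alpha> + \<sigma> l, \<iota> l) \<in> mmons n p" if "(\<alpha>, l) \<in> mmons n m" for \<alpha> l
    using that \<sigma>[of l] by (auto simp: mmons_def)
  have lt'': "lt' (\<alpha>, l) (\<beta>, l') \<longleftrightarrow> lt (\<alpha> + \<sigma> l, \<iota> l) (\<beta> + \<sigma> l', \<iota> l') \<or>
        (\<alpha> + \<sigma> l, \<iota> l) = (\<beta> + \<sigma> l', \<iota> l') \<and> l < l'"
    if "(\<alpha>, l) \<in> mmons n m" "(\<beta>, l') \<in> mmons n m" for \<alpha> l \<beta> l'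
    using mem(1)[OF that(1)] mem(1)[OF that(2)] by (intro lt') auto
  show ?thesis
  proof
    fix \<mu> \<nu> assume *: "\<mu> \<in> mmons n m" "\<nu> \<in> mmons n m" "\<mu> \<noteq> \<nu>"
    obtain \<alpha> l \<beta> l' where [simp]: "\<mu> = (\<alpha>, l)" "\<nu> = (\<beta>, l')" by fastforce
    show "lt' \<mu> \<nu> \<or> lt' \<nu> \<mu>"
    proof (cases "(\<alpha> + \<sigma> l, \<iota> l) = (\<beta> + \<sigma> l', \<iota> l')")
      case True
      then have "l \<noteq> l'" using * by auto
      then show ?thesis using True * by (auto simp: lt'' neq_iff)
    next
      case False
      then have "lt (\<alpha> + \<sigma> l, \<iota> l) (\<beta> + \<sigma> l', \<iota> l') \<or> lt (\<beta> + \<sigma> l', \<iota> l') (\<alpha> + \<sigma> l, \<iota> l)"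
        using * by (intro total mem) auto
      then show ?thesis using * by (auto simp: lt'')
    qed
  next
    let ?r = "{(\<mu>, \<nu>). \<mu> \<in> mmons n p \<and> \<nu> \<in> mmons n p \<and> lt \<mu> \<nu>}"
    let ?f = "\<lambda>(\<alpha>, l). ((\<alpha> + \<sigma> l, \<iota> l), l)"
    have "wf (inv_image (?r <*lex*> less_than) ?f)"
      by (intro wf_inv_image wf_lex_prod wf_less_than wf_lt)
    moreover have "{(\<mu>, \<nu>). \<mu> \<in> mmons n m \<and> \<nu> \<in> mmons n m \<and> lt' \<mu> \<nu>} \<subseteq> inv_image (?r <*lex*> less_than) ?f"
      by (auto simp: lt'' mem)
    ultimately show "wf {(\<mu>, \<nu>). \<mu> \<in> mmons n m \<and> \<nu> \<in> mmons n m \<and> lt' \<mu> \<nu>}"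
      by (rule wf_subset)
  next
    fix \<alpha> \<beta> \<gamma> i j
    assume *: "(\<alpha>, i) \<in> mmons n m" "(\<beta>, j) \<in> mmons n m" "\<gamma> \<in> mons n" "lt' (\<alpha>, i) (\<beta>, j)"
    then have "(\<gamma> + \<alpha>, i) \<in> mmons n m" "(\<gamma> + \<beta>, j) \<in> mmons n m" by (auto simp: mmons_def)
    then show "lt' (\<gamma> + \<alpha>, i) (\<gamma> + \<beta>, j)"
      using * compat[OF mem(2)[OF *(1)] mem(2)[OF *(2)] *(3)] by (auto simp: lt'' add.assoc)
  next
    fix \<alpha> \<beta> i j
    assume *: "(\<alpha>, i) \<in> mmons n m" "(\<beta>, j) \<in> mmons n m" "lt' (\<alpha>, i) (\<beta>, j)"
    then have "pdeg c (\<alpha> + \<sigma> i) + a (\<iota> i) \<le> pdeg c (\<beta> + \<sigma> j) + a (\<iota> j)"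
      using graded[OF mem(2)[OF *(1)] mem(2)[OF *(2)]] by (auto simp: lt'')
    then show "pdeg c \<alpha> + a' i \<le> pdeg c \<beta> + a' j"
      using a' mem(1)[OF *(1)] mem(1)[OF *(2)] by (simp add: pdeg_add)
  next
    fix S assume S: "finite S" "S \<subseteq> mmons n m"
    let ?f = "\<lambda>(\<alpha>, l). (\<alpha> + \<sigma> l, \<iota> l)"
    have "?f ` S \<subseteq> mmons n p" using S(2) mem by auto
    from weights[OF finite_imageI[OF S(1)] this] obtain w s where w: "\<forall>i<n. 1 \<le> w i"
      and ws: "\<And>\<mu> \<nu>. \<mu> \<in> ?f ` S \<Longrightarrow> \<nu> \<in> mmons n p \<Longrightarrow> lt \<mu> \<nu> \<Longrightarrow> mwdeg n w s \<mu> < mwdeg n w s \<nu>" by blast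
    \<comment> \<open>Scaling by \<open>Suc m\<close> leaves room for the tie-breaker: a difference
      of at least 1 in the old weight outweighs an index l < m, and equal old weights are separated
      by the index.\<close>
    define w' where "w' i = Suc m * w i" for i
    define s' where "s' l = Suc m * (wdeg n w (\<sigma> l) + s (\<iota> l)) + l" for l
    have w': "wdeg n w' \<alpha> = Suc m * wdeg n w \<alpha>" for \<alpha>
      by (simp add: w'_def wdeg_def sum_distrib_left algebra_simps sum.distrib)
    have mw': "mwdeg n w' s' (\<alpha>, l) = Suc m * mwdeg n w s (\<alpha> + \<sigma> l, \<iota> l) + l" for \<alpha> l
      unfolding mwdeg_def w' s'_def by (simp add: wdeg_add algebra_simps)
    have "mwdeg n w' s' \<mu> < mwdeg n w' s' \<nu>" if *: "\<mu> \<in> S" "\<nu> \<in> mmons n m" "lt' \<mu> \<nu>" for \<mu> \<nu>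
    proof -
      obtain \<alpha> l \<beta> l' where [simp]: "\<mu> = (\<alpha>, l)" "\<nu> = (\<beta>, l')" by fastforce
      have \<mu>: "(\<alpha>, l) \<in> mmons n m" and \<nu>: "(\<beta>, l') \<in> mmons n m" using * S by auto
      from *(3) consider "lt (\<alpha> + \<sigma> l, \<iota> l) (\<beta> + \<sigma> l', \<iota> l')"
        | "(\<alpha> + \<sigma> l, \<iota> l) = (\<beta> + \<sigma> l', \<iota> l')" "l < l'" using lt''[OF \<mu> \<nu>] by auto
      then show ?thesis
      proof cases
        case 1
        have "mwdeg n w s (\<alpha> + \<sigma> l, \<iota> l) < mwdeg n w s (\<beta> + \<sigma> l', \<iota> l')"
          by (rule ws[OF _ mem(2)[OF \<nu>] 1]) (use * in force)
        then have "Suc m * Suc (mwdeg n w s (\<alpha> + \<sigma> l, \<iota> l)) \<le> Suc m * mwdeg n w s (\<beta> + \<sigma> l', \<iota> l')"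
          by (intro mult_le_mono2) simp
        moreover have "l < m" using mem(1)[OF \<mu>] by simp
        ultimately show ?thesis unfolding \<open>\<mu> = _\<close> \<open>\<nu> = _\<close> mw' by simp
      next
        case 2
        then show ?thesis unfolding \<open>\<mu> = _\<close> \<open>\<nu> = _\<close> mw' by simp
      qed
    qed
    moreover have "\<forall>i<n. 1 \<le> w' i" using w by (auto simp: w'_def)
    ultimately show "\<exists>w s. (\<forall>i<n. 1 \<le> w i) \<and>
        (\<forall>\<mu>\<in>S. \<forall>\<nu>\<in>mmons n m. lt' \<mu> \<nu> \<longrightarrow> mwdeg n w s \<mu> < mwdeg n w s \<nu>)" by blast
  qed
qed

section \<open>Formal series as convergent series\<close>

lemma sum_half_powers_le: "(\<Sum>j\<le>M. (1 / 2 :: real) ^ j) \<le> 2"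
proof -
  have "(\<Sum>j\<le>M. (1 / 2 :: real) ^ j) = 2 - (1 / 2) ^ M"
    by (induction M) auto
  then show ?thesis by simp
qed

text \<open>Placing A in a box {0..M}^n factors the sum into n truncated geometric series, each at
  most 2.\<close>

lemma sum_half_mon_degree_le:
  assumes "finite A" "A \<subseteq> mons n"
  shows "(\<Sum>\<alpha>\<in>A. (1 / 2 :: real) ^ mon_degree \<alpha>) \<le> 2 ^ n"
proof -
  define M where "M = Max (insert 0 (mon_degree ` A))"
  have M: "mon_degree \<alpha> \<le> M" if "\<alpha> \<in> A" for \<alpha>
    unfolding M_def using that assms by (intro Max_ge) auto
  \<comment> \<open>\<open>restrict\<close> moves the exponent vectors into the extensional function
    space over which \<open>prod_sum_PiE\<close> expands a product of sums.\<close>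
  let ?h = "\<lambda>\<alpha>. restrict (Poly_Mapping.lookup \<alpha>) {..<n}"
  have inj: "inj_on ?h A"
  proof (rule inj_onI)
    fix \<alpha> \<beta> assume *: "\<alpha> \<in> A" "\<beta> \<in> A" "?h \<alpha> = ?h \<beta>"
    then have "Poly_Mapping.lookup \<alpha> i = Poly_Mapping.lookup \<beta> i" if "i < n" for i
      using that by (auto dest!: fun_cong[of _ _ i])
    then show "\<alpha> = \<beta>" using * assms by (intro mon_eq_iff_mons[of _ n]) auto
  qed
  have sub: "?h ` A \<subseteq> PiE {..<n} (\<lambda>_. {..M})"
  proof (rule image_subsetI)
    fix \<alpha> assume \<alpha>: "\<alpha> \<in> A"
    then have "Poly_Mapping.lookup \<alpha> i \<le> M" if "i < n" for i
      using lookup_le_wdeg[of n "\<lambda>_. 1" i \<alpha>] M[OF \<alpha>] mon_degree_wdeg[of \<alpha> n] that assms by auto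
    then show "?h \<alpha> \<in> PiE {..<n} (\<lambda>_. {..M})" by auto
  qed
  have "(\<Sum>\<alpha>\<in>A. (1 / 2 :: real) ^ mon_degree \<alpha>) = (\<Sum>\<alpha>\<in>A. \<Prod>i<n. (1 / 2) ^ ?h \<alpha> i)"
  proof (rule sum.cong[OF refl])
    fix \<alpha> assume "\<alpha> \<in> A"
    then have "mon_degree \<alpha> = (\<Sum>i<n. Poly_Mapping.lookup \<alpha> i)"
      using assms mon_degree_wdeg[of \<alpha> n] by (auto simp: wdeg_def)
    then show "(1 / 2 :: real) ^ mon_degree \<alpha> = (\<Prod>i<n. (1 / 2) ^ ?h \<alpha> i)"
      by (simp only: power_sum) (auto intro: prod.cong)
  qed
  also have "\<dots> = (\<Sum>g\<in>?h ` A. \<Prod>i<n. (1 / 2) ^ g i)"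
    by (rule sum.reindex_cong[OF inj, symmetric]) auto
  also have "\<dots> \<le> (\<Sum>g\<in>PiE {..<n} (\<lambda>_. {..M}). \<Prod>i<n. (1 / 2) ^ g i)"
    by (rule sum_mono2[OF _ sub]) (auto intro!: finite_PiE prod_nonneg)
  also have "\<dots> = (\<Prod>i<n. \<Sum>j\<le>M. (1 / 2) ^ j)"
    by (rule prod_sum_PiE[symmetric]) auto
  also have "\<dots> \<le> (\<Prod>i<n. 2)"
    by (rule prod_mono) (auto intro!: sum_nonneg sum_half_powers_le)
  finally show ?thesis by simp
qed

text \<open>Under the trivial absolute value every nonzero coefficient has size 1, so the radius 1/2
  works for all formal series at once, with the bound 2 ^ n.\<close>

lemma conv_ring_trivial: 
  assumes "c \<le> n"
  shows "conv_ring (\<lambda>a :: 'k::field. of_bool (a \<noteq> 0)) n c (formal_series n)"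
proof
  let ?v = "\<lambda>a :: 'k. of_bool (a \<noteq> 0) :: real"
  show "formal_series n = convergent_series ?v n"
  proof safe
    fix f :: "'k mps" assume f: "f \<in> formal_series n"
    have "(\<Sum>\<alpha>\<in>A. ?v (mps_coeff f \<alpha>) * (1 / 2) ^ mon_degree \<alpha>) \<le> 2 ^ n" if "finite A" for A
    proof -
      have "(\<Sum>\<alpha>\<in>A. ?v (mps_coeff f \<alpha>) * (1 / 2) ^ mon_degree \<alpha>) =
        (\<Sum>\<alpha>\<in>{\<alpha> \<in> A. mps_coeff f \<alpha> \<noteq> 0}. (1 / 2) ^ mon_degree \<alpha>)"
        using that by (simp add: sum.inter_filter of_bool_def if_distrib[of "\<lambda>x. x * _"] cong: if_cong)
      also have "\<dots> \<le> 2 ^ n"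
        using f that by (intro sum_half_mon_degree_le) (auto simp: formal_series_def mons_def)
      finally show ?thesis .
    qed
    then have "(\<lambda>\<alpha>. ?v (mps_coeff f \<alpha>) * (1 / 2) ^ mon_degree \<alpha>) summable_on UNIV"
      by (intro nonneg_bdd_above_summable_on) (auto simp: bdd_above_def)
    then show "f \<in> convergent_series ?v n"
      using f unfolding convergent_series_def by (auto intro!: exI[of _ "1 / 2"])
  qed (simp add: convergent_series_def)
qed (use assms in auto)

lemma conv_ring_cases:
  fixes R :: "'k::field mps set"
  assumes "c \<le> n"
    and "R = formal_series n \<or> (\<exists>v. complete_absolute_value v \<and> R = convergent_series v n)"
  shows "\<exists>v. conv_ring v n c R"
  using assms(2)
proof (elim disjE exE conjE)
  assume "R = formal_series n"
  then show ?thesis using conv_ring_trivial[OF assms(1)] by blast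
next
  fix v assume v: "complete_absolute_value v" "R = convergent_series v n"
  have "conv_ring v n c R"
    using v(1) assms(1) unfolding v(2) complete_absolute_value_def
    by unfold_locales auto
  then show ?thesis by blast
qed

section \<open>Infinite triangular systems\<close>

text \<open>Well-founded recursion solves the system however long the order is: the equation at
  \<nu> refers only to unknowns below \<nu>, which is why \<open>cut\<close> has no effect. A sum
  over an infinite set is 0 by convention, so the equation carries its intended meaning when each
  \<nu> meets finitely many \<kappa>, a fact supplied where the system is used.\<close>

lemma triangular_solution:
  fixes e :: "'x \<Rightarrow> 'x \<Rightarrow> 'k::comm_ring_1"
  assumes wf: "wf r" and less: "\<And>\<kappa> \<nu>. e \<kappa> \<nu> \<noteq> 0 \<Longrightarrow> (\<kappa>, \<nu>) \<in> r"
  shows "\<exists>u. \<forall>\<nu>. u \<nu> = g \<nu> - (\<Sum>\<kappa> | e \<kappa> \<nu> \<noteq> 0. u \<kappa> * e \<kappa> \<nu>)"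
proof -
  define u where "u = wfrec r (\<lambda>u \<nu>. g \<nu> - (\<Sum>\<kappa> | e \<kappa> \<nu> \<noteq> 0. u \<kappa> * e \<kappa> \<nu>))"
  have "u \<nu> = g \<nu> - (\<Sum>\<kappa> | e \<kappa> \<nu> \<noteq> 0. u \<kappa> * e \<kappa> \<nu>)" for \<nu>
  proof -
    have "u \<nu> = g \<nu> - (\<Sum>\<kappa> | e \<kappa> \<nu> \<noteq> 0. cut u r \<nu> \<kappa> * e \<kappa> \<nu>)"
      unfolding u_def by (subst wfrec[OF wf]) (rule refl)
    also have "(\<Sum>\<kappa> | e \<kappa> \<nu> \<noteq> 0. cut u r \<nu> \<kappa> * e \<kappa> \<nu>) = (\<Sum>\<kappa> | e \<kappa> \<nu> \<noteq> 0. u \<kappa> * e \<kappa> \<nu>)"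
      by (intro sum.cong refl) (simp add: cut_apply less)
    finally show ?thesis .
  qed
  then show ?thesis by blast
qed

text \<open>Applied with Z the monomials outside the module and with Z those of weighted P-degree
  below d. Both sets are closed under passing to the unknowns on which an equation depends.\<close>

lemma triangular_solution_vanishes:
  fixes e :: "'x \<Rightarrow> 'x \<Rightarrow> 'k::comm_ring_1"
  assumes wf: "wf r" and less: "\<And>\<kappa> \<nu>. e \<kappa> \<nu> \<noteq> 0 \<Longrightarrow> (\<kappa>, \<nu>) \<in> r"
    and u: "\<And>\<nu>. u \<nu> = g \<nu> - (\<Sum>\<kappa> | e \<kappa> \<nu> \<noteq> 0. u \<kappa> * e \<kappa> \<nu>)"
    and Z: "\<And>\<nu>. \<nu> \<in> Z \<Longrightarrow> g \<nu> = 0" "\<And>\<kappa> \<nu>. e \<kappa> \<nu> \<noteq> 0 \<Longrightarrow> \<nu> \<in> Z \<Longrightarrow> \<kappa> \<in> Z"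
    and "\<nu> \<in> Z"
  shows "u \<nu> = 0"
  using wf \<open>\<nu> \<in> Z\<close>
proof (induction \<nu> rule: wf_induct_rule)
  case (less \<nu>)
  have "(\<Sum>\<kappa> | e \<kappa> \<nu> \<noteq> 0. u \<kappa> * e \<kappa> \<nu>) = 0"
    using less.IH less.prems assms(2) Z(2) by (intro sum.neutral) auto
  then show ?case using u[of \<nu>] Z(1)[OF less.prems] by simp
qed

context abs_value
begin

text \<open>The off-diagonal part has norm at most 1/2, so the size W of a truncated solution
  satisfies W \<le> C + W / 2. Truncating at weight N makes W a finite sum, which permits
  subtracting W / 2, and it loses nothing: by monotonicity of the weight, equations inside the
  truncation involve no nonzero unknown outside.\<close>

lemma triangular_solution_bounded:
  fixes e :: "'x \<Rightarrow> 'x \<Rightarrow> 'k"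
  assumes u: "\<And>\<nu>. u \<nu> = g \<nu> - (\<Sum>\<kappa> | e \<kappa> \<nu> \<noteq> 0. u \<kappa> * e \<kappa> \<nu>)"
    and X: "\<And>\<nu>. \<nu> \<notin> X \<Longrightarrow> u \<nu> = 0" "\<And>N. finite {\<nu> \<in> X. w \<nu> \<le> N}"
    and w: "\<And>\<kappa> \<nu>. e \<kappa> \<nu> \<noteq> 0 \<Longrightarrow> w \<kappa> \<le> w \<nu>"
    and fin: "\<And>\<nu>. finite {\<kappa>. e \<kappa> \<nu> \<noteq> 0}"
    and \<rho>: "0 < \<rho>" and g: "wbounded v w \<rho> C g"
    and e: "\<And>\<kappa> A. finite A \<Longrightarrow> (\<Sum>\<nu>\<in>A. v (e \<kappa> \<nu>) * \<rho> ^ w \<nu>) \<le> \<rho> ^ w \<kappa> / 2"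
  shows "wbounded v w \<rho> (2 * C) u"
  unfolding wbounded_def
proof (intro allI impI)
  fix A :: "'x set" assume A: "finite A"
  define N where "N = Max (insert 0 (w ` A))"
  define B where "B = {\<nu> \<in> X. w \<nu> \<le> N}"
  have B: "finite B" unfolding B_def by (rule X(2))
  define W where "W = (\<Sum>\<nu>\<in>B. v (u \<nu>) * \<rho> ^ w \<nu>)"
  have "W \<le> (\<Sum>\<nu>\<in>B. v (g \<nu>) * \<rho> ^ w \<nu> + (\<Sum>\<kappa>\<in>B. v (u \<kappa>) * (v (e \<kappa> \<nu>) * \<rho> ^ w \<nu>)))"
    unfolding W_def
  proof (rule sum_mono)
    fix \<nu> assume \<nu>: "\<nu> \<in> B"
    have "v (u \<nu>) \<le> v (g \<nu>) + v (\<Sum>\<kappa> | e \<kappa> \<nu> \<noteq> 0. u \<kappa> * e \<kappa> \<nu>)"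
      by (subst u) (rule v_diff)
    also have "(\<Sum>\<kappa> | e \<kappa> \<nu> \<noteq> 0. u \<kappa> * e \<kappa> \<nu>) = (\<Sum>\<kappa>\<in>B. u \<kappa> * e \<kappa> \<nu>)"
    proof (rule sum.mono_neutral_cong[OF B fin])
      fix \<kappa> assume "\<kappa> \<in> {\<kappa>. e \<kappa> \<nu> \<noteq> 0} - B"
      then have "\<kappa> \<notin> X" using w[of \<kappa> \<nu>] \<nu> by (auto simp: B_def)
      then show "u \<kappa> * e \<kappa> \<nu> = 0" using X(1) by simp
    qed auto
    also have "v \<dots> \<le> (\<Sum>\<kappa>\<in>B. v (u \<kappa>) * v (e \<kappa> \<nu>))"
      using v_sum[of "\<lambda>\<kappa>. u \<kappa> * e \<kappa> \<nu>" B] by (simp add: v_mult)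
    finally have "v (u \<nu>) * \<rho> ^ w \<nu> \<le> (v (g \<nu>) + (\<Sum>\<kappa>\<in>B. v (u \<kappa>) * v (e \<kappa> \<nu>))) * \<rho> ^ w \<nu>"
      using \<rho> by (intro mult_right_mono) auto
    then show "v (u \<nu>) * \<rho> ^ w \<nu> \<le> v (g \<nu>) * \<rho> ^ w \<nu> + (\<Sum>\<kappa>\<in>B. v (u \<kappa>) * (v (e \<kappa> \<nu>) * \<rho> ^ w \<nu>))"
      by (simp add: distrib_right sum_distrib_right mult.assoc)
  qed
  also have "\<dots> = (\<Sum>\<nu>\<in>B. v (g \<nu>) * \<rho> ^ w \<nu>) + (\<Sum>\<kappa>\<in>B. v (u \<kappa>) * (\<Sum>\<nu>\<in>B. v (e \<kappa> \<nu>) * \<rho> ^ w \<nu>))"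
    by (simp add: sum.distrib sum_distrib_left) (rule sum.swap)
  also have "\<dots> \<le> C + (\<Sum>\<kappa>\<in>B. v (u \<kappa>) * (\<rho> ^ w \<kappa> / 2))"
    using g e B by (intro add_mono sum_mono mult_left_mono) (auto simp: wbounded_def)
  also have "(\<Sum>\<kappa>\<in>B. v (u \<kappa>) * (\<rho> ^ w \<kappa> / 2)) = W / 2"
    by (simp add: W_def sum_divide_distrib)
  finally have "W \<le> 2 * C" by simp
  have "(\<Sum>\<nu>\<in>A. v (u \<nu>) * \<rho> ^ w \<nu>) = (\<Sum>\<nu>\<in>A \<inter> X. v (u \<nu>) * \<rho> ^ w \<nu>)"
    using A X(1) by (intro sum.mono_neutral_right) auto
  also have "\<dots> \<le> W"
    unfolding W_def
  proof (rule sum_mono2[OF B])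
    show "A \<inter> X \<subseteq> B" using A by (auto simp: B_def N_def intro!: Max_ge)
  qed (use \<rho> in auto)
  finally show "(\<Sum>\<nu>\<in>A. v (u \<nu>) * \<rho> ^ w \<nu>) \<le> 2 * C" using \<open>W \<le> 2 * C\<close> by simp
qed

end

section \<open>Division with remainder\<close>

text \<open>Total on all module monomials, with value 0 beyond the dimension, so that a vector can
  serve as the right-hand side of a system indexed by the whole type.\<close>

definition vec_coeff :: "'k::zero mps vec \<Rightarrow> mmon \<Rightarrow> 'k" where
  "vec_coeff g \<mu> = (if snd \<mu> < dim_vec g then mps_coeff (g $ snd \<mu>) (fst \<mu>) else 0)"

lemma vec_supp_iff: "\<mu> \<in> vec_supp g \<longleftrightarrow> vec_coeff g \<mu> \<noteq> 0"
  by (auto simp: vec_supp_def vec_coeff_def split: if_splits)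

lemma vec_supp_eq_empty_iff: "vec_supp (g :: 'k::comm_ring_1 mps vec) = {} \<longleftrightarrow> g = 0\<^sub>v (dim_vec g)"
proof -
  have "vec_supp g = {} \<longleftrightarrow> (\<forall>l<dim_vec g. g $ l = 0)"
    by (fastforce simp: vec_supp_def mps_eq_iff)
  also have "\<dots> \<longleftrightarrow> g = 0\<^sub>v (dim_vec g)"
    by (metis index_zero_vec eq_vecI)
  finally show ?thesis .
qed

lemma carrier_free_module: "u \<in> carrier (free_module R p) \<longleftrightarrow> u \<in> carrier_vec p \<and> (\<forall>l<p. u $ l \<in> R)"
  by (simp add: free_module_def)

lemma init_coeff_eq: "init_mon lt g \<in> vec_supp g \<Longrightarrow> init_coeff lt g = vec_coeff g (init_mon lt g)"
  by (cases "init_mon lt g") (simp add: init_coeff_def vec_coeff_def vec_supp_def)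

text \<open>All weights exceed d, so shrinking the radius gains at least d + 1 powers of
  \<open>\<rho> / \<rho>\<^sub>0\<close>. Compared with \<open>\<rho> ^ d\<close> one power of
  \<rho> is left over, and for small \<rho> it beats any constant.\<close>

lemma (in abs_value) wbounded_tail_small:
  assumes h: "wbounded v w \<rho>\<^sub>0 C h" and \<rho>\<^sub>0: "0 < \<rho>\<^sub>0" and d: "\<And>x. h x \<noteq> 0 \<Longrightarrow> d < w x"
  shows "\<forall>\<^sub>F \<rho> in at_right 0. wbounded v w \<rho> (\<rho> ^ d / 2) h"
proof -
  have C: "0 \<le> C" using h unfolding wbounded_def by (metis finite.emptyI sum.empty)
  \<comment> \<open>The second bound is
    \<open>\<rho> * (2 * (C + 1)) \<le> \<rho>\<^sub>0 ^ Suc d\<close> solved for \<rho>; C + 1 in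
    place of C keeps the denominator positive.\<close>
  define \<delta> where "\<delta> = min \<rho>\<^sub>0 (\<rho>\<^sub>0 ^ Suc d / (2 * (C + 1)))"
  have \<delta>: "\<delta> > 0" using C \<rho>\<^sub>0 by (auto simp: \<delta>_def)
  have "wbounded v w \<rho> (\<rho> ^ d / 2) h" if \<rho>: "0 < \<rho>" "\<rho> < \<delta>" for \<rho>
    unfolding wbounded_def
  proof (intro allI impI)
    fix A :: "'a set" assume A: "finite A"
    have "\<rho> \<le> \<rho>\<^sub>0" using \<rho> by (simp add: \<delta>_def)
    have "(\<Sum>x\<in>A. v (h x) * \<rho> ^ w x) \<le> (\<Sum>x\<in>A. (\<rho> / \<rho>\<^sub>0) ^ Suc d * (v (h x) * \<rho>\<^sub>0 ^ w x))"
    proof (rule sum_mono)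
      fix x
      show "v (h x) * \<rho> ^ w x \<le> (\<rho> / \<rho>\<^sub>0) ^ Suc d * (v (h x) * \<rho>\<^sub>0 ^ w x)"
      proof (cases "h x = 0")
        case False
        have "(\<rho> / \<rho>\<^sub>0) ^ w x \<le> (\<rho> / \<rho>\<^sub>0) ^ Suc d"
          using d[OF False] \<rho> \<rho>\<^sub>0 \<open>\<rho> \<le> \<rho>\<^sub>0\<close> by (intro power_decreasing) auto
        then have "\<rho> ^ w x \<le> (\<rho> / \<rho>\<^sub>0) ^ Suc d * \<rho>\<^sub>0 ^ w x"
          using \<rho>\<^sub>0 by (simp add: power_divide divide_simps del: power_Suc)
        then have "v (h x) * \<rho> ^ w x \<le> v (h x) * ((\<rho> / \<rho>\<^sub>0) ^ Suc d * \<rho>\<^sub>0 ^ w x)"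
          by (rule mult_left_mono) simp
        then show ?thesis by (simp only: mult.left_commute)
      qed simp
    qed
    also have "\<dots> = (\<rho> / \<rho>\<^sub>0) ^ Suc d * (\<Sum>x\<in>A. v (h x) * \<rho>\<^sub>0 ^ w x)"
      by (simp only: sum_distrib_left)
    also have "\<dots> \<le> (\<rho> / \<rho>\<^sub>0) ^ Suc d * C"
      using h A \<rho> \<rho>\<^sub>0 by (intro mult_left_mono) (auto simp: wbounded_def)
    also have "\<dots> \<le> \<rho> ^ d / 2"
    proof -
      have "\<rho> * (2 * C) \<le> \<rho> * (2 * (C + 1))" using \<rho> by simp
      also have "\<dots> \<le> \<rho>\<^sub>0 ^ Suc d"
        using \<rho> C by (simp add: \<delta>_def less_divide_eq del: power_Suc)
      finally have "\<rho> ^ d * (\<rho> * (2 * C)) \<le> \<rho> ^ d * \<rho>\<^sub>0 ^ Suc d"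
        using \<rho> by (intro mult_left_mono) auto
      then show ?thesis using \<rho>\<^sub>0 by (simp add: power_divide divide_simps mult_ac)
    qed
    finally show "(\<Sum>x\<in>A. v (h x) * \<rho> ^ w x) \<le> \<rho> ^ d / 2" .
  qed
  then show ?thesis using \<delta> by (intro eventually_at_rightI[of 0 \<delta>]) auto
qed

context conv_ring
begin

lemma vec_supp_mmons: "g \<in> carrier (free_module R p) \<Longrightarrow> vec_supp g \<subseteq> mmons n p"
  using R_mons by (auto simp: carrier_free_module vec_supp_def mmons_def)

text \<open>A common radius exists for the finitely many components, and the shift s only multiplies
  the norm of component l by \<open>\<rho> ^ s l\<close>.\<close>

lemma vec_coeff_bounded:
  assumes g: "g \<in> carrier (free_module R p)" and w: "\<forall>i<n. 1 \<le> w i"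
  shows "\<forall>\<^sub>F \<rho> in at_right 0. \<exists>C. wbounded v (mwdeg n w s) \<rho> C (vec_coeff g)"
proof -
  have "\<forall>\<^sub>F \<rho> in at_right 0. \<exists>C. wbounded v (wdeg n w) \<rho> C (mps_coeff (g $ l))" if "l \<in> {..<p}" for l
  proof -
    have "g $ l \<in> R" using g that by (simp add: carrier_free_module)
    then show ?thesis using R_iff[OF w] by blast
  qed
  then have "\<forall>\<^sub>F \<rho> in at_right 0. \<forall>l\<in>{..<p}. \<exists>C. wbounded v (wdeg n w) \<rho> C (mps_coeff (g $ l))"
    by (intro eventually_ball_finite) auto
  then show ?thesis using eventually_pos
  proof eventually_elim
    case (elim \<rho>)
    then obtain C where C: "\<And>l. l < p \<Longrightarrow> wbounded v (wdeg n w) \<rho> (C l) (mps_coeff (g $ l))"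
      by (metis lessThan_iff)
    have dim: "dim_vec g = p" using g by (simp add: carrier_free_module)
    have "wbounded v (mwdeg n w s) \<rho> (\<Sum>l<p. C l * \<rho> ^ s l) (vec_coeff g)"
      unfolding wbounded_def
    proof (intro allI impI)
      fix A :: "mmon set" assume A: "finite A"
      let ?h = "\<lambda>\<mu>. v (vec_coeff g \<mu>) * \<rho> ^ mwdeg n w s \<mu>"
      have "(\<Sum>\<mu>\<in>A. ?h \<mu>) = (\<Sum>\<mu>\<in>{\<mu> \<in> A. snd \<mu> < p}. ?h \<mu>)"
        using A by (intro sum.mono_neutral_right) (auto simp: vec_coeff_def dim)
      also have "\<dots> \<le> (\<Sum>\<mu>\<in>fst ` A \<times> {..<p}. ?h \<mu>)"
      proof (rule sum_mono2)
        show "{\<mu> \<in> A. snd \<mu> < p} \<subseteq> fst ` A \<times> {..<p}" by force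
      qed (use A elim in auto)
      also have "\<dots> = (\<Sum>l<p. \<Sum>\<alpha>\<in>fst ` A. ?h (\<alpha>, l))"
        by (subst sum.swap) (simp add: sum.cartesian_product)
      also have "\<dots> = (\<Sum>l<p. (\<Sum>\<alpha>\<in>fst ` A. v (mps_coeff (g $ l) \<alpha>) * \<rho> ^ wdeg n w \<alpha>) * \<rho> ^ s l)"
        by (simp add: vec_coeff_def dim mwdeg_def power_add sum_distrib_right mult.assoc)
      also have "\<dots> \<le> (\<Sum>l<p. C l * \<rho> ^ s l)"
        using C A elim by (intro sum_mono mult_right_mono) (auto simp: wbounded_def)
      finally show "(\<Sum>\<mu>\<in>A. ?h \<mu>) \<le> (\<Sum>l<p. C l * \<rho> ^ s l)" .
    qed
    then show ?case by blast
  qed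
qed

end

locale division = conv_ring v n c R + good_order n c p a lt
  for v :: "'k::field \<Rightarrow> real" and n c R p a lt +
  fixes m :: nat and F :: "'k mps mat" and g :: "'k mps vec"
  assumes F: "F \<in> carrier_mat p m"
    and cols: "\<And>t. t < m \<Longrightarrow> col F t \<in> carrier (free_module R p)"
    and nonzero: "\<And>t. t < m \<Longrightarrow> col F t \<noteq> 0\<^sub>v p"
    and monic: "\<And>t. t < m \<Longrightarrow> init_coeff lt (col F t) = 1"
    and g: "g \<in> carrier (free_module R p)"
begin

abbreviation im :: "nat \<Rightarrow> mmon" where
  "im t \<equiv> init_mon lt (col F t)"

definition lead :: "mmon set" where
  "lead = {\<kappa> \<in> mmons n p. \<exists>t<m. mmon_dvd (im t) \<kappa>}"

text \<open>A leading monomial may be divisible by several initial monomials. Fixing one of them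
  assigns exactly one unknown to each monomial, which makes the system square.\<close>

definition \<tau> :: "mmon \<Rightarrow> nat" where
  "\<tau> \<kappa> = (SOME t. t < m \<and> mmon_dvd (im t) \<kappa>)"

definition cofactor :: "mmon \<Rightarrow> mon" where
  "cofactor \<kappa> = fst \<kappa> - fst (im (\<tau> \<kappa>))"

text \<open>For \<open>\<kappa> \<in> lead\<close>, \<open>entry \<kappa>\<close> is the monomial multiple of a column of \<open>F\<close> with initial monomial
  \<open>\<kappa>\<close>. Together with the monomials outside \<open>lead\<close> these vectors form a unitriangular matrix, and
  dividing \<open>g\<close> amounts to solving the corresponding linear system.\<close>

definition entry :: "mmon \<Rightarrow> mmon \<Rightarrow> 'k" where
  "entry \<kappa> \<nu> = (if \<kappa> \<in> lead \<and> (\<exists>\<gamma>. fst \<nu> = cofactor \<kappa> + \<gamma>)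
     then vec_coeff (col F (\<tau> \<kappa>)) (fst \<nu> - cofactor \<kappa>, snd \<nu>) else 0)"

definition tail_entry :: "mmon \<Rightarrow> mmon \<Rightarrow> 'k" where
  "tail_entry \<kappa> \<nu> = (if \<nu> = \<kappa> then 0 else entry \<kappa> \<nu>)"

lemma col_supp: "t < m \<Longrightarrow> vec_supp (col F t) \<subseteq> mmons n p"
  by (rule vec_supp_mmons[OF cols])

lemma col_supp_nonempty: "t < m \<Longrightarrow> vec_supp (col F t) \<noteq> {}"
  using nonzero F by (subst vec_supp_eq_empty_iff) auto

lemma im_supp: "t < m \<Longrightarrow> im t \<in> vec_supp (col F t)"
  by (rule init_mon_least(1)[OF col_supp col_supp_nonempty])

lemma im_less: "t < m \<Longrightarrow> \<nu> \<in> vec_supp (col F t) \<Longrightarrow> \<nu> \<noteq> im t \<Longrightarrow> lt (im t) \<nu>"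
  by (rule init_mon_least(2)[OF col_supp col_supp_nonempty])

lemma im_mmons: "t < m \<Longrightarrow> im t \<in> mmons n p"
  using im_supp col_supp by blast

lemma im_coeff: "t < m \<Longrightarrow> vec_coeff (col F t) (im t) = 1"
  using monic[of t] init_coeff_eq[OF im_supp] by simp

lemma \<tau>: "\<kappa> \<in> lead \<Longrightarrow> \<tau> \<kappa> < m" "\<kappa> \<in> lead \<Longrightarrow> mmon_dvd (im (\<tau> \<kappa>)) \<kappa>"
proof -
  assume "\<kappa> \<in> lead"
  then have "\<exists>t. t < m \<and> mmon_dvd (im t) \<kappa>" by (auto simp: lead_def)
  from someI_ex[OF this] show "\<tau> \<kappa> < m" "mmon_dvd (im (\<tau> \<kappa>)) \<kappa>" by (auto simp: \<tau>_def)
qed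

lemma lead_eq: 
  assumes "\<kappa> \<in> lead"
  shows "\<kappa> = (cofactor \<kappa> + fst (im (\<tau> \<kappa>)), snd (im (\<tau> \<kappa>)))"
proof -
  obtain \<gamma> where "fst \<kappa> = fst (im (\<tau> \<kappa>)) + \<gamma>" "snd \<kappa> = snd (im (\<tau> \<kappa>))"
    using \<tau>(2)[OF assms] by (auto simp: mmon_dvd_def)
  then show ?thesis by (simp add: cofactor_def prod_eq_iff add.commute)
qed

lemma cofactor_eq: "\<tau> (\<beta> + fst (im t), j) = t \<Longrightarrow> cofactor (\<beta> + fst (im t), j) = \<beta>"
  by (simp add: cofactor_def)

lemma cofactor_mons: "\<kappa> \<in> lead \<Longrightarrow> cofactor \<kappa> \<in> mons n"
proof -
  assume *: "\<kappa> \<in> lead"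
  then have "fst \<kappa> \<in> mons n" by (auto simp: lead_def mmons_def)
  moreover have "fst \<kappa> = cofactor \<kappa> + fst (im (\<tau> \<kappa>))" using lead_eq[OF *] by (metis fst_conv)
  ultimately show ?thesis by simp
qed

lemma entry_nonzeroE:
  assumes "entry \<kappa> \<nu> \<noteq> 0"
  obtains \<gamma> where "\<kappa> \<in> lead" "\<nu> = (cofactor \<kappa> + \<gamma>, snd \<nu>)" "(\<gamma>, snd \<nu>) \<in> vec_supp (col F (\<tau> \<kappa>))"
    "entry \<kappa> \<nu> = vec_coeff (col F (\<tau> \<kappa>)) (\<gamma>, snd \<nu>)"
proof -
  have "\<kappa> \<in> lead" "\<exists>\<gamma>. fst \<nu> = cofactor \<kappa> + \<gamma>"
    using assms by (auto simp: entry_def split: if_splits)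
  then obtain \<gamma> where \<gamma>: "\<kappa> \<in> lead" "fst \<nu> = cofactor \<kappa> + \<gamma>" by blast
  then have "entry \<kappa> \<nu> = vec_coeff (col F (\<tau> \<kappa>)) (\<gamma>, snd \<nu>)"
    by (simp add: entry_def)
  then show ?thesis using that[OF \<gamma>(1), of \<gamma>] \<gamma>(2) assms by (simp add: vec_supp_iff prod_eq_iff)
qed

lemma entry_self: "\<kappa> \<in> lead \<Longrightarrow> entry \<kappa> \<kappa> = 1"
proof -
  assume *: "\<kappa> \<in> lead"
  have "fst \<kappa> = cofactor \<kappa> + fst (im (\<tau> \<kappa>))" "snd \<kappa> = snd (im (\<tau> \<kappa>))"
    using lead_eq[OF *] by (metis fst_conv snd_conv)+
  then show ?thesis using * im_coeff[OF \<tau>(1)[OF *]] by (auto simp: entry_def)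
qed

text \<open>Multiplication by the cofactor preserves the order, so the tail of a multiple lies
  strictly after its initial monomial. This is the triangularity of the system.\<close>

lemma tail_entry_nonzero:
  assumes "tail_entry \<kappa> \<nu> \<noteq> 0"
  shows "\<kappa> \<in> lead" "\<kappa> \<in> mmons n p" "\<nu> \<in> mmons n p" "lt \<kappa> \<nu>"
proof -
  have ne: "\<nu> \<noteq> \<kappa>" and "entry \<kappa> \<nu> \<noteq> 0" using assms by (auto simp: tail_entry_def split: if_splits)
  from this(2) obtain \<gamma> where \<gamma>: "\<kappa> \<in> lead" "\<nu> = (cofactor \<kappa> + \<gamma>, snd \<nu>)"
    "(\<gamma>, snd \<nu>) \<in> vec_supp (col F (\<tau> \<kappa>))" by (rule entry_nonzeroE)
  let ?t = "\<tau> \<kappa>"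
  have t: "?t < m" using \<tau>(1) \<gamma>(1) by blast
  have mm: "(\<gamma>, snd \<nu>) \<in> mmons n p" using \<gamma>(3) col_supp[OF t] by blast
  show "\<kappa> \<in> lead" "\<kappa> \<in> mmons n p" using \<gamma>(1) by (auto simp: lead_def)
  have "(cofactor \<kappa> + \<gamma>, snd \<nu>) \<in> mmons n p" using mm cofactor_mons[OF \<gamma>(1)] by (simp add: mmons_def)
  then show "\<nu> \<in> mmons n p" using \<gamma>(2) by simp
  have "(\<gamma>, snd \<nu>) \<noteq> im ?t"
  proof
    assume "(\<gamma>, snd \<nu>) = im ?t"
    then have "\<kappa> = (cofactor \<kappa> + \<gamma>, snd \<nu>)" using lead_eq[OF \<gamma>(1)] by (metis fst_conv snd_conv)
    then show False using \<gamma>(2) ne by metis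
  qed
  then have "lt (im ?t) (\<gamma>, snd \<nu>)" using im_less[OF t \<gamma>(3)] by blast
  then have "lt (cofactor \<kappa> + fst (im ?t), snd (im ?t)) (cofactor \<kappa> + \<gamma>, snd \<nu>)"
    using im_mmons[OF t] mm cofactor_mons[OF \<gamma>(1)] by (intro compat) auto
  then show "lt \<kappa> \<nu>" using lead_eq[OF \<gamma>(1)] \<gamma>(2) by simp
qed

text \<open>A row meeting \<nu> is recovered from a column index and a factorisation of the monomial
  of \<nu>, and there are finitely many of each.\<close>

lemma finite_entry: "finite {\<kappa>. entry \<kappa> \<nu> \<noteq> 0}"
proof (rule finite_subset)
  show "{\<kappa>. entry \<kappa> \<nu> \<noteq> 0} \<subseteq> (\<lambda>(t, \<beta>, \<gamma>). (\<beta> + fst (im t), snd (im t))) ` ({..<m} \<times> {(\<beta>, \<gamma>). \<beta> + \<gamma> = fst \<nu>})"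
  proof
    fix \<kappa> assume "\<kappa> \<in> {\<kappa>. entry \<kappa> \<nu> \<noteq> 0}"
    then have "entry \<kappa> \<nu> \<noteq> 0" by simp
    then obtain \<gamma> where \<gamma>: "\<kappa> \<in> lead" "\<nu> = (cofactor \<kappa> + \<gamma>, snd \<nu>)" by (rule entry_nonzeroE)
    have "fst \<nu> = cofactor \<kappa> + \<gamma>" using \<gamma>(2) by (metis fst_conv)
    then have "(\<tau> \<kappa>, cofactor \<kappa>, \<gamma>) \<in> {..<m} \<times> {(\<beta>, \<gamma>). \<beta> + \<gamma> = fst \<nu>}"
      using \<tau>(1)[OF \<gamma>(1)] by simp
    then show "\<kappa> \<in> (\<lambda>(t, \<beta>, \<gamma>). (\<beta> + fst (im t), snd (im t))) ` ({..<m} \<times> {(\<beta>, \<gamma>). \<beta> + \<gamma> = fst \<nu>})"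
      by (rule rev_image_eqI) (use lead_eq[OF \<gamma>(1)] in simp)
  qed
  show "finite ((\<lambda>(t, \<beta>, \<gamma>). (\<beta> + fst (im t), snd (im t))) ` ({..<m} \<times> {(\<beta>, \<gamma>). \<beta> + \<gamma> = fst \<nu>}))"
    by (intro finite_imageI finite_cartesian_product finite_lessThan finite_mon_splits)
qed

lemma finite_tail_entry: "finite {\<kappa>. tail_entry \<kappa> \<nu> \<noteq> 0}"
  by (rule finite_subset[OF _ finite_entry[of \<nu>]]) (auto simp: tail_entry_def)

section \<open>The solution of the system, its degrees and its norm\<close>

definition wfr :: "(mmon \<times> mmon) set" where
  "wfr = {(\<mu>, \<nu>). \<mu> \<in> mmons n p \<and> \<nu> \<in> mmons n p \<and> lt \<mu> \<nu>}"

lemma tail_entry_wfr: "tail_entry \<kappa> \<nu> \<noteq> 0 \<Longrightarrow> (\<kappa>, \<nu>) \<in> wfr"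
  using tail_entry_nonzero by (simp add: wfr_def)

text \<open>One family holds all the unknowns: on \<open>lead\<close> the coefficients of the
  quotients, elsewhere those of the remainder.\<close>

definition u :: "mmon \<Rightarrow> 'k" where
  "u = (SOME u. \<forall>\<nu>. u \<nu> = vec_coeff g \<nu> - (\<Sum>\<kappa> | tail_entry \<kappa> \<nu> \<noteq> 0. u \<kappa> * tail_entry \<kappa> \<nu>))"

lemma u: "u \<nu> = vec_coeff g \<nu> - (\<Sum>\<kappa> | tail_entry \<kappa> \<nu> \<noteq> 0. u \<kappa> * tail_entry \<kappa> \<nu>)"
  using someI_ex[OF triangular_solution[of wfr tail_entry "vec_coeff g"], folded u_def]
    wf_lt tail_entry_wfr unfolding wfr_def by blast

lemma wf_wfr: "wf wfr"
  unfolding wfr_def by (rule wf_lt)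

lemma u_outside: "\<nu> \<notin> mmons n p \<Longrightarrow> u \<nu> = 0"
proof (rule triangular_solution_vanishes[OF wf_wfr tail_entry_wfr u, of "- mmons n p"])
  fix \<nu> assume "\<nu> \<in> - mmons n p"
  then show "vec_coeff g \<nu> = 0" using vec_supp_mmons[OF g] by (auto simp: vec_supp_iff)
qed (use tail_entry_nonzero in auto)

text \<open>By \<open>graded\<close> the weighted P-degree cannot rise on the way down, so the
  monomials of degree below d are closed under predecessors. There g vanishes, hence so does the
  solution.\<close>

lemma u_degree:
  assumes d: "\<And>\<alpha> j. (\<alpha>, j) \<in> vec_supp g \<Longrightarrow> d \<le> pdeg c \<alpha> + a j" and "u (\<alpha>, j) \<noteq> 0"
  shows "d \<le> pdeg c \<alpha> + a j"
proof (rule ccontr)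
  let ?Z = "{(\<alpha>, j). \<not> d \<le> pdeg c \<alpha> + a j}"
  assume "\<not> d \<le> pdeg c \<alpha> + a j"
  then have "(\<alpha>, j) \<in> ?Z" by simp
  have "u (\<alpha>, j) = 0"
  proof (rule triangular_solution_vanishes[OF wf_wfr tail_entry_wfr u _ _ \<open>(\<alpha>, j) \<in> ?Z\<close>])
    fix \<nu> assume "\<nu> \<in> ?Z"
    then show "vec_coeff g \<nu> = 0" using d by (auto simp: vec_supp_iff)
  next
    fix \<kappa> \<nu> assume *: "tail_entry \<kappa> \<nu> \<noteq> 0" "\<nu> \<in> ?Z"
    obtain \<alpha> i \<beta> j where [simp]: "\<kappa> = (\<alpha>, i)" "\<nu> = (\<beta>, j)" by fastforce
    show "\<kappa> \<in> ?Z" using graded[of \<alpha> i \<beta> j] tail_entry_nonzero[OF *(1)] *(2) by auto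
  qed
  then show False using assms(2) by simp
qed

text \<open>Weights chosen for the m initial monomials serve all of \<open>lead\<close>: the
  off-diagonal row of \<kappa> is the tail of a column translated by the cofactor, and a translation
  multiplies both sides of the smallness estimate by the same power of the radius.\<close>

lemma u_bounded:
  "\<exists>w s. (\<forall>i<n. 1 \<le> w i) \<and> (\<forall>\<^sub>F \<rho> in at_right 0. \<exists>C. wbounded v (mwdeg n w s) \<rho> C u)"
proof -
  obtain w s where w: "\<forall>i<n. 1 \<le> w i"
    and ws: "\<And>t \<nu>. t < m \<Longrightarrow> \<nu> \<in> mmons n p \<Longrightarrow> lt (im t) \<nu> \<Longrightarrow> mwdeg n w s (im t) < mwdeg n w s \<nu>"
    using weights[of "im ` {..<m}"] im_mmons by auto blast
  let ?w = "mwdeg n w s"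
  define tail where "tail t \<nu> = (if \<nu> = im t then 0 else vec_coeff (col F t) \<nu>)" for t \<nu>
  have tail: "\<forall>\<^sub>F \<rho> in at_right 0. wbounded v ?w \<rho> (\<rho> ^ ?w (im t) / 2) (tail t)" if t: "t < m" for t
  proof -
    have "\<forall>\<^sub>F \<rho> in at_right 0. 0 < \<rho> \<and> (\<exists>C. wbounded v ?w \<rho> C (vec_coeff (col F t)))"
      using vec_coeff_bounded[OF cols[OF t] w] eventually_pos by (simp add: eventually_conj_iff)
    then obtain \<rho> C where \<rho>: "0 < \<rho>" and C: "wbounded v ?w \<rho> C (vec_coeff (col F t))"
      using eventually_happens'[OF trivial_limit_at_right_real] by blast
    have "wbounded v ?w \<rho> (C / \<rho> ^ 0) (tail t)"
      by (rule wbounded_reindex[OF C \<rho>, where h = "\<lambda>x. x" and B = UNIV]) (auto simp: tail_def split: if_splits)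
    then show ?thesis
    proof (rule wbounded_tail_small[OF _ \<rho>])
      fix \<nu> assume "tail t \<nu> \<noteq> 0"
      then have "\<nu> \<noteq> im t" "\<nu> \<in> vec_supp (col F t)" by (auto simp: tail_def vec_supp_iff split: if_splits)
      then show "?w (im t) < ?w \<nu>" using ws[OF t] im_less[OF t] col_supp[OF t] by blast
    qed
  qed
  have mono: "?w \<kappa> \<le> ?w \<nu>" if "tail_entry \<kappa> \<nu> \<noteq> 0" for \<kappa> \<nu>
  proof -
    have "entry \<kappa> \<nu> \<noteq> 0" using that by (auto simp: tail_entry_def split: if_splits)
    then obtain \<gamma> where \<gamma>: "\<kappa> \<in> lead" "\<nu> = (cofactor \<kappa> + \<gamma>, snd \<nu>)"
      "(\<gamma>, snd \<nu>) \<in> vec_supp (col F (\<tau> \<kappa>))" by (rule entry_nonzeroE)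
    have t: "\<tau> \<kappa> < m" using \<tau>(1) \<gamma>(1) by blast
    have "?w (im (\<tau> \<kappa>)) \<le> ?w (\<gamma>, snd \<nu>)"
      using ws[OF t, of "(\<gamma>, snd \<nu>)"] im_less[OF t \<gamma>(3)] \<gamma>(3) col_supp[OF t]
      by (cases "(\<gamma>, snd \<nu>) = im (\<tau> \<kappa>)") (auto simp: less_imp_le)
    moreover have "?w \<kappa> = wdeg n w (cofactor \<kappa>) + ?w (im (\<tau> \<kappa>))"
      by (subst lead_eq[OF \<gamma>(1)]) (simp add: mwdeg_def wdeg_add)
    moreover have "?w \<nu> = wdeg n w (cofactor \<kappa>) + ?w (\<gamma>, snd \<nu>)"
      by (subst \<gamma>(2)) (simp add: mwdeg_def wdeg_add)
    ultimately show ?thesis by simp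
  qed
  have fin: "finite {\<nu> \<in> mmons n p. ?w \<nu> \<le> N}" for N
    by (rule finite_subset[of _ "{\<alpha> \<in> mons n. wdeg n w \<alpha> \<le> N} \<times> {..<p}"])
      (auto simp: mmons_def mwdeg_def finite_wdeg_le[OF w])
  have "\<forall>\<^sub>F \<rho> in at_right 0. \<forall>t\<in>{..<m}. wbounded v ?w \<rho> (\<rho> ^ ?w (im t) / 2) (tail t)"
    using tail by (intro eventually_ball_finite) auto
  then have "\<forall>\<^sub>F \<rho> in at_right 0. \<exists>C. wbounded v ?w \<rho> C u"
    using vec_coeff_bounded[OF g w, of s] eventually_pos
  proof eventually_elim
    case (elim \<rho>)
    then obtain C where C: "wbounded v ?w \<rho> C (vec_coeff g)" by blast
    have "wbounded v ?w \<rho> (2 * C) u"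
    proof (rule triangular_solution_bounded[OF u u_outside fin mono finite_tail_entry elim(3) C])
      fix \<kappa> and A :: "mmon set" assume A: "finite A"
      show "(\<Sum>\<nu>\<in>A. v (tail_entry \<kappa> \<nu>) * \<rho> ^ ?w \<nu>) \<le> \<rho> ^ ?w \<kappa> / 2"
      proof (cases "\<kappa> \<in> lead")
        case False
        then have "tail_entry \<kappa> \<nu> = 0" for \<nu> by (simp add: tail_entry_def entry_def)
        then show ?thesis using elim(3) by simp
      next
        case True
        define b where "b = cofactor \<kappa>"
        let ?h = "\<lambda>\<nu> :: mmon. (fst \<nu> - b, snd \<nu>)"
        have t: "\<tau> \<kappa> < m" using \<tau>(1)[OF True] .
        have nz: "fst \<nu> = b + fst (?h \<nu>) \<and> tail_entry \<kappa> \<nu> = tail (\<tau> \<kappa>) (?h \<nu>)"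
          if *: "tail_entry \<kappa> \<nu> \<noteq> 0" for \<nu>
        proof -
          have "entry \<kappa> \<nu> \<noteq> 0" "\<nu> \<noteq> \<kappa>" using * by (auto simp: tail_entry_def split: if_splits)
          from this(1) obtain \<gamma> where \<gamma>: "\<nu> = (b + \<gamma>, snd \<nu>)"
            "entry \<kappa> \<nu> = vec_coeff (col F (\<tau> \<kappa>)) (\<gamma>, snd \<nu>)" unfolding b_def by (rule entry_nonzeroE)
          have h: "fst \<nu> = b + \<gamma>" using \<gamma>(1) by (metis fst_conv)
          then have h': "?h \<nu> = (\<gamma>, snd \<nu>)" by simp
          have "(\<gamma>, snd \<nu>) \<noteq> im (\<tau> \<kappa>)"
            using lead_eq[OF True] \<gamma>(1) \<open>\<nu> \<noteq> \<kappa>\<close> unfolding b_def by (metis fst_conv snd_conv)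
          then have "tail_entry \<kappa> \<nu> = tail (\<tau> \<kappa>) (\<gamma>, snd \<nu>)"
            using \<gamma>(2) \<open>\<nu> \<noteq> \<kappa>\<close> by (simp add: tail_def tail_entry_def)
          then show ?thesis unfolding h' using h by simp
        qed
        have T: "wbounded v ?w \<rho> (\<rho> ^ ?w (im (\<tau> \<kappa>)) / 2) (tail (\<tau> \<kappa>))" using elim(1) t by blast
        have "wbounded v (\<lambda>\<nu>. ?w (?h \<nu>)) \<rho> (\<rho> ^ ?w (im (\<tau> \<kappa>)) / 2 / \<rho> ^ 0) (tail_entry \<kappa>)"
        \<comment> \<open>Truncated subtraction of b need not be injective beyond the multiples of
          the monomial b. Injectivity is therefore asked on these multiples only; they contain all
          nonzero entries of the row.\<close>
        proof (rule wbounded_reindex[OF T elim(3), where h = ?h and B = "{\<nu>. fst \<nu> = b + fst (?h \<nu>)}"])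
          show "inj_on ?h {\<nu>. fst \<nu> = b + fst (?h \<nu>)}"
          proof (rule inj_onI)
            fix \<mu> \<nu> assume "\<mu> \<in> {\<nu>. fst \<nu> = b + fst (?h \<nu>)}" "\<nu> \<in> {\<nu>. fst \<nu> = b + fst (?h \<nu>)}" "?h \<mu> = ?h \<nu>"
            then have "fst \<mu> = fst \<nu>" "snd \<mu> = snd \<nu>" unfolding mem_Collect_eq fst_conv prod.inject by metis+
            then show "\<mu> = \<nu>" by (rule prod_eqI)
          qed
        qed (use nz in auto)
        then have *: "(\<Sum>\<nu>\<in>A. v (tail_entry \<kappa> \<nu>) * \<rho> ^ ?w (?h \<nu>)) \<le> \<rho> ^ ?w (im (\<tau> \<kappa>)) / 2"
          using A by (simp add: wbounded_def)
        have "(\<Sum>\<nu>\<in>A. v (tail_entry \<kappa> \<nu>) * \<rho> ^ ?w \<nu>) =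
            (\<Sum>\<nu>\<in>A. \<rho> ^ wdeg n w b * (v (tail_entry \<kappa> \<nu>) * \<rho> ^ ?w (?h \<nu>)))"
        proof (rule sum.cong[OF refl])
          fix \<nu>
          show "v (tail_entry \<kappa> \<nu>) * \<rho> ^ ?w \<nu> = \<rho> ^ wdeg n w b * (v (tail_entry \<kappa> \<nu>) * \<rho> ^ ?w (?h \<nu>))"
          proof (cases "tail_entry \<kappa> \<nu> = 0")
            case False
            then have "wdeg n w (fst \<nu>) = wdeg n w b + wdeg n w (fst (?h \<nu>))"
              using nz[OF False] wdeg_add by metis
            then show ?thesis by (simp add: mwdeg_def power_add)
          qed simp
        qed
        also have "\<dots> = \<rho> ^ wdeg n w b * (\<Sum>\<nu>\<in>A. v (tail_entry \<kappa> \<nu>) * \<rho> ^ ?w (?h \<nu>))"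
          by (simp only: sum_distrib_left)
        also have "\<dots> \<le> \<rho> ^ wdeg n w b * (\<rho> ^ ?w (im (\<tau> \<kappa>)) / 2)"
          using * elim(3) by (intro mult_left_mono) auto
        also have "\<dots> = \<rho> ^ ?w \<kappa> / 2"
        proof -
          have "?w \<kappa> = wdeg n w b + ?w (im (\<tau> \<kappa>))"
            unfolding b_def by (subst lead_eq[OF True]) (simp add: mwdeg_def wdeg_add)
          then show ?thesis by (simp add: power_add)
        qed
        finally show ?thesis .
      qed
    qed
    then show ?case by blast
  qed
  then show ?thesis using w by blast
qed

text \<open>The solution is distributed among the quotients according to \<open>\<tau>\<close>, so
  each leading monomial contributes to exactly one of them. This is the support condition by which
  division is usually made unique.\<close>

definition quot :: "'k mps vec" where
  "quot = vec m (\<lambda>t. Abs_mps (\<lambda>\<beta>. if (\<beta> + fst (im t), snd (im t)) \<in> lead \<and> \<tau> (\<beta> + fst (im t), snd (im t)) = t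
     then u (\<beta> + fst (im t), snd (im t)) else 0))"

definition remainder :: "'k mps vec" where
  "remainder = vec p (\<lambda>j. Abs_mps (\<lambda>\<alpha>. if (\<alpha>, j) \<in> lead then 0 else u (\<alpha>, j)))"

lemma quot_coeff: "t < m \<Longrightarrow> mps_coeff (quot $ t) \<beta> =
    (if (\<beta> + fst (im t), snd (im t)) \<in> lead \<and> \<tau> (\<beta> + fst (im t), snd (im t)) = t
     then u (\<beta> + fst (im t), snd (im t)) else 0)"
  by (simp add: quot_def)

lemma remainder_coeff: "j < p \<Longrightarrow> mps_coeff (remainder $ j) \<alpha> = (if (\<alpha>, j) \<in> lead then 0 else u (\<alpha>, j))"
  by (simp add: remainder_def)

lemma quot_R: "quot \<in> carrier (free_module R m)"
  unfolding carrier_free_module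
proof (intro conjI allI impI)
  show "quot \<in> carrier_vec m" by (simp add: quot_def)
  fix t assume t: "t < m"
  obtain w s where w: "\<forall>i<n. 1 \<le> w i" and ev: "\<forall>\<^sub>F \<rho> in at_right 0. \<exists>C. wbounded v (mwdeg n w s) \<rho> C u"
    using u_bounded by blast
  have "\<forall>\<^sub>F \<rho> in at_right 0. \<exists>C. wbounded v (wdeg n w) \<rho> C (mps_coeff (quot $ t))"
    using ev eventually_pos
  proof eventually_elim
    case (elim \<rho>)
    then obtain C where C: "wbounded v (mwdeg n w s) \<rho> C u" by blast
    have "wbounded v (wdeg n w) \<rho> (C / \<rho> ^ mwdeg n w s (im t)) (mps_coeff (quot $ t))"
      by (rule wbounded_reindex[OF C elim(2), where h = "\<lambda>\<beta>. (\<beta> + fst (im t), snd (im t))" and B = UNIV])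
        (auto simp: inj_on_def quot_coeff[OF t] mwdeg_def wdeg_add split: if_splits)
    then show ?case by blast
  qed
  moreover have "\<beta> \<in> mons n" if "mps_coeff (quot $ t) \<beta> \<noteq> 0" for \<beta>
    using that by (auto simp: quot_coeff[OF t] lead_def mmons_def split: if_splits)
  ultimately show "quot $ t \<in> R" using R_iff[OF w] by blast
qed

lemma remainder_R: "remainder \<in> carrier (free_module R p)"
  unfolding carrier_free_module
proof (intro conjI allI impI)
  show "remainder \<in> carrier_vec p" by (simp add: remainder_def)
  fix j assume j: "j < p"
  obtain w s where w: "\<forall>i<n. 1 \<le> w i" and ev: "\<forall>\<^sub>F \<rho> in at_right 0. \<exists>C. wbounded v (mwdeg n w s) \<rho> C u"
    using u_bounded by blast
  have "\<forall>\<^sub>F \<rho> in at_right 0. \<exists>C. wbounded v (wdeg n w) \<rho> C (mps_coeff (remainder $ j))"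
    using ev eventually_pos
  proof eventually_elim
    case (elim \<rho>)
    then obtain C where C: "wbounded v (mwdeg n w s) \<rho> C u" by blast
    have "wbounded v (wdeg n w) \<rho> (C / \<rho> ^ s j) (mps_coeff (remainder $ j))"
      by (rule wbounded_reindex[OF C elim(2), where h = "\<lambda>\<alpha>. (\<alpha>, j)" and B = UNIV])
        (auto simp: inj_on_def remainder_coeff[OF j] mwdeg_def split: if_splits)
    then show ?case by blast
  qed
  moreover have "\<alpha> \<in> mons n" if "mps_coeff (remainder $ j) \<alpha> \<noteq> 0" for \<alpha>
    using that u_outside[of "(\<alpha>, j)"] by (auto simp: remainder_coeff[OF j] mmons_def split: if_splits)
  ultimately show "remainder $ j \<in> R" using R_iff[OF w] by blast
qed

lemma remainder_supp:
  assumes "\<nu> \<in> vec_supp remainder" "t < m"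
  shows "\<not> mmon_dvd (im t) \<nu>"
proof -
  have "\<nu> \<in> mmons n p" using vec_supp_mmons[OF remainder_R] assms(1) by blast
  moreover have "\<nu> \<notin> lead"
    using assms(1) by (auto simp: vec_supp_def remainder_def split: if_splits)
  ultimately show ?thesis using assms(2) by (auto simp: lead_def)
qed

lemma quot_degree:
  assumes "\<And>\<alpha> j. (\<alpha>, j) \<in> vec_supp g \<Longrightarrow> d \<le> pdeg c \<alpha> + a j" and "(\<beta>, t) \<in> vec_supp quot"
  shows "d \<le> pdeg c \<beta> + (pdeg c (fst (im t)) + a (snd (im t)))"
proof -
  have "t < m" using assms(2) by (simp add: vec_supp_def quot_def)
  then have nz: "u (\<beta> + fst (im t), snd (im t)) \<noteq> 0"
    using assms(2) quot_coeff[of t \<beta>] by (auto simp: vec_supp_def split: if_splits)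
  have "d \<le> pdeg c (\<beta> + fst (im t)) + a (snd (im t))"
    by (rule u_degree[OF _ nz]) (rule assms(1))
  then show ?thesis by (simp only: pdeg_add add.assoc)
qed

text \<open>The triples (t, \<gamma>, \<beta>) that contribute correspond to the rows \<kappa>
  meeting (\<alpha>, j): \<kappa> is \<beta> times the initial monomial of column t, and
  \<open>\<tau>\<close> and \<open>cofactor\<close> recover t and \<beta> from it. Multiplying F by
  the quotients thus combines the rows of the system with coefficients u.\<close>

lemma product_coeff:
  assumes j: "j < p"
  shows "mps_coeff ((F *\<^sub>v quot) $ j) \<alpha> = (\<Sum>\<kappa> | entry \<kappa> (\<alpha>, j) \<noteq> 0. u \<kappa> * entry \<kappa> (\<alpha>, j))"
proof -
  let ?S = "{(\<gamma>, \<beta>). \<gamma> + \<beta> = \<alpha>}"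
  let ?\<kappa> = "\<lambda>t \<beta>. (\<beta> + fst (im t), snd (im t))"
  let ?f = "\<lambda>t \<gamma>. vec_coeff (col F t) (\<gamma>, j)"
  let ?P = "{(t, \<gamma>, \<beta>). t < m \<and> \<gamma> + \<beta> = \<alpha> \<and> ?\<kappa> t \<beta> \<in> lead \<and> \<tau> (?\<kappa> t \<beta>) = t \<and> ?f t \<gamma> \<noteq> 0}"
  have "mps_coeff ((F *\<^sub>v quot) $ j) \<alpha> = (\<Sum>t<m. mps_coeff (F $$ (j, t) * quot $ t) \<alpha>)"
    using F j by (simp add: scalar_prod_def quot_def lessThan_atLeast0)
  also have "\<dots> = (\<Sum>t<m. \<Sum>(\<gamma>, \<beta>)\<in>?S. ?f t \<gamma> * mps_coeff (quot $ t) \<beta>)"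
    using F j by (intro sum.cong) (auto simp: mps_coeff_times vec_coeff_def)
  also have "\<dots> = (\<Sum>(t, \<gamma>, \<beta>)\<in>{..<m} \<times> ?S. ?f t \<gamma> * mps_coeff (quot $ t) \<beta>)"
    by (simp add: sum.cartesian_product case_prod_beta)
  also have "\<dots> = (\<Sum>(t, \<gamma>, \<beta>)\<in>?P. ?f t \<gamma> * mps_coeff (quot $ t) \<beta>)"
    by (rule sum.mono_neutral_right)
      (auto simp: quot_coeff finite_mon_splits split: if_splits)
  also have "\<dots> = (\<Sum>\<kappa> | entry \<kappa> (\<alpha>, j) \<noteq> 0. u \<kappa> * entry \<kappa> (\<alpha>, j))"
  proof (rule sum.reindex_bij_witness[where j = "\<lambda>(t, \<gamma>, \<beta>). ?\<kappa> t \<beta>"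
        and i = "\<lambda>\<kappa>. (\<tau> \<kappa>, \<alpha> - cofactor \<kappa>, cofactor \<kappa>)"])
    fix x assume "x \<in> ?P"
    then obtain t \<gamma> \<beta> where [simp]: "x = (t, \<gamma>, \<beta>)"
      and x: "t < m" "\<gamma> + \<beta> = \<alpha>" "?\<kappa> t \<beta> \<in> lead" "\<tau> (?\<kappa> t \<beta>) = t" "?f t \<gamma> \<noteq> 0" by auto
    have co: "cofactor (?\<kappa> t \<beta>) = \<beta>" by (rule cofactor_eq[OF x(4)])
    have \<gamma>: "\<alpha> - \<beta> = \<gamma>" "\<exists>\<gamma>. \<alpha> = \<beta> + \<gamma>" using x(2) by (auto simp: add.commute)
    have e: "entry (?\<kappa> t \<beta>) (\<alpha>, j) = ?f t \<gamma>"
      unfolding entry_def co using x(3,4) \<gamma> by simp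
    show "(case case x of (t, \<gamma>, \<beta>) \<Rightarrow> ?\<kappa> t \<beta> of \<kappa> \<Rightarrow> (\<tau> \<kappa>, \<alpha> - cofactor \<kappa>, cofactor \<kappa>)) = x"
      using co \<gamma> x(4) by simp
    show "(case x of (t, \<gamma>, \<beta>) \<Rightarrow> ?\<kappa> t \<beta>) \<in> {\<kappa>. entry \<kappa> (\<alpha>, j) \<noteq> 0}" using e x(5) by simp
    show "u (case x of (t, \<gamma>, \<beta>) \<Rightarrow> ?\<kappa> t \<beta>) * entry (case x of (t, \<gamma>, \<beta>) \<Rightarrow> ?\<kappa> t \<beta>) (\<alpha>, j) =
       (case x of (t, \<gamma>, \<beta>) \<Rightarrow> ?f t \<gamma> * mps_coeff (quot $ t) \<beta>)"
      using e x by (simp add: quot_coeff mult.commute)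
  next
    fix \<kappa> assume "\<kappa> \<in> {\<kappa>. entry \<kappa> (\<alpha>, j) \<noteq> 0}"
    then have nz: "entry \<kappa> (\<alpha>, j) \<noteq> 0" by simp
    then obtain \<gamma> where \<gamma>: "\<kappa> \<in> lead" "(\<alpha>, j) = (cofactor \<kappa> + \<gamma>, snd (\<alpha>, j))"
      "entry \<kappa> (\<alpha>, j) = ?f (\<tau> \<kappa>) \<gamma>" by (rule entry_nonzeroE) auto
    have \<alpha>: "\<alpha> = cofactor \<kappa> + \<gamma>" using \<gamma>(2) by simp
    have \<kappa>: "?\<kappa> (\<tau> \<kappa>) (cofactor \<kappa>) = \<kappa>" using lead_eq[OF \<gamma>(1)] by simp
    show "(case (\<tau> \<kappa>, \<alpha> - cofactor \<kappa>, cofactor \<kappa>) of (t, \<gamma>, \<beta>) \<Rightarrow> ?\<kappa> t \<beta>) = \<kappa>" using \<kappa> by simp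
    show "(\<tau> \<kappa>, \<alpha> - cofactor \<kappa>, cofactor \<kappa>) \<in> ?P"
      using \<alpha> \<kappa> \<gamma> nz \<tau>(1)[OF \<gamma>(1)] by (simp add: add.commute)
  qed
  finally show ?thesis .
qed

text \<open>On \<open>lead\<close> the diagonal entries are 1, and outside it the remainder supplies
  the missing diagonal term. In both cases the coefficient becomes u plus the off-diagonal sum,
  which is the equation that u solves.\<close>

lemma division_eq: "g = F *\<^sub>v quot + remainder"
proof (rule eq_vecI)
  show "dim_vec g = dim_vec (F *\<^sub>v quot + remainder)" using g by (simp add: carrier_free_module remainder_def)
  fix j assume "j < dim_vec (F *\<^sub>v quot + remainder)"
  then have j: "j < p" by (simp add: remainder_def)
  show "g $ j = (F *\<^sub>v quot + remainder) $ j"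
    unfolding mps_eq_iff
  proof
    fix \<alpha> :: mon
    let ?\<nu> = "(\<alpha>, j)"
    let ?T = "\<Sum>\<kappa> | tail_entry \<kappa> ?\<nu> \<noteq> 0. u \<kappa> * tail_entry \<kappa> ?\<nu>"
    have tail: "?T = (\<Sum>\<kappa>\<in>{\<kappa>. entry \<kappa> ?\<nu> \<noteq> 0} - {?\<nu>}. u \<kappa> * entry \<kappa> ?\<nu>)"
      by (rule sum.cong) (auto simp: tail_entry_def split: if_splits)
    have "(\<Sum>\<kappa> | entry \<kappa> ?\<nu> \<noteq> 0. u \<kappa> * entry \<kappa> ?\<nu>) = (if ?\<nu> \<in> lead then u ?\<nu> else 0) + ?T"
    proof (cases "?\<nu> \<in> lead")
      case True
      then have "?\<nu> \<in> {\<kappa>. entry \<kappa> ?\<nu> \<noteq> 0}" by (simp add: entry_self)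
      from sum.remove[OF finite_entry this, of "\<lambda>\<kappa>. u \<kappa> * entry \<kappa> ?\<nu>"] show ?thesis
        unfolding tail using True by (simp add: entry_self)
    next
      case False
      then have "?\<nu> \<notin> {\<kappa>. entry \<kappa> ?\<nu> \<noteq> 0}" by (simp add: entry_def)
      then show ?thesis unfolding tail using False by simp
    qed
    then have "mps_coeff ((F *\<^sub>v quot) $ j) \<alpha> + mps_coeff (remainder $ j) \<alpha> = u ?\<nu> + ?T"
      unfolding product_coeff[OF j] remainder_coeff[OF j] by simp
    also have "\<dots> = vec_coeff g ?\<nu>" using u[of ?\<nu>] by simp
    also have "\<dots> = mps_coeff (g $ j) \<alpha>" using g j by (auto simp: vec_coeff_def carrier_free_module)
    finally show "mps_coeff (g $ j) \<alpha> = mps_coeff ((F *\<^sub>v quot + remainder) $ j) \<alpha>"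
      using j by (simp add: remainder_def)
  qed
qed

end

section \<open>Standard bases and the filtration\<close>

text \<open>Vectors of all dimensions share one type, so the neutral element depends on m. The
  locale extracts what the free modules and their filtered pieces have in common as additive
  groups.\<close>

locale vec_group =
  fixes G :: "('a::ab_group_add vec, 'b) monoid_scheme" and m :: nat
  assumes mult_G: "monoid.mult G = (+)" and one_G: "\<one>\<^bsub>G\<^esub> = 0\<^sub>v m"
    and carrier_G: "carrier G \<subseteq> carrier_vec m" and zero_G: "0\<^sub>v m \<in> carrier G"
    and add_G: "\<And>x y. x \<in> carrier G \<Longrightarrow> y \<in> carrier G \<Longrightarrow> x + y \<in> carrier G"
    and uminus_G: "\<And>x. x \<in> carrier G \<Longrightarrow> - x \<in> carrier G"
begin

sublocale comm_group G
proof (rule comm_groupI)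
  fix x assume "x \<in> carrier G"
  then show "\<exists>y\<in>carrier G. y \<otimes>\<^bsub>G\<^esub> x = \<one>\<^bsub>G\<^esub>"
    using uminus_G carrier_G by (intro bexI[of _ "- x"]) (auto simp: mult_G one_G)
next
  fix x y z assume "x \<in> carrier G" "y \<in> carrier G" "z \<in> carrier G"
  then show "x \<otimes>\<^bsub>G\<^esub> y \<otimes>\<^bsub>G\<^esub> z = x \<otimes>\<^bsub>G\<^esub> (y \<otimes>\<^bsub>G\<^esub> z)"
    using carrier_G unfolding mult_G by (intro assoc_add_vec[of _ m]) auto
next
  fix x y assume "x \<in> carrier G" "y \<in> carrier G"
  then show "x \<otimes>\<^bsub>G\<^esub> y = y \<otimes>\<^bsub>G\<^esub> x"
    using carrier_G unfolding mult_G by (intro comm_add_vec[of _ m]) auto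
qed (use carrier_G zero_G add_G in \<open>auto simp: mult_G one_G\<close>)

lemma comm_group_G: "comm_group G"
  by (rule comm_group_axioms)

lemma inv_G: "x \<in> carrier G \<Longrightarrow> inv\<^bsub>G\<^esub> x = - x"
  using uminus_G carrier_G by (intro inv_equality) (auto simp: mult_G one_G)

lemma subgroup_vecs:
  assumes "B \<subseteq> carrier G" "0\<^sub>v m \<in> B" "\<And>x y. x \<in> B \<Longrightarrow> y \<in> B \<Longrightarrow> x + y \<in> B" "\<And>x. x \<in> B \<Longrightarrow> - x \<in> B"
  shows "subgroup B G"
proof
  fix x assume x: "x \<in> B"
  then have "inv\<^bsub>G\<^esub> x = - x" using assms(1) by (intro inv_G) auto
  then show "inv\<^bsub>G\<^esub> x \<in> B" using assms(4)[OF x] by simp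
qed (use assms in \<open>auto simp: mult_G one_G\<close>)

end

lemma vec_supp_uminus: "vec_supp (- u :: 'k::comm_ring_1 mps vec) = vec_supp u"
  by (auto simp: vec_supp_def)

lemma vec_supp_add: "u \<in> carrier_vec m \<Longrightarrow> u' \<in> carrier_vec m \<Longrightarrow>
    vec_supp (u + u' :: 'k::comm_ring_1 mps vec) \<subseteq> vec_supp u \<union> vec_supp u'"
  by (auto simp: vec_supp_def)

lemma vec_supp_zero [simp]: "vec_supp (0\<^sub>v m :: 'k::comm_ring_1 mps vec) = {}"
  by (auto simp: vec_supp_def)

lemma vec_supp_smult:
  assumes "(\<alpha>, l) \<in> vec_supp (b \<cdot>\<^sub>v u :: 'k::comm_ring_1 mps vec)"
  obtains \<beta> \<gamma> where "\<alpha> = \<beta> + \<gamma>" "(\<gamma>, l) \<in> vec_supp u"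
proof -
  have "l < dim_vec u" "mps_coeff (b * u $ l) \<alpha> \<noteq> 0" using assms by (auto simp: vec_supp_def)
  from mps_times_nonzero_coeffE[OF this(2)] this(1) that show ?thesis
    by (auto simp: vec_supp_def)
qed

lemma mult_mat_vec_index:
  assumes "F \<in> carrier_mat p m" "q \<in> carrier_vec m" "j < p"
  shows "(F *\<^sub>v q) $ j = (\<Sum>t<m. F $$ (j, t) * q $ t)"
  using assms by (auto simp: scalar_prod_def lessThan_atLeast0 intro: sum.cong)

lemma vec_supp_mult_mat_vec:
  assumes "F \<in> carrier_mat p m" "q \<in> carrier_vec m" 
    and "(\<alpha>, j) \<in> vec_supp (F *\<^sub>v q :: 'k::comm_ring_1 mps vec)"
  obtains t \<beta> \<gamma> where "t < m" "\<alpha> = \<beta> + \<gamma>" "(\<beta>, j) \<in> vec_supp (col F t)" "(\<gamma>, t) \<in> vec_supp q"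
proof -
  have j: "j < p" and "mps_coeff ((F *\<^sub>v q) $ j) \<alpha> \<noteq> 0" using assms by (auto simp: vec_supp_def)
  moreover have "(F *\<^sub>v q) $ j = (\<Sum>t<m. F $$ (j, t) * q $ t)"
    by (rule mult_mat_vec_index[OF assms(1,2) j])
  ultimately have "(\<Sum>t<m. mps_coeff (F $$ (j, t) * q $ t) \<alpha>) \<noteq> 0" by simp
  then obtain t where t: "t < m" "mps_coeff (F $$ (j, t) * q $ t) \<alpha> \<noteq> 0"
    by (metis (no_types, lifting) lessThan_iff sum.neutral)
  from t(2) obtain \<beta> \<gamma> where "\<alpha> = \<beta> + \<gamma>" "mps_coeff (F $$ (j, t)) \<beta> \<noteq> 0" "mps_coeff (q $ t) \<gamma> \<noteq> 0"
    by (rule mps_times_nonzero_coeffE)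
  then show ?thesis using that[of t \<beta> \<gamma>] t(1) j assms(1,2) by (auto simp: vec_supp_def)
qed

text \<open>\<open>exact_seq\<close> lists the target first and grows at the head, so the sequence
  is built up from the source end, with \<phi> i going from H (Suc i) to H i. The kernel condition
  is asked at inner groups only.\<close>

lemma exact_seqI:
  assumes "\<And>i. i < N \<Longrightarrow> group (H i)" "\<And>i. i < N \<Longrightarrow> group (H (Suc i))"
    and "\<And>i. i < N \<Longrightarrow> \<phi> i \<in> hom (H (Suc i)) (H i)"
    and "\<And>i. Suc i < N \<Longrightarrow> kernel (H (Suc i)) (H i) (\<phi> i) = \<phi> (Suc i) ` carrier (H (Suc (Suc i)))"
    and "0 < N"
  shows "exact_seq (map H [0..<Suc N], map \<phi> [0..<N])"
proof -
  have "exact_seq (map H [j..<Suc N], map \<phi> [j..<N])" if "j < N" for j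
    using that
  proof (induction "N - j" arbitrary: j)
    case (Suc d)
    have g: "group (H j)" "group (H (Suc j))" "\<phi> j \<in> hom (H (Suc j)) (H j)" using assms Suc.prems by auto
    show ?case
    proof (cases "Suc j = N")
      case True
      then have "[j..<Suc N] = [j, Suc j]" "[j..<N] = [j]" by (auto simp: upt_rec)
      then show ?thesis using g by (auto simp: group_hom_def group_hom_axioms_def)
    next
      case False
      then have j: "Suc j < N" using Suc.prems by simp
      have IH: "exact_seq (map H [Suc j..<Suc N], map \<phi> [Suc j..<N])" using Suc j by simp
      have l: "[j..<Suc N] = j # Suc j # Suc (Suc j) # [Suc (Suc (Suc j))..<Suc N]"
        "[Suc j..<Suc N] = Suc j # Suc (Suc j) # [Suc (Suc (Suc j))..<Suc N]"
        "[j..<N] = j # Suc j # [Suc (Suc j)..<N]" "[Suc j..<N] = Suc j # [Suc (Suc j)..<N]"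
        using j by (simp_all add: upt_conv_Cons del: upt_Suc)
      show ?thesis using IH unfolding l list.map
        by (rule exact_seq.extension) (use g assms(4)[OF j] in auto)
    qed
  qed simp
  from this[OF assms(5)] show ?thesis .
qed

context conv_ring
begin

section \<open>Free modules, their filtrations and lifting through a standard basis\<close>

lemma free_module_closed:
  "0\<^sub>v p \<in> carrier (free_module R p)"
  "x \<in> carrier (free_module R p) \<Longrightarrow> y \<in> carrier (free_module R p) \<Longrightarrow> x + y \<in> carrier (free_module R p)"
  "x \<in> carrier (free_module R p) \<Longrightarrow> - x \<in> carrier (free_module R p)"
  "b \<in> R \<Longrightarrow> x \<in> carrier (free_module R p) \<Longrightarrow> b \<cdot>\<^sub>v x \<in> carrier (free_module R p)"
  by (auto simp: carrier_free_module R_add R_uminus R_times)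

lemma free_module_carrier_vec: "carrier (free_module R p) \<subseteq> carrier_vec p"
  by (auto simp: carrier_free_module)

lemma vec_group_free_module: "vec_group (add_monoid (free_module R p)) p"
proof
  show "monoid.mult (add_monoid (free_module R p)) = (+)" "\<one>\<^bsub>add_monoid (free_module R p)\<^esub> = 0\<^sub>v p"
    by (simp_all add: free_module_def module_vec_def)
qed (use free_module_closed free_module_carrier_vec in auto)

lemma mult_mat_vec_free_module:
  assumes "F \<in> carrier_mat p m" "\<And>t. t < m \<Longrightarrow> col F t \<in> carrier (free_module R p)"
    "q \<in> carrier (free_module R m)"
  shows "F *\<^sub>v q \<in> carrier (free_module R p)"
  unfolding carrier_free_module
proof (intro conjI allI impI)
  show "F *\<^sub>v q \<in> carrier_vec p" using assms by (auto simp: carrier_free_module)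
  fix j assume j: "j < p"
  have "F $$ (j, t) \<in> R" if "t < m" for t
    using assms(2)[OF that] assms(1) j that by (auto simp: carrier_free_module)
  then have "(\<Sum>t<m. F $$ (j, t) * q $ t) \<in> R"
    using assms(3) by (intro R_sum R_times) (auto simp: carrier_free_module)
  then show "(F *\<^sub>v q) $ j \<in> R"
    using mult_mat_vec_index[OF assms(1) _ j, of q] assms(3) by (simp add: carrier_free_module)
qed

text \<open>Moves the weights to the degree side: a module monomial has its P-degree plus the degree
  w l of its basis vector, and this is the quantity that \<open>graded\<close> controls.\<close>

lemma carrier_P_sum:
  "u \<in> carrier (P_sum R c m w r) \<longleftrightarrow>
    u \<in> carrier (free_module R m) \<and> (\<forall>\<alpha> l. (\<alpha>, l) \<in> vec_supp u \<longrightarrow> r \<le> int (pdeg c \<alpha> + w l))"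
  unfolding P_sum_def carrier_free_module P_power_eq vec_supp_def by (auto simp: algebra_simps)

lemma vec_group_P_sum: "vec_group (P_sum R c m w r) m"
proof
  show "monoid.mult (P_sum R c m w r) = (+)" "\<one>\<^bsub>P_sum R c m w r\<^esub> = 0\<^sub>v m"
    by (simp_all add: P_sum_def)
  show "carrier (P_sum R c m w r) \<subseteq> carrier_vec m" by (simp add: P_sum_def subset_iff)
  show "0\<^sub>v m \<in> carrier (P_sum R c m w r)" by (simp add: carrier_P_sum free_module_closed)
next
  fix x y assume *: "x \<in> carrier (P_sum R c m w r)" "y \<in> carrier (P_sum R c m w r)"
  then have xy: "x \<in> carrier (free_module R m)" "y \<in> carrier (free_module R m)" by (auto simp: carrier_P_sum)
  then have "vec_supp (x + y) \<subseteq> vec_supp x \<union> vec_supp y"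
    by (intro vec_supp_add[of _ m]) (auto simp: carrier_free_module)
  then show "x + y \<in> carrier (P_sum R c m w r)"
    using * free_module_closed(2)[OF xy] by (auto simp: carrier_P_sum)
next
  fix x assume "x \<in> carrier (P_sum R c m w r)"
  then show "- x \<in> carrier (P_sum R c m w r)"
    by (simp add: carrier_P_sum free_module_closed vec_supp_uminus)
qed

text \<open>An upper bound for the intersection in \<open>submodule_gen\<close>. If \<mu> t are the
  initial monomials of a standard basis, this submodule contains their initial terms, hence all
  initial terms of the module, and membership of a single term is divisibility.\<close>

lemma submodule_leading:
  "submodule {x \<in> carrier (free_module R p). \<forall>\<nu>\<in>vec_supp x. \<exists>t<m. mmon_dvd (\<mu> t) \<nu>}
    (series_ring R) (free_module R p)" (is "submodule ?N _ _")
proof (intro submodule.intro submodule_axioms.intro)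
  show "subgroup ?N (add_monoid (free_module R p))"
  proof (rule vec_group.subgroup_vecs[OF vec_group_free_module])
    fix x y assume *: "x \<in> ?N" "y \<in> ?N"
    then have "vec_supp (x + y) \<subseteq> vec_supp x \<union> vec_supp y"
      using free_module_carrier_vec by (intro vec_supp_add[of _ p]) auto
    then show "x + y \<in> ?N" using * free_module_closed(2)[of x p y] by blast
  qed (auto simp: free_module_closed vec_supp_uminus)
next
  fix b x assume *: "b \<in> carrier (series_ring R)" "x \<in> ?N"
  have "\<exists>t<m. mmon_dvd (\<mu> t) \<nu>" if "\<nu> \<in> vec_supp (b \<cdot>\<^sub>v x)" for \<nu>
  proof -
    obtain \<alpha> l where \<nu>: "\<nu> = (\<alpha>, l)" by fastforce
    obtain \<beta> \<gamma> where \<gamma>: "\<alpha> = \<beta> + \<gamma>" "(\<gamma>, l) \<in> vec_supp x"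
      using \<open>\<nu> \<in> vec_supp (b \<cdot>\<^sub>v x)\<close> unfolding \<nu> by (rule vec_supp_smult)
    from *(2) \<gamma>(2) obtain t where t: "t < m" "mmon_dvd (\<mu> t) (\<gamma>, l)" by blast
    from t(2) obtain \<delta> where "snd (\<mu> t) = l" "\<gamma> = fst (\<mu> t) + \<delta>" by (auto simp: mmon_dvd_def)
    then have "mmon_dvd (\<mu> t) \<nu>"
      unfolding mmon_dvd_def \<nu> \<gamma>(1) by (auto intro!: exI[of _ "\<beta> + \<delta>"] simp: ac_simps)
    then show ?thesis using t(1) by blast
  qed
  moreover have "b \<cdot>\<^sub>v x \<in> carrier (free_module R p)"
    using * free_module_closed(4) by (simp add: series_ring_def)
  moreover have "b \<odot>\<^bsub>free_module R p\<^esub> x = b \<cdot>\<^sub>v x" by (simp add: free_module_def module_vec_def)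
  ultimately show "b \<odot>\<^bsub>free_module R p\<^esub> x \<in> ?N" by simp
qed

lemma init_term_supp:
  assumes "good_order n c p a lt" "x \<in> carrier (free_module R p)" "x \<noteq> 0\<^sub>v p"
  shows "init_term lt x \<in> carrier (free_module R p)" "vec_supp (init_term lt x) = {init_mon lt x}"
    "init_mon lt x \<in> vec_supp x"
proof -
  interpret good_order n c p a lt by fact
  have dim: "dim_vec x = p" using assms(2) by (simp add: carrier_free_module)
  have "vec_supp x \<noteq> {}" using assms(3) dim by (simp add: vec_supp_eq_empty_iff)
  from init_mon_least(1)[OF vec_supp_mmons[OF assms(2)] this] show im: "init_mon lt x \<in> vec_supp x" .
  obtain \<alpha> l where \<alpha>: "init_mon lt x = (\<alpha>, l)" by fastforce
  have mm: "\<alpha> \<in> mons n" "l < p" using im vec_supp_mmons[OF assms(2)] \<alpha> by (auto simp: mmons_def)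
  have nz: "init_coeff lt x \<noteq> 0" using im unfolding init_coeff_eq[OF im] by (simp add: vec_supp_iff)
  have it: "init_term lt x = mps_monom \<alpha> (init_coeff lt x) \<cdot>\<^sub>v unit_vec p l"
    by (simp add: init_term_def \<alpha> dim)
  show "init_term lt x \<in> carrier (free_module R p)"
    unfolding it carrier_free_module using mm by (auto simp: unit_vec_def R_monom)
  show "vec_supp (init_term lt x) = {init_mon lt x}"
    unfolding it \<alpha> using mm nz by (auto simp: vec_supp_def unit_vec_def mps_coeff_monom split: if_splits)
qed

text \<open>The hypothesis \<open>closed\<close> keeps the remainder inside M; in this form it suits
  both the ideal and the syzygy modules. The bound d passes from g to the quotients monomial by
  monomial, each basis vector being placed in the weighted degree of the initial monomial of its
  column.\<close>

theorem standard_basis_lift: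
  assumes go: "good_order n c p a lt"
    and F: "F \<in> carrier_mat p m" and sb: "standard_basis R lt M F" and mm: "monic_minimal lt F"
    and M: "M \<subseteq> carrier (free_module R p)"
    and closed: "\<And>g q. g \<in> M \<Longrightarrow> q \<in> carrier (free_module R m) \<Longrightarrow> g - F *\<^sub>v q \<in> M"
    and g: "g \<in> M" and deg: "\<And>\<alpha> j. (\<alpha>, j) \<in> vec_supp g \<Longrightarrow> d \<le> pdeg c \<alpha> + a j"
  shows "\<exists>q\<in>carrier (free_module R m). g = F *\<^sub>v q \<and>
     (\<forall>\<beta> t. (\<beta>, t) \<in> vec_supp q \<longrightarrow>
        d \<le> pdeg c \<beta> + (pdeg c (fst (init_mon lt (col F t))) + a (snd (init_mon lt (col F t)))))"
proof -
  have dims: "dim_row F = p" "dim_col F = m" using F by auto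
  have cols: "col F t \<in> carrier (free_module R p)" if "t < m" for t
  proof -
    have "col F t \<in> set (Matrix.cols F)" using that dims by (simp add: cols_def)
    then show ?thesis using sb M by (auto simp: standard_basis_def)
  qed
  have nz: "col F t \<noteq> 0\<^sub>v p" "init_coeff lt (col F t) = 1" if "t < m" for t
    using mm that dims by (auto simp: monic_minimal_def)
  have "g \<in> carrier (free_module R p)" using M g by blast
  interpret division v n c R p a lt m F g
    by (intro division.intro division_axioms.intro conv_ring_axioms go F cols nz) (assumption | fact)+
  have "remainder = g - F *\<^sub>v quot"
  proof -
    have "F *\<^sub>v quot \<in> carrier_vec p" using F by (auto simp: quot_def)
    moreover have "remainder \<in> carrier_vec p" by (simp add: remainder_def)
    moreover have "x + y - x = y" if "x \<in> carrier_vec p" "y \<in> carrier_vec p" for x y :: "'k mps vec"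
      using that by auto
    ultimately show ?thesis using arg_cong[OF division_eq, of "\<lambda>x. x - F *\<^sub>v quot"] by metis
  qed
  then have remM: "remainder \<in> M" using closed[OF \<open>g \<in> M\<close> quot_R] by simp
  have "remainder = 0\<^sub>v p"
  proof (rule ccontr)
    assume nz': "remainder \<noteq> 0\<^sub>v p"
    let ?N = "{x \<in> carrier (free_module R p). \<forall>\<nu>\<in>vec_supp x. \<exists>t<m. mmon_dvd (im t) \<nu>}"
    have "init_term lt remainder \<in> submodule_gen R p {init_term lt g |g. g \<in> M \<and> g \<noteq> 0\<^sub>v p}"
      unfolding submodule_gen_def using remM nz' by blast
    also have "\<dots> = submodule_gen R p {init_term lt f |f. f \<in> set (cols F) \<and> f \<noteq> 0\<^sub>v p}"
      using sb dims by (simp add: standard_basis_def)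
    also have "\<dots> \<subseteq> ?N"
    proof -
      have "init_term lt f \<in> ?N" if f: "f \<in> set (Matrix.cols F)" "f \<noteq> 0\<^sub>v p" for f
      proof -
        obtain t where t: "t < m" "f = col F t" using f dims by (auto simp: cols_def)
        have "mmon_dvd (im t) (im t)" by (auto simp: mmon_dvd_def intro: exI[of _ 0])
        then show ?thesis
          using init_term_supp[OF go cols[OF t(1)] nz(1)[OF t(1)]] t by auto
      qed
      then show ?thesis
        unfolding submodule_gen_def using submodule_leading[of p m im] by blast
    qed
    finally have "init_term lt remainder \<in> ?N" .
    then obtain t where "t < m" "mmon_dvd (im t) (init_mon lt remainder)"
      using init_term_supp(2)[OF go remainder_R nz'] by auto
    then show False using remainder_supp[OF init_term_supp(3)[OF go remainder_R nz']] by blast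
  qed
  moreover have "F *\<^sub>v quot \<in> carrier_vec p" using F by (auto simp: quot_def)
  ultimately have "g = F *\<^sub>v quot"
    using division_eq by (metis right_zero_vec)
  then show ?thesis using quot_R quot_degree[OF deg] by blast
qed

text \<open>For a nonzero vector over a good order this is its P-order, because
  \<open>graded\<close> makes the initial monomial one of least weighted degree.\<close>

definition init_degree :: "(nat \<Rightarrow> nat) \<Rightarrow> (mmon \<Rightarrow> mmon \<Rightarrow> bool) \<Rightarrow> 'k mps vec \<Rightarrow> nat" where
  "init_degree a lt f = pdeg c (fst (init_mon lt f)) + a (snd (init_mon lt f))"

lemma init_degree_le:
  assumes go: "good_order n c p a lt" and f: "f \<in> carrier (free_module R p)"
    and "(\<alpha>, l) \<in> vec_supp f"
  shows "init_degree a lt f \<le> pdeg c \<alpha> + a l"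
proof -
  interpret good_order n c p a lt by fact
  have mm: "vec_supp f \<subseteq> mmons n p" by (rule vec_supp_mmons[OF f])
  have ne: "vec_supp f \<noteq> {}" using assms(3) by blast
  obtain \<beta> j where \<beta>: "init_mon lt f = (\<beta>, j)" by fastforce
  show ?thesis
  proof (cases "(\<alpha>, l) = init_mon lt f")
    case True
    then show ?thesis by (simp add: init_degree_def flip: True)
  next
    case False
    then have "lt (\<beta>, j) (\<alpha>, l)" using init_mon_least(2)[OF mm ne assms(3)] \<beta> by simp
    moreover have "(\<beta>, j) \<in> mmons n p" "(\<alpha>, l) \<in> mmons n p"
      using init_mon_least(1)[OF mm ne] mm assms(3) \<beta> by auto
    ultimately show ?thesis using graded[of \<beta> j \<alpha> l] \<beta> by (simp add: init_degree_def)
  qed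
qed

text \<open>Finiteness of this value gives \<open>the_enat\<close> in \<open>level_ord\<close> its
  meaning. The equality ties the weights, defined through orders of vectors, to the degrees of
  initial monomials that appear in the division estimate.\<close>

lemma ord_P_vec_eq:
  assumes go: "good_order n c p a lt" and f: "f \<in> carrier (free_module R p)" "f \<noteq> 0\<^sub>v p"
  shows "ord_P_vec R c a f = enat (init_degree a lt f)"
proof (rule antisym)
  have dim: "dim_vec f = p" using f by (simp add: carrier_free_module)
  obtain \<beta> j where \<beta>: "init_mon lt f = (\<beta>, j)" by fastforce
  have \<beta>f: "(\<beta>, j) \<in> vec_supp f" using init_term_supp(3)[OF go f] \<beta> by simp
  then have j: "j < p" "mps_coeff (f $ j) \<beta> \<noteq> 0" using dim by (auto simp: vec_supp_def)
  have "ord_P R c (f $ j) \<le> enat (pdeg c \<beta>)"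
    unfolding ord_P_def by (rule Sup_least) (use j in \<open>auto simp: P_power_eq\<close>)
  then have "ord_P R c (f $ j) + enat (a j) \<le> enat (pdeg c \<beta>) + enat (a j)"
    by (rule add_right_mono)
  also have "\<dots> = enat (init_degree a lt f)" by (simp add: init_degree_def \<beta>)
  finally show "ord_P_vec R c a f \<le> enat (init_degree a lt f)"
    unfolding ord_P_vec_def using j dim by (intro INF_lower2[of j]) auto
  show "enat (init_degree a lt f) \<le> ord_P_vec R c a f"
    unfolding ord_P_vec_def dim
  proof (rule INF_greatest)
    fix l assume l: "l \<in> {..<p}"
    \<comment> \<open>Truncated subtraction: if the weight of the component already exceeds the
      degree, then e = 0 and the power in question is the whole ring.\<close>
    define e where "e = init_degree a lt f - a l"
    have "f $ l \<in> P_power R c (int e)"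
      unfolding P_power_eq
    proof (intro CollectI conjI allI impI)
      show "f $ l \<in> R" using f l by (simp add: carrier_free_module)
      fix \<alpha> assume "mps_coeff (f $ l) \<alpha> \<noteq> 0"
      then have "(\<alpha>, l) \<in> vec_supp f" using l dim by (simp add: vec_supp_def)
      from init_degree_le[OF go f(1) this] show "int e \<le> int (pdeg c \<alpha>)" by (simp add: e_def)
    qed
    then have "enat e \<le> ord_P R c (f $ l)" unfolding ord_P_def by (intro Sup_upper) auto
    then have "enat e + enat (a l) \<le> ord_P R c (f $ l) + enat (a l)" by (rule add_right_mono)
    moreover have "enat (init_degree a lt f) \<le> enat e + enat (a l)" by (simp add: e_def)
    ultimately show "enat (init_degree a lt f) \<le> ord_P R c (f $ l) + enat (a l)" by (rule order.trans[rotated])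
  qed
qed

text \<open>Evaluates the initial monomials inside \<open>schreyer_less\<close>: compatibility
  carries the initial monomial along with the factor, so the order becomes a comparison of
  translated exponents.\<close>

lemma init_mon_monom_smult:
  assumes go: "good_order n c p a lt" and f: "f \<in> carrier (free_module R p)" "f \<noteq> 0\<^sub>v p"
    and \<gamma>: "\<gamma> \<in> mons n"
  shows "init_mon lt (mps_monom \<gamma> 1 \<cdot>\<^sub>v f) = (\<gamma> + fst (init_mon lt f), snd (init_mon lt f))"
proof -
  interpret good_order n c p a lt by fact
  have dim: "dim_vec f = p" using f by (simp add: carrier_free_module)
  have ne: "vec_supp f \<noteq> {}" using f(2) dim by (simp add: vec_supp_eq_empty_iff)
  have mm: "vec_supp f \<subseteq> mmons n p" by (rule vec_supp_mmons[OF f(1)])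
  have supp: "(\<alpha>, l) \<in> vec_supp (mps_monom \<gamma> 1 \<cdot>\<^sub>v f) \<longleftrightarrow> (\<exists>\<beta>. \<alpha> = \<gamma> + \<beta> \<and> (\<beta>, l) \<in> vec_supp f)" for \<alpha> l
  proof (cases "\<exists>\<beta>. \<alpha> = \<gamma> + \<beta>")
    case True
    then obtain \<beta> where "\<alpha> = \<gamma> + \<beta>" by blast
    then show ?thesis
      using mps_coeff_monom_times[of \<gamma> 1 "f $ l" \<beta>] by (auto simp: vec_supp_def)
  next
    case False
    then show ?thesis
      using mps_coeff_monom_times_eq_0[OF False, of 1 "f $ l"] by (auto simp: vec_supp_def)
  qed
  obtain \<beta> j where \<beta>: "init_mon lt f = (\<beta>, j)" by fastforce
  have \<beta>f: "(\<beta>, j) \<in> vec_supp f" using init_mon_least(1)[OF mm ne] \<beta> by simp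
  show ?thesis
    unfolding \<beta> fst_conv snd_conv
  proof (rule init_mon_unique)
    show "vec_supp (mps_monom \<gamma> 1 \<cdot>\<^sub>v f) \<subseteq> mmons n p"
      by (intro vec_supp_mmons free_module_closed R_monom \<gamma> f)
    show "(\<gamma> + \<beta>, j) \<in> vec_supp (mps_monom \<gamma> 1 \<cdot>\<^sub>v f)" using \<beta>f supp by blast
    fix \<nu> assume \<nu>: "\<nu> \<in> vec_supp (mps_monom \<gamma> 1 \<cdot>\<^sub>v f)" "\<nu> \<noteq> (\<gamma> + \<beta>, j)"
    obtain \<alpha> l where \<nu>': "\<nu> = (\<alpha>, l)" by fastforce
    then obtain \<delta> where \<delta>: "\<alpha> = \<gamma> + \<delta>" "(\<delta>, l) \<in> vec_supp f" using \<nu>(1) supp by blast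
    then have "(\<delta>, l) \<noteq> (\<beta>, j)" using \<nu>(2) \<nu>' by auto
    then have "lt (\<beta>, j) (\<delta>, l)" using init_mon_least(2)[OF mm ne \<delta>(2)] \<beta> by simp
    then show "lt (\<gamma> + \<beta>, j) \<nu>" unfolding \<nu>' \<delta>(1) using mm \<beta>f \<delta>(2) \<gamma> by (intro compat) auto
  qed
qed

lemma good_order_schreyer:
  assumes go: "good_order n c p a lt"
    and cols: "\<And>t. t < m \<Longrightarrow> col F t \<in> carrier (free_module R p)"
    and nz: "\<And>t. t < m \<Longrightarrow> col F t \<noteq> 0\<^sub>v p"
    and a': "\<And>t. t < m \<Longrightarrow> a' t = init_degree a lt (col F t)"
  shows "good_order n c m a' (schreyer_less lt F)"
proof (rule good_order_induced[OF go, where \<sigma> = "\<lambda>t. fst (init_mon lt (col F t))" and \<iota> = "\<lambda>t. snd (init_mon lt (col F t))"])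
  fix t assume t: "t < m"
  show "(fst (init_mon lt (col F t)), snd (init_mon lt (col F t))) \<in> mmons n p"
    using init_term_supp(3)[OF go cols nz] vec_supp_mmons[OF cols] t by auto
  show "a' t = pdeg c (fst (init_mon lt (col F t))) + a (snd (init_mon lt (col F t)))"
    using a'[OF t] by (simp add: init_degree_def)
next
  fix \<alpha> \<beta> l l' assume *: "\<alpha> \<in> mons n" "\<beta> \<in> mons n" "l < m" "l' < m"
  show "schreyer_less lt F (\<alpha>, l) (\<beta>, l') \<longleftrightarrow>
    lt (\<alpha> + fst (init_mon lt (col F l)), snd (init_mon lt (col F l)))
       (\<beta> + fst (init_mon lt (col F l')), snd (init_mon lt (col F l'))) \<or>
    (\<alpha> + fst (init_mon lt (col F l)), snd (init_mon lt (col F l))) =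
       (\<beta> + fst (init_mon lt (col F l')), snd (init_mon lt (col F l'))) \<and> l < l'"
    unfolding schreyer_less_def fst_conv snd_conv Let_def
      init_mon_monom_smult[OF go cols[OF *(3)] nz[OF *(3)] *(1)]
      init_mon_monom_smult[OF go cols[OF *(4)] nz[OF *(4)] *(2)] by (rule refl)
qed

end

section \<open>Exactness\<close>

lemma mult_syzygies_eq_0:
  assumes "F \<in> carrier_mat p m" "F' \<in> carrier_mat m m'" "q \<in> carrier_vec m'"
    and cols: "\<And>t. t < m' \<Longrightarrow> F *\<^sub>v col F' t = 0\<^sub>v p"
  shows "F *\<^sub>v (F' *\<^sub>v q) = (0\<^sub>v p :: 'a::comm_ring_1 vec)"
proof -
  have "F * F' = 0\<^sub>m p m'"
  proof (rule eq_matI)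
    fix i j assume "i < dim_row (0\<^sub>m p m' :: 'a mat)" "j < dim_col (0\<^sub>m p m' :: 'a mat)"
    then have ij: "i < p" "j < m'" by auto
    then have "(F * F') $$ (i, j) = (F *\<^sub>v col F' j) $ i" using assms(1,2) by auto
    then show "(F * F') $$ (i, j) = 0\<^sub>m p m' $$ (i, j)" using cols[OF ij(2)] ij by simp
  qed (use assms in auto)
  moreover have "0\<^sub>m p m' *\<^sub>v q = 0\<^sub>v p"
    using assms(3) by (intro eq_vecI) auto
  ultimately show ?thesis using assoc_mult_mat_vec[OF assms(1,2,3)] by simp
qed

context conv_ring
begin

text \<open>Every monomial of a column has at least the weighted degree that its basis vector
  carries in the source, so multiplication never lowers the degree.\<close>

lemma mult_mat_vec_P_sum:
  assumes go: "good_order n c p a lt" and F: "F \<in> carrier_mat p m"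
    and cols: "\<And>t. t < m \<Longrightarrow> col F t \<in> carrier (free_module R p)"
    and a': "\<And>t. t < m \<Longrightarrow> a' t = init_degree a lt (col F t)"
    and q: "q \<in> carrier (P_sum R c m a' r)"
  shows "F *\<^sub>v q \<in> carrier (P_sum R c p a r)"
  unfolding carrier_P_sum
proof (intro conjI allI impI)
  have q': "q \<in> carrier (free_module R m)" using q by (simp add: carrier_P_sum)
  show "F *\<^sub>v q \<in> carrier (free_module R p)" by (rule mult_mat_vec_free_module[OF F cols q'])
  fix \<alpha> j assume "(\<alpha>, j) \<in> vec_supp (F *\<^sub>v q)"
  moreover have "q \<in> carrier_vec m" using q' by (simp add: carrier_free_module)
  ultimately obtain t \<beta> \<gamma> where t: "t < m" "\<alpha> = \<beta> + \<gamma>" "(\<beta>, j) \<in> vec_supp (col F t)"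
      "(\<gamma>, t) \<in> vec_supp q"
    using vec_supp_mult_mat_vec[OF F] by blast
  have "r \<le> int (pdeg c \<gamma> + a' t)" using q t(4) by (simp add: carrier_P_sum)
  moreover have "a' t \<le> pdeg c \<beta> + a j" using init_degree_le[OF go cols[OF t(1)] t(3)] a'[OF t(1)] by simp
  ultimately show "r \<le> int (pdeg c \<alpha> + a j)" by (simp add: t(2) pdeg_add)
qed

lemma mult_mat_vec_hom:
  assumes go: "good_order n c p a lt" and F: "F \<in> carrier_mat p m"
    and cols: "\<And>t. t < m \<Longrightarrow> col F t \<in> carrier (free_module R p)"
    and a': "\<And>t. t < m \<Longrightarrow> a' t = init_degree a lt (col F t)"
  shows "(*\<^sub>v) F \<in> hom (P_sum R c m a' r) (P_sum R c p a r)"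
proof (rule homI)
  fix x y assume *: "x \<in> carrier (P_sum R c m a' r)" "y \<in> carrier (P_sum R c m a' r)"
  then have "x \<in> carrier_vec m" "y \<in> carrier_vec m" by (auto simp: carrier_P_sum carrier_free_module)
  then show "F *\<^sub>v (x \<otimes>\<^bsub>P_sum R c m a' r\<^esub> y) = (F *\<^sub>v x) \<otimes>\<^bsub>P_sum R c p a r\<^esub> (F *\<^sub>v y)"
    using F by (simp add: P_sum_def mult_add_distrib_mat_vec)
qed (rule mult_mat_vec_P_sum[OF assms])

text \<open>Strictness of F for the filtrations: an element of M in the filtered target has a
  preimage in the filtered source, not merely in the free module. With M the ideal or a module of
  syzygies this yields exactness at the filtered ring and at the filtered modules.\<close>

lemma image_P_sum:
  assumes go: "good_order n c p a lt" and F: "F \<in> carrier_mat p m"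
    and sb: "standard_basis R lt M F" and mm: "monic_minimal lt F"
    and M: "M \<subseteq> carrier (free_module R p)"
    and diff: "\<And>x y. x \<in> M \<Longrightarrow> y \<in> M \<Longrightarrow> x - y \<in> M"
    and gen: "\<And>q. q \<in> carrier (free_module R m) \<Longrightarrow> F *\<^sub>v q \<in> M"
    and a': "\<And>t. t < m \<Longrightarrow> a' t = init_degree a lt (col F t)"
  shows "(*\<^sub>v) F ` carrier (P_sum R c m a' r) = M \<inter> carrier (P_sum R c p a r)"
proof (intro equalityI subsetI)
  have cols: "col F t \<in> carrier (free_module R p)" if "t < m" for t
  proof -
    have "col F t \<in> set (Matrix.cols F)" using that F by (simp add: cols_def)
    then show ?thesis using sb M by (auto simp: standard_basis_def)
  qed
  fix x assume "x \<in> (*\<^sub>v) F ` carrier (P_sum R c m a' r)"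
  then obtain q where q: "x = F *\<^sub>v q" "q \<in> carrier (P_sum R c m a' r)" by blast
  then have "q \<in> carrier (free_module R m)" by (simp add: carrier_P_sum)
  then show "x \<in> M \<inter> carrier (P_sum R c p a r)"
    using gen mult_mat_vec_P_sum[OF go F cols a' q(2)] q(1) by blast
next
  fix g assume g: "g \<in> M \<inter> carrier (P_sum R c p a r)"
  \<comment> \<open>\<open>nat\<close> replaces a negative r by 0, which is harmless because degrees
    are natural numbers.\<close>
  have deg: "nat r \<le> pdeg c \<alpha> + a j" if "(\<alpha>, j) \<in> vec_supp g" for \<alpha> j
    using g that by (auto simp: carrier_P_sum nat_le_iff)
  obtain q where q: "q \<in> carrier (free_module R m)" "g = F *\<^sub>v q"
    and qdeg: "\<And>\<beta> t. (\<beta>, t) \<in> vec_supp q \<Longrightarrow> nat r \<le> pdeg c \<beta> + init_degree a lt (col F t)"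
    using standard_basis_lift[OF go F sb mm M _ _ deg] diff gen g unfolding init_degree_def by blast
  have "q \<in> carrier (P_sum R c m a' r)"
    unfolding carrier_P_sum
  proof (intro conjI allI impI q(1))
    fix \<beta> t assume *: "(\<beta>, t) \<in> vec_supp q"
    then have "t < m" using q(1) by (auto simp: vec_supp_def carrier_free_module)
    then show "r \<le> int (pdeg c \<beta> + a' t)" using qdeg[OF *] a' by (simp add: nat_le_iff)
  qed
  then show "g \<in> (*\<^sub>v) F ` carrier (P_sum R c m a' r)" using q(2) by blast
qed

lemma vecs1_ideal_free_module: "ideal I (series_ring R) \<Longrightarrow> vecs1 I \<subseteq> carrier (free_module R 1)"
  using ideal.Icarr[of I "series_ring R"] by (auto simp: vecs1_def carrier_free_module series_ring_def)

lemma ideal_closed: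
  assumes "ideal I (series_ring R)"
  shows "0 \<in> I" "x \<in> I \<Longrightarrow> y \<in> I \<Longrightarrow> x + y \<in> I" "x \<in> I \<Longrightarrow> - x \<in> I" "x \<in> I \<Longrightarrow> y \<in> R \<Longrightarrow> x * y \<in> I"
proof -
  interpret ideal I "series_ring R" by fact
  show "0 \<in> I" using additive_subgroup.zero_closed[OF additive_subgroup_axioms] by (simp add: series_ring_def)
  show "x \<in> I \<Longrightarrow> y \<in> I \<Longrightarrow> x + y \<in> I" using additive_subgroup.a_closed[OF additive_subgroup_axioms, of x y] by (simp add: series_ring_def)
  show mult: "x * y \<in> I" if "x \<in> I" "y \<in> R" for x y using I_r_closed[of x y] that by (simp add: series_ring_def)
  show "x \<in> I \<Longrightarrow> - x \<in> I" using mult[of x "-1"] R_uminus[OF R_1] by simp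
qed

lemma image_P_sum_ideal:
  assumes go: "good_order n c 1 a lt" and F: "F \<in> carrier_mat 1 m"
    and sb: "standard_basis R lt (vecs1 I) F" and mm: "monic_minimal lt F"
    and I: "ideal I (series_ring R)"
    and a': "\<And>t. t < m \<Longrightarrow> a' t = init_degree a lt (col F t)"
  shows "(*\<^sub>v) F ` carrier (P_sum R c m a' r) = vecs1 I \<inter> carrier (P_sum R c 1 a r)"
proof (rule image_P_sum[OF go F sb mm vecs1_ideal_free_module[OF I] _ _ a'])
  fix x y assume "x \<in> vecs1 I" "y \<in> vecs1 I"
  then show "x - y \<in> vecs1 I"
    using ideal_closed[OF I] by (auto simp: vecs1_def diff_conv_add_uminus simp del: add_uminus_conv_diff)
next
  fix q assume q: "q \<in> carrier (free_module R m)"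
  have Ft: "F $$ (0, t) \<in> I" if "t < m" for t
  proof -
    have "col F t \<in> set (Matrix.cols F)" using that F by (simp add: cols_def)
    then have "col F t \<in> vecs1 I" using sb by (auto simp: standard_basis_def)
    then show ?thesis using that F by (auto simp: vecs1_def)
  qed
  have "(\<Sum>t<k. F $$ (0, t) * q $ t) \<in> I" if "k \<le> m" for k
    using that
  proof (induction k)
    case 0
    then show ?case using ideal_closed(1)[OF I] by simp
  next
    case (Suc k)
    then show ?case
      using ideal_closed(2,4)[OF I] Ft[of k] q by (auto simp: carrier_free_module)
  qed
  then have "(\<Sum>t<m. F $$ (0, t) * q $ t) \<in> I" by simp
  then show "F *\<^sub>v q \<in> vecs1 I"
    using mult_mat_vec_index[OF F, of q 0] F q by (auto simp: vecs1_def carrier_free_module)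
qed

text \<open>Exactness at an inner place. For m = 0 the image is zero, and the statement says that
  \<open>F\<^sub>0\<close> is injective on the filtered module.\<close>

lemma image_P_sum_syzygies:
  assumes go: "good_order n c p a lt" and F: "F \<in> carrier_mat p m" and F\<^sub>0: "F\<^sub>0 \<in> carrier_mat p\<^sub>0 p"
    and sb: "standard_basis R lt (syzygies R F\<^sub>0) F" and mm: "monic_minimal lt F"
    and a': "\<And>t. t < m \<Longrightarrow> a' t = init_degree a lt (col F t)"
  shows "(*\<^sub>v) F ` carrier (P_sum R c m a' r) = {g \<in> carrier (P_sum R c p a r). F\<^sub>0 *\<^sub>v g = 0\<^sub>v p\<^sub>0}"
proof -
  have syz: "x \<in> syzygies R F\<^sub>0 \<longleftrightarrow> x \<in> carrier (free_module R p) \<and> F\<^sub>0 *\<^sub>v x = 0\<^sub>v p\<^sub>0" for x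
    using F\<^sub>0 by (auto simp: syzygies_def)
  have cols: "col F t \<in> syzygies R F\<^sub>0" if "t < m" for t
  proof -
    have "col F t \<in> set (Matrix.cols F)" using that F by (simp add: cols_def)
    then show ?thesis using sb by (auto simp: standard_basis_def)
  qed
  have "(*\<^sub>v) F ` carrier (P_sum R c m a' r) = syzygies R F\<^sub>0 \<inter> carrier (P_sum R c p a r)"
  proof (rule image_P_sum[OF go F sb mm _ _ _ a'])
    show "syzygies R F\<^sub>0 \<subseteq> carrier (free_module R p)" using syz by blast
  next
    fix x y assume xy: "x \<in> syzygies R F\<^sub>0" "y \<in> syzygies R F\<^sub>0"
    then have v: "x \<in> carrier_vec p" "y \<in> carrier_vec p" by (auto simp: syz carrier_free_module)
    have "x - y \<in> carrier (free_module R p)"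
      using xy by (auto simp: syz carrier_free_module R_diff)
    moreover have "F\<^sub>0 *\<^sub>v (x - y) = 0\<^sub>v p\<^sub>0"
      using mult_minus_distrib_mat_vec[OF F\<^sub>0 v] xy by (simp add: syz)
    ultimately show "x - y \<in> syzygies R F\<^sub>0" by (simp add: syz)
  next
    fix q assume q: "q \<in> carrier (free_module R m)"
    have "F\<^sub>0 *\<^sub>v (F *\<^sub>v q) = 0\<^sub>v p\<^sub>0"
      by (rule mult_syzygies_eq_0[OF F\<^sub>0 F]) (use q cols in \<open>auto simp: carrier_free_module syz\<close>)
    moreover have "F *\<^sub>v q \<in> carrier (free_module R p)"
      by (rule mult_mat_vec_free_module[OF F _ q]) (use cols in \<open>simp add: syz\<close>)
    ultimately show "F *\<^sub>v q \<in> syzygies R F\<^sub>0" by (simp add: syz)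
  qed
  also have "\<dots> = {g \<in> carrier (P_sum R c p a r). F\<^sub>0 *\<^sub>v g = 0\<^sub>v p\<^sub>0}"
    by (auto simp: syz carrier_P_sum)
  finally show ?thesis .
qed

text \<open>The induction carries the columns and their monic initial terms along with the order:
  the next order is built from these columns, and it inherits goodness because they are nonzero
  vectors over R.\<close>

lemma schreyer_resolution_levels:
  assumes xs: "set xs = {..<c}" and ys: "set ys = {..<n}" and I: "ideal I (series_ring R)"
    and res: "schreyer_resolution R c xs ys I k F" and "i \<le> k"
  shows "good_order n c (dim_row (F i)) (level_ord R c F i) (level_less c xs ys F i) \<and>
    (\<forall>t<dim_col (F i). col (F i) t \<in> carrier (free_module R (dim_row (F i)))) \<and>
    monic_minimal (level_less c xs ys F i) (F i)"
  using \<open>i \<le> k\<close>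
proof (induction i)
  case 0
  have "set (cols (F 0)) \<subseteq> carrier (free_module R (dim_row (F 0)))"
    using res vecs1_ideal_free_module[OF I]
    by (auto simp: schreyer_resolution_def reduced_standard_basis_def standard_basis_def)
  then show ?case
    using res good_order_ring[OF c_le_n xs ys]
    by (auto simp: schreyer_resolution_def reduced_standard_basis_def cols_def)
next
  case (Suc i)
  let ?lt = "level_less c xs ys F i" and ?a = "level_ord R c F i"
  have IH: "good_order n c (dim_row (F i)) ?a ?lt"
    "\<And>t. t < dim_col (F i) \<Longrightarrow> col (F i) t \<in> carrier (free_module R (dim_row (F i)))"
    "monic_minimal ?lt (F i)"
    using Suc by auto
  have nz: "col (F i) t \<noteq> 0\<^sub>v (dim_row (F i))" if "t < dim_col (F i)" for t
    using IH(3) that by (simp add: monic_minimal_def)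
  have step: "schreyer_step R ?lt (F i) (F (Suc i))"
    using res Suc.prems by (simp add: schreyer_resolution_def)
  have "good_order n c (dim_col (F i)) (level_ord R c F (Suc i)) (schreyer_less ?lt (F i))"
    by (rule good_order_schreyer[OF IH(1,2) nz]) (simp_all add: ord_P_vec_eq[OF IH(1,2) nz])
  moreover have "set (cols (F (Suc i))) \<subseteq> syzygies R (F i)"
    using step by (auto simp: schreyer_step_def standard_basis_def)
  then have "set (cols (F (Suc i))) \<subseteq> carrier (free_module R (dim_col (F i)))"
    by (auto simp: syzygies_def)
  then have "\<forall>t<dim_col (F (Suc i)). col (F (Suc i)) t \<in> carrier (free_module R (dim_col (F i)))"
    by (auto simp: cols_def)
  ultimately show ?case
    using step by (simp add: schreyer_step_def)
qed

end

section \<open>Assembly of the filtered sequence\<close>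

lemma zero_group_group: "group (zero_group :: 'k::field mps vec monoid)"
  by (rule groupI) (auto simp: zero_group_def)

lemma normal_quotient:
  assumes "comm_group G" "subgroup N G"
  shows "group_hom G (G Mod N) (\<lambda>u. N #>\<^bsub>G\<^esub> u) \<and> kernel G (G Mod N) (\<lambda>u. N #>\<^bsub>G\<^esub> u) = N \<and>
    (\<lambda>u. N #>\<^bsub>G\<^esub> u) ` carrier G = carrier (G Mod N)"
proof -
  interpret comm_group G by fact
  have N: "N \<lhd> G" by (rule subgroup_imp_normal[OF assms(2)])
  have "group_hom G (G Mod N) (\<lambda>u. N #>\<^bsub>G\<^esub> u)"
    by (intro group_hom.intro group_hom_axioms.intro is_group
        normal.factorgroup_is_group[OF N] normal.r_coset_hom_Mod[OF N])
  moreover have "kernel G (G Mod N) (\<lambda>u. N #>\<^bsub>G\<^esub> u) = N"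
    using coset_join1[OF _ _ assms(2)] coset_join2[OF _ assms(2)] subgroup.subset[OF assms(2)]
    by (auto simp: kernel_def FactGroup_def)
  moreover have "(\<lambda>u. N #>\<^bsub>G\<^esub> u) ` carrier G = carrier (G Mod N)"
    by (auto simp: FactGroup_def RCOSETS_def)
  ultimately show ?thesis by blast
qed

text \<open>\<open>exact_seq\<close> imposes no kernel or image condition at the head of its list,
  so exactness at P^r and at the quotient is stated separately; cosets are sets of vectors, hence
  the projection has another type than the listed maps. The trailing zero group encodes injectivity
  of the last matrix.\<close>

theorem lemma2p9:
  fixes n c k :: nat and xs ys :: "nat list" and r :: int
    and R I :: "'k::field mps set" and F :: "nat \<Rightarrow> 'k mps mat"
  assumes "c \<le> n"
    and "distinct xs" and "set xs = {..<c}"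
    and "distinct ys" and "set ys = {..<n}"
    and "R = formal_series n \<or>
         (\<exists>v. complete_absolute_value v \<and> R = convergent_series v n)"
    and "ideal I (series_ring R)"
    and "schreyer_resolution R c xs ys I k F"
  shows
    "let P_r = P_sum R c 1 (\<lambda>_. 0) r;
         G = (\<lambda>i. P_sum R c (dim_col (F i)) (schreyer_ord R c F i) r);
         Q = P_r Mod vecs1 (P_power R c r \<inter> I);
         \<pi> = (\<lambda>u. vecs1 (P_power R c r \<inter> I) #>\<^bsub>P_r\<^esub> u)
     in exact_seq (P_r # map G [0..<Suc k] @ [zero_group],
                   map (\<lambda>i. (*\<^sub>v) (F i)) [0..<Suc k] @ [\<lambda>_. 0\<^sub>v (dim_col (F k))]) \<and>
        group_hom P_r Q \<pi> \<and>
        kernel P_r Q \<pi> = (*\<^sub>v) (F 0) ` carrier (G 0) \<and>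
        \<pi> ` carrier P_r = carrier Q"
proof -
  obtain v where "conv_ring v n c R" using conv_ring_cases[OF assms(1,6)] by blast
  then interpret conv_ring v n c R .
  define P_r where "P_r = P_sum R c 1 (\<lambda>_. 0) r"
  define G where "G = (\<lambda>i. P_sum R c (dim_col (F i)) (schreyer_ord R c F i) r)"
  define N where "N = vecs1 (P_power R c r \<inter> I)"
  note res = assms(8)
  note levels = schreyer_resolution_levels[OF assms(3,5,7) res]
  let ?p = "\<lambda>i. dim_row (F i)" and ?m = "\<lambda>i. dim_col (F i)"
  let ?lt = "level_less c xs ys F" and ?a = "level_ord R c F"
  have F: "F i \<in> carrier_mat (?p i) (?m i)" for i by auto
  have go: "good_order n c (?p i) (?a i) (?lt i)"
    and cols: "\<And>t. t < ?m i \<Longrightarrow> col (F i) t \<in> carrier (free_module R (?p i))"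
    and mm: "monic_minimal (?lt i) (F i)" if "i \<le> k" for i
    using levels[OF that] by auto
  have nz: "col (F i) t \<noteq> 0\<^sub>v (?p i)" if "i \<le> k" "t < ?m i" for i t
    using mm[OF that(1)] that(2) by (simp add: monic_minimal_def)
  have a: "?a (Suc i) t = init_degree (?a i) (?lt i) (col (F i) t)" if "i \<le> k" "t < ?m i" for i t
    using ord_P_vec_eq[OF go[OF that(1)] cols[OF that] nz[OF that]] by simp
  have p0: "?p 0 = 1" using res by (simp add: schreyer_resolution_def)
  have step: "schreyer_step R (?lt i) (F i) (F (Suc i))" if "i < k" for i
    using res that by (simp add: schreyer_resolution_def)
  have p_Suc: "?p (Suc i) = ?m i" if "i < k" for i
    using step[OF that] by (simp add: schreyer_step_def)
  have G: "G i = P_sum R c (?m i) (?a (Suc i)) r" for i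
    by (simp add: G_def schreyer_ord_def)
  \<comment> \<open>Numbering from the target makes position i \<le> k the filtered module that
    contains the columns of F i, in line with \<open>level_ord\<close>; G is therefore shifted by
    one.\<close>
  define H where "H j = (if j = 0 then P_r else if j \<le> Suc k then G (j - 1) else zero_group)" for j
  define \<phi> where "\<phi> i = (if i \<le> k then (*\<^sub>v) (F i) else (\<lambda>_. 0\<^sub>v (?m k)))" for i
  have H: "H i = P_sum R c (?p i) (?a i) r" if "i \<le> k" for i
    using that by (cases i) (simp_all add: H_def P_r_def p0 G p_Suc del: level_ord.simps(2))
  have H_Suc: "H (Suc i) = P_sum R c (?m i) (?a (Suc i)) r" if "i \<le> k" for i
    using that by (simp add: H_def G)
  have group_P: "group (P_sum R c m w r)" for m w
    by (rule comm_group.axioms(2)[OF vec_group.comm_group_G[OF vec_group_P_sum]])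
  have ex: "exact_seq (map H [0..<Suc (Suc (Suc k))], map \<phi> [0..<Suc (Suc k)])"
  proof (rule exact_seqI)
    show grp: "group (H i)" for i
      by (simp add: H_def P_r_def G group_P zero_group_group)
    then show "group (H (Suc i))" for i .
    fix i assume i: "i < Suc (Suc k)"
    show "\<phi> i \<in> hom (H (Suc i)) (H i)"
    proof (cases "i \<le> k")
      case True
      show ?thesis unfolding H[OF True] H_Suc[OF True]
        using mult_mat_vec_hom[OF go[OF True] F cols[OF True] a[OF True]] True by (simp add: \<phi>_def)
    next
      case False
      then have "i = Suc k" using i by simp
      moreover have "(\<lambda>_. 0\<^sub>v (?m k)) \<in> hom zero_group (G k)"
        unfolding G by (rule homI) (auto simp: zero_group_def carrier_P_sum free_module_closed, simp add: P_sum_def)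
      ultimately show ?thesis by (simp add: \<phi>_def H_def)
    qed
  next
    fix i assume "Suc i < Suc (Suc k)"
    then have i: "i \<le> k" by simp
    have kernel: "kernel (H (Suc i)) (H i) (\<phi> i) =
        {g \<in> carrier (P_sum R c (?m i) (?a (Suc i)) r). F i *\<^sub>v g = 0\<^sub>v (?p i)}"
      unfolding H[OF i] H_Suc[OF i] kernel_def using i by (simp add: \<phi>_def P_sum_def)
    show "kernel (H (Suc i)) (H i) (\<phi> i) = \<phi> (Suc i) ` carrier (H (Suc (Suc i)))"
    proof (cases "i < k")
      case True
      then have Suc: "Suc i \<le> k" by simp
      have go': "good_order n c (?m i) (?a (Suc i)) (?lt (Suc i))"
        using go[OF Suc] p_Suc[OF True] by (simp del: level_ord.simps level_less.simps)
      have F': "F (Suc i) \<in> carrier_mat (?m i) (?m (Suc i))" using p_Suc[OF True] by auto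
      have sb: "standard_basis R (?lt (Suc i)) (syzygies R (F i)) (F (Suc i))"
        using step[OF True] by (simp add: schreyer_step_def)
      from image_P_sum_syzygies[OF go' F' F sb mm[OF Suc] a[OF Suc], of r] show ?thesis
        unfolding kernel H_Suc[OF Suc] using Suc by (simp add: \<phi>_def del: level_ord.simps)
    next
      case False
      then have ik: "i = k" using i by simp
      \<comment> \<open>Termination means that the matrix without columns is a standard basis of the
        syzygies of F k. Read as one more step, it has the filtered module of rank 0 as source,
        which is the zero group, and so the kernel is zero.\<close>
      let ?F = "0\<^sub>m (?m k) 0 :: 'k mps mat"
      have last: "schreyer_step R (?lt k) (F k) ?F" using res by (simp add: schreyer_resolution_def)
      \<comment> \<open>\<open>levels\<close> reaches only level k, so the order on the source of F
        k needs one further Schreyer passage.\<close>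
      have go': "good_order n c (?m k) (?a (Suc k)) (?lt (Suc k))"
        using good_order_schreyer[OF go[OF order.refl] cols[OF order.refl] nz[OF order.refl] a[OF order.refl]]
        by simp
      have "(*\<^sub>v) ?F ` carrier (P_sum R c 0 (\<lambda>_. 0) r) =
          {g \<in> carrier (P_sum R c (?m k) (?a (Suc k)) r). F k *\<^sub>v g = 0\<^sub>v (?p k)}"
        using last by (intro image_P_sum_syzygies[OF go' _ F]) (auto simp: schreyer_step_def)
      moreover have "carrier (P_sum R c 0 (\<lambda>_. 0) r) = {0\<^sub>v 0}" by (auto simp: P_sum_def)
      moreover have "?F *\<^sub>v 0\<^sub>v 0 = 0\<^sub>v (?m k)" by (intro eq_vecI) auto
      ultimately show ?thesis unfolding kernel unfolding ik by (simp add: \<phi>_def H_def zero_group_def)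
    qed
  qed simp
  have objects: "map H [0..<Suc (Suc (Suc k))] = P_r # map G [0..<Suc k] @ [zero_group]"
    by (rule nth_equalityI) (auto simp: H_def nth_Cons nth_append simp del: upt_Suc split: nat.split)
  have maps: "map \<phi> [0..<Suc (Suc k)] = map (\<lambda>i. (*\<^sub>v) (F i)) [0..<Suc k] @ [\<lambda>_. 0\<^sub>v (?m k)]"
    by (rule nth_equalityI) (auto simp: \<phi>_def nth_append simp del: upt_Suc)
  have exact: "exact_seq (P_r # map G [0..<Suc k] @ [zero_group],
      map (\<lambda>i. (*\<^sub>v) (F i)) [0..<Suc k] @ [\<lambda>_. 0\<^sub>v (?m k)])"
    using ex unfolding objects maps .
  \<comment> \<open>The filtered ideal as M intersected with the filtered module, the shape in which
    \<open>image_P_sum_ideal\<close> delivers the image of F 0.\<close>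
  have N: "N = vecs1 I \<inter> carrier P_r"
    unfolding N_def P_r_def by (auto simp: vecs1_def P_sum_def)
  have "subgroup N P_r"
    unfolding P_r_def
  proof (rule vec_group.subgroup_vecs[OF vec_group_P_sum])
    interpret P: vec_group "P_sum R c 1 (\<lambda>_. 0) r" 1 by (rule vec_group_P_sum)
    show "N \<subseteq> carrier (P_sum R c 1 (\<lambda>_. 0) r)" using N P_r_def by blast
    show "0\<^sub>v 1 \<in> N" using P.zero_G ideal_closed[OF assms(7)] by (auto simp: N P_r_def vecs1_def)
    show "x + y \<in> N" if "x \<in> N" "y \<in> N" for x y
      using that P.add_G ideal_closed[OF assms(7)] by (auto simp: N P_r_def vecs1_def)
    show "- x \<in> N" if "x \<in> N" for x
      using that P.uminus_G ideal_closed[OF assms(7)] by (auto simp: N P_r_def vecs1_def)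
  qed
  moreover have "comm_group P_r"
    unfolding P_r_def using vec_group_P_sum by (rule vec_group.comm_group_G)
  ultimately have quot: "group_hom P_r (P_r Mod N) (\<lambda>u. N #>\<^bsub>P_r\<^esub> u)"
    "kernel P_r (P_r Mod N) (\<lambda>u. N #>\<^bsub>P_r\<^esub> u) = N"
    "(\<lambda>u. N #>\<^bsub>P_r\<^esub> u) ` carrier P_r = carrier (P_r Mod N)"
    using normal_quotient by blast+
  have "N = (*\<^sub>v) (F 0) ` carrier (G 0)"
  proof -
    have sb: "standard_basis R (?lt 0) (vecs1 I) (F 0)"
      using res by (simp add: schreyer_resolution_def reduced_standard_basis_def)
    have go0: "good_order n c 1 (?a 0) (?lt 0)" using go[OF le0] unfolding p0 .
    have F0: "F 0 \<in> carrier_mat 1 (?m 0)" using F[of 0] unfolding p0 .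
    from image_P_sum_ideal[OF go0 F0 sb mm[OF le0] assms(7) a[OF le0], of r] show ?thesis
      unfolding N P_r_def G level_ord.simps(1) by (rule sym)
  qed
  then show ?thesis
    using exact quot unfolding Let_def P_r_def[symmetric] N_def[symmetric] G_def[symmetric] by metis
qed

end
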